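(* The AF subalgebra $C=\overline{\bigcup_{i=0}^\infty C_i}$ of $C^*(G)$ (with the finite dimensional subalgebras $C_i$ as defined in the context) is proper, i.e. $C\ne C^*(G)$.
   Context: Category $\Lambda$. Fix nonnegative integers $k_1,k_2,\ldots$ with $k_i>0$ for infinitely many $i$. $\Lambda$ is the small category with units (objects) $v_1,v_2,\ldots$, generated by edges $\alpha_i$, $\beta_i$, $\gamma_i^{(j)}$ ($i\ge1$, $1\le j\le k_i$), each having range $v_i$ and source $v_{i+1}$, subject only to the relations $\alpha_i\beta_{i+1}=\beta_i\alpha_{i+1}$ for all $i\ge1$. A product $\mu\nu$ is defined iff $s(\mu)=r(\nu)$. $\Lambda_1$ (resp. $\Lambda_2$) is the subcategory generated by the edges $\alpha_i,\beta_i$ (resp. $\gamma_i^{(j)}$). $|\lambda|$ is the number of edges in $\lambda$; $v\Lambda=\{\lambda: r(\lambda)=v\}$. Subscripts on edges are dropped when determined by context. For $\lambda\in v_1\Lambda$ with $|\lambda|=n$ write $\lambda=\lambda_1\cdots\lambda_n$ as a product of edges; whether $\lambda_j$ lies in $\Lambda_2$ does not depend on the choice of factorization. Directed hereditary sets. $[\nu]=\{\mu\in\Lambda:\nu\in\mu\Lambda\}$ where $\mu\Lambda=\{\mu\eta:r(\eta)=s(\mu)\}$. A subset $x\subseteq\Lambda$ is directed if $x\cap\mu\Lambda\cap\nu\Lambda\ne\varnothing$ for all $\mu,\nu\in x$, and hereditary if $[\mu]\subseteq x$ for all $\mu\in x$. $\Lambda^*$ is the set of nonempty directed hereditary subsets;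 all elements of $x\in\Lambda^*$ have the same range $r(x)$. $\Lambda^*$ has the locally compact Hausdorff topology with base $\{Z(\lambda)\setminus\bigcup_{i=1}^kZ(\mu_i)\}$, where $Z(\mu)=\{x\in\Lambda^*:\mu\in x\}$. $\Lambda^{**}$ is the set of maximal elements of $\Lambda^*$ under inclusion, $\partial\Lambda=\overline{\Lambda^{**}}$, $v\partial\Lambda=\{x\in\partial\Lambda:r(x)=v\}$. For $r(x)=s(\mu)$, $\mu x=\bigcup_{\nu\in x}[\mu\nu]$. Below, $Z(\mu)$ denotes $\{x\in\partial\Lambda:\mu\in x\}$. Groupoid $G$. Put $X=v_1\partial\Lambda$. $G$ is the set of equivalence classes $[\mu,\nu,x]$ of triples with $\mu,\nu\in v_1\Lambda$, $s(\mu)=s(\nu)$, $x\in s(\mu)\partial\Lambda$, for the equivalence relation generated by $(\mu,\nu,\eta x)\sim(\mu\eta,\nu\eta,x)$, with $s([\mu,\nu,x])=\nu x$, $r([\mu,\nu,x])=\mu x$, $[\mu,\nu,x]^{-1}=[\nu,\mu,x]$, $[\mu,\nu,x][\nu,\eta,x]=[\mu,\eta,x]$. Its unit space is identified with $X$, and the sets $[\mu,\nu,E]=\{[\mu,\nu,x]:x\in E\}$, $E\subseteq s(\mu)\partial\Lambda$ compact open, form a base of its topology; $G$ is an ample Hausdorff étale groupoid. The subalgebras $C_i$. For $i\ge0$: $\Phi_i=\{\lambda\in v_1\Lambda:|\lambda|\le i,\ \lambda_{|\lambda|}\in\Lambda_2\}$, where $v_1$ is counted as an element of $\Phi_i$;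 $E_i=\{\mu\in v_1\Lambda:|\mu|=i\}$; $F_i=\{\eta\beta^q:\eta\in\Phi_i,\ |\eta|+q=i+1\}$. $C_i\subseteq C^*(G)$ is the linear span of the partial isometries $\chi_{[\nu,\mu,\,Z(v_{i+1})\setminus Z(\beta_{i+1})]}$ for $\mu,\nu\in E_i$ and $\chi_{[\eta,\xi,\,Z(v_{i+2})]}$ for $\xi,\eta\in F_i$ (characteristic functions of compact open bisections, viewed in $C_c(G)\subseteq C^*(G)$). These are matrix units giving $C_i\cong M_{|E_i|}\oplus M_{|F_i|}$, and $C_i\subseteq C_{i+1}$. *)

theory Defs
  imports "HOL-Analysis.Analysis"
begin

section \<open>The category \<Lambda>\<close>

text \<open>
  The subscript of an edge is determined by its position in a path, so a path is given by the
  index of its range together with a word in unsubscripted edges: the pair \<open>(i, [e\<^sub>0, e\<^sub>1, \<dots>])\<close>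
  stands for the product of \<open>e\<^sub>0\<close> at level \<open>i\<close>, \<open>e\<^sub>1\<close> at level \<open>i + 1\<close>, and so on; the
  pair \<open>(i, [])\<close> stands for the object \<open>v\<^sub>i\<close>.  A level \<open>i\<close> edge has range \<open>v\<^sub>i\<close> and
  source \<open>v\<^sub>i\<^sub>+\<^sub>1\<close>.  Morphisms are paths modulo the congruence generated by
  \<open>\<alpha>\<^sub>i \<beta>\<^sub>i\<^sub>+\<^sub>1 = \<beta>\<^sub>i \<alpha>\<^sub>i\<^sub>+\<^sub>1\<close>.
\<close>

datatype edge = Alpha | Beta | Gamma nat

inductive swap :: "edge list \<Rightarrow> edge list \<Rightarrow> bool" where
  "swap (u @ [Alpha, Beta] @ w) (u @ [Beta, Alpha] @ w)"

quotient_type word = "edge list" / "equivclp swap"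
  by (rule equivp_evquivclp)

lemma swap_append: "swap a b \<Longrightarrow> swap (c @ a @ d) (c @ b @ d)"
  by (erule swap.cases) (metis append.assoc swap.intros)

lemma equivclp_swap_append: "equivclp swap a b \<Longrightarrow> equivclp swap (c @ a @ d) (c @ b @ d)"
  by (induction rule: equivclp_induct)
    (auto intro: equivclp_trans swap_append r_into_equivclp converse_r_into_equivclp)

lemma equivclp_swap_length: "equivclp swap a b \<Longrightarrow> length a = length b"
  by (induction rule: equivclp_induct) (auto elim: swap.cases)

lift_definition word_length :: "word \<Rightarrow> nat" is length
  by (rule equivclp_swap_length)

lift_definition word_append :: "word \<Rightarrow> word \<Rightarrow> word" is "(@)"
  using equivclp_swap_append[where c = "[]"] equivclp_swap_append[where d = "[]"]
  by (metis append_Nil append_Nil2 equivclp_trans)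

type_synonym mor = "nat \<times> word"

definition path :: "nat \<Rightarrow> edge list \<Rightarrow> mor" where
  "path i w = (i, abs_word w)"

definition vertex :: "nat \<Rightarrow> mor" where
  "vertex i = path i []"

definition rng :: "mor \<Rightarrow> nat" where
  "rng \<mu> = fst \<mu>"

definition len :: "mor \<Rightarrow> nat" where
  "len \<mu> = word_length (snd \<mu>)"

definition src :: "mor \<Rightarrow> nat" where
  "src \<mu> = rng \<mu> + len \<mu>"

text \<open>The product; meaningful only if \<open>src \<mu> = rng \<nu>\<close>.\<close>

definition mcomp :: "mor \<Rightarrow> mor \<Rightarrow> mor" where
  "mcomp \<mu> \<nu> = (fst \<mu>, word_append (snd \<mu>) (snd \<nu>))"

text \<open>The parameter \<open>k\<close> is the sequence \<open>k\<^sub>1, k\<^sub>2, \<dots>\<close>; the value \<open>k 0\<close> is never used.\<close>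

definition Lam :: "(nat \<Rightarrow> nat) \<Rightarrow> mor set" where
  "Lam k = {path i w | i w.
     1 \<le> i \<and> (\<forall>p<length w. \<forall>j. w ! p = Gamma j \<longrightarrow> 1 \<le> j \<and> j \<le> k (i + p))}"

definition Lam2 :: "(nat \<Rightarrow> nat) \<Rightarrow> mor set" where
  "Lam2 k = {path i w | i w. path i w \<in> Lam k \<and> set w \<subseteq> range Gamma}"

definition vLam :: "(nat \<Rightarrow> nat) \<Rightarrow> nat \<Rightarrow> mor set" where
  "vLam k i = {\<rho>\<in>Lam k. rng \<rho> = i}"

section \<open>Directed hereditary sets and the boundary\<close>

definition extensions :: "(nat \<Rightarrow> nat) \<Rightarrow> mor \<Rightarrow> mor set" where
  "extensions k \<mu> = {mcomp \<mu> \<eta> | \<eta>. \<eta> \<in> Lam k \<and> rng \<eta> = src \<mu>}"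

definition segments :: "(nat \<Rightarrow> nat) \<Rightarrow> mor \<Rightarrow> mor set" where
  "segments k \<nu> = {\<mu>\<in>Lam k. \<nu> \<in> extensions k \<mu>}"

definition directed :: "(nat \<Rightarrow> nat) \<Rightarrow> mor set \<Rightarrow> bool" where
  "directed k x \<longleftrightarrow> (\<forall>\<mu>\<in>x. \<forall>\<nu>\<in>x. x \<inter> extensions k \<mu> \<inter> extensions k \<nu> \<noteq> {})"

definition hereditary :: "(nat \<Rightarrow> nat) \<Rightarrow> mor set \<Rightarrow> bool" where
  "hereditary k x \<longleftrightarrow> (\<forall>\<mu>\<in>x. segments k \<mu> \<subseteq> x)"

definition Lstar :: "(nat \<Rightarrow> nat) \<Rightarrow> mor set set" where
  "Lstar k = {x. x \<subseteq> Lam k \<and> x \<noteq> {} \<and> directed k x \<and> hereditary k x}"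

definition Zstar :: "(nat \<Rightarrow> nat) \<Rightarrow> mor \<Rightarrow> mor set set" where
  "Zstar k \<mu> = {x\<in>Lstar k. \<mu> \<in> x}"

definition Lstar_top :: "(nat \<Rightarrow> nat) \<Rightarrow> mor set topology" where
  "Lstar_top k = topology_generated_by
     {Zstar k \<rho> - (\<Union>\<mu>\<in>M. Zstar k \<mu>) | \<rho> M. \<rho> \<in> Lam k \<and> finite M \<and> M \<subseteq> Lam k}"

definition Lmax :: "(nat \<Rightarrow> nat) \<Rightarrow> mor set set" where
  "Lmax k = {x\<in>Lstar k. \<forall>y\<in>Lstar k. x \<subseteq> y \<longrightarrow> y = x}"

definition bd :: "(nat \<Rightarrow> nat) \<Rightarrow> mor set set" where
  "bd k = Lstar_top k closure_of Lmax k"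

definition bd_top :: "(nat \<Rightarrow> nat) \<Rightarrow> mor set topology" where
  "bd_top k = subtopology (Lstar_top k) (bd k)"

text \<open>All elements of a member of \<open>Lstar k\<close> have the same range, and it is nonempty.\<close>

definition vbd :: "(nat \<Rightarrow> nat) \<Rightarrow> nat \<Rightarrow> mor set set" where
  "vbd k i = {x\<in>bd k. \<forall>\<mu>\<in>x. rng \<mu> = i}"

definition Z :: "(nat \<Rightarrow> nat) \<Rightarrow> mor \<Rightarrow> mor set set" where
  "Z k \<mu> = {x\<in>bd k. \<mu> \<in> x}"

definition act :: "(nat \<Rightarrow> nat) \<Rightarrow> mor \<Rightarrow> mor set \<Rightarrow> mor set" where
  "act k \<mu> x = (\<Union>\<nu>\<in>x. segments k (mcomp \<mu> \<nu>))"

section \<open>The groupoid G\<close>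

type_synonym triple = "mor \<times> mor \<times> mor set"

text \<open>Elements of the groupoid are equivalence classes, i.e. sets of triples.\<close>

type_synonym gelt = "triple set"

definition triples :: "(nat \<Rightarrow> nat) \<Rightarrow> triple set" where
  "triples k = {(\<mu>, \<nu>, x). \<mu> \<in> vLam k 1 \<and> \<nu> \<in> vLam k 1 \<and> src \<mu> = src \<nu> \<and> x \<in> vbd k (src \<mu>)}"

inductive gstep :: "(nat \<Rightarrow> nat) \<Rightarrow> triple \<Rightarrow> triple \<Rightarrow> bool" for k where
  "\<lbrakk>\<eta> \<in> Lam k; rng \<eta> = src \<mu>; (\<mu>, \<nu>, act k \<eta> x) \<in> triples k;
    (mcomp \<mu> \<eta>, mcomp \<nu> \<eta>, x) \<in> triples k\<rbrakk>
   \<Longrightarrow> gstep k (\<mu>, \<nu>, act k \<eta> x) (mcomp \<mu> \<eta>, mcomp \<nu> \<eta>, x)"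

definition gclass :: "(nat \<Rightarrow> nat) \<Rightarrow> triple \<Rightarrow> gelt" where
  "gclass k t = {t'. equivclp (gstep k) t t'}"

definition G :: "(nat \<Rightarrow> nat) \<Rightarrow> gelt set" where
  "G k = gclass k ` triples k"

definition gsrc :: "(nat \<Rightarrow> nat) \<Rightarrow> gelt \<Rightarrow> mor set" where
  "gsrc k g = (THE y. \<exists>(\<mu>, \<nu>, x)\<in>g. y = act k \<nu> x)"

definition grng :: "(nat \<Rightarrow> nat) \<Rightarrow> gelt \<Rightarrow> mor set" where
  "grng k g = (THE y. \<exists>(\<mu>, \<nu>, x)\<in>g. y = act k \<mu> x)"

definition ginv :: "gelt \<Rightarrow> gelt" where
  "ginv g = {(\<nu>, \<mu>, x) | \<mu> \<nu> x. (\<mu>, \<nu>, x) \<in> g}"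

text \<open>The product; meaningful only if \<open>gsrc k g = grng k h\<close>.\<close>

definition gmult :: "(nat \<Rightarrow> nat) \<Rightarrow> gelt \<Rightarrow> gelt \<Rightarrow> gelt" where
  "gmult k g h = (THE c. \<exists>\<mu> \<nu> \<eta> x. (\<mu>, \<nu>, x) \<in> g \<and> (\<nu>, \<eta>, x) \<in> h \<and> c = gclass k (\<mu>, \<eta>, x))"

definition gset :: "(nat \<Rightarrow> nat) \<Rightarrow> mor \<Rightarrow> mor \<Rightarrow> mor set set \<Rightarrow> gelt set" where
  "gset k \<mu> \<nu> E = {gclass k (\<mu>, \<nu>, x) | x. x \<in> E}"

definition G_top :: "(nat \<Rightarrow> nat) \<Rightarrow> gelt topology" where
  "G_top k = topology_generated_by
     {gset k \<mu> \<nu> E | \<mu> \<nu> E. \<mu> \<in> vLam k 1 \<and> \<nu> \<in> vLam k 1 \<and> src \<mu> = src \<nu> \<and>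
        E \<subseteq> vbd k (src \<mu>) \<and> openin (bd_top k) E \<and> compactin (bd_top k) E}"

section \<open>The convolution algebra of G\<close>

type_synonym gfun = "gelt \<Rightarrow> complex"

text \<open>Functions on the groupoid are extended by \<open>0\<close> to the whole type.\<close>

definition Cc :: "(nat \<Rightarrow> nat) \<Rightarrow> gfun set" where
  "Cc k = {f. (\<forall>g. g \<notin> G k \<longrightarrow> f g = 0) \<and> continuous_map (G_top k) euclidean f \<and>
     compactin (G_top k) (G_top k closure_of {g\<in>G k. f g \<noteq> 0})}"

text \<open>For functions in \<open>Cc k\<close> only finitely many terms of the sum are nonzero.\<close>

definition conv :: "(nat \<Rightarrow> nat) \<Rightarrow> gfun \<Rightarrow> gfun \<Rightarrow> gfun" where
  "conv k f h = (\<lambda>g. \<Sum>\<^sub>\<infinity>(a, b)\<in>{(a, b). a \<in> G k \<and> b \<in> G k \<and> gsrc k a = grng k b \<and>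
     gmult k a b = g}. f a * h b)"

definition invol :: "gfun \<Rightarrow> gfun" where
  "invol f = (\<lambda>g. cnj (f (ginv g)))"

section \<open>The full groupoid C*-algebra\<close>

definition ell2 :: "('i \<Rightarrow> complex) set" where
  "ell2 = {\<xi>. (\<lambda>i. (cmod (\<xi> i))\<^sup>2) summable_on UNIV}"

definition ell2_inner :: "('i \<Rightarrow> complex) \<Rightarrow> ('i \<Rightarrow> complex) \<Rightarrow> complex" where
  "ell2_inner \<xi> \<eta> = (\<Sum>\<^sub>\<infinity>i. \<xi> i * cnj (\<eta> i))"

definition ell2_norm :: "('i \<Rightarrow> complex) \<Rightarrow> real" where
  "ell2_norm \<xi> = sqrt (\<Sum>\<^sub>\<infinity>i. (cmod (\<xi> i))\<^sup>2)"

definition ell2_bounded_op :: "(('i \<Rightarrow> complex) \<Rightarrow> ('i \<Rightarrow> complex)) \<Rightarrow> bool" where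
  "ell2_bounded_op T \<longleftrightarrow>
     (\<forall>\<xi>\<in>ell2. T \<xi> \<in> ell2) \<and>
     (\<forall>\<xi>\<in>ell2. \<forall>\<eta>\<in>ell2. T (\<lambda>i. \<xi> i + \<eta> i) = (\<lambda>i. T \<xi> i + T \<eta> i)) \<and>
     (\<forall>c. \<forall>\<xi>\<in>ell2. T (\<lambda>i. c * \<xi> i) = (\<lambda>i. c * T \<xi> i)) \<and>
     (\<exists>K. \<forall>\<xi>\<in>ell2. ell2_norm (T \<xi>) \<le> K * ell2_norm \<xi>)"

definition star_rep :: "(nat \<Rightarrow> nat) \<Rightarrow> (gfun \<Rightarrow> ('i \<Rightarrow> complex) \<Rightarrow> ('i \<Rightarrow> complex)) \<Rightarrow> bool" where
  "star_rep k \<pi> \<longleftrightarrow>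
     (\<forall>f\<in>Cc k. ell2_bounded_op (\<pi> f)) \<and>
     (\<forall>f\<in>Cc k. \<forall>h\<in>Cc k. \<forall>\<xi>\<in>ell2. \<pi> (\<lambda>g. f g + h g) \<xi> = (\<lambda>i. \<pi> f \<xi> i + \<pi> h \<xi> i)) \<and>
     (\<forall>c. \<forall>f\<in>Cc k. \<forall>\<xi>\<in>ell2. \<pi> (\<lambda>g. c * f g) \<xi> = (\<lambda>i. c * \<pi> f \<xi> i)) \<and>
     (\<forall>f\<in>Cc k. \<forall>h\<in>Cc k. \<forall>\<xi>\<in>ell2. \<pi> (conv k f h) \<xi> = \<pi> f (\<pi> h \<xi>)) \<and>
     (\<forall>f\<in>Cc k. \<forall>\<xi>\<in>ell2. \<forall>\<eta>\<in>ell2. ell2_inner (\<pi> (invol f) \<xi>) \<eta> = ell2_inner \<xi> (\<pi> f \<eta>))"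

text \<open>
  The universal norm: the supremum of the operator norms over all *-representations of the
  convolution algebra by bounded operators on Hilbert spaces.  It suffices to consider the one
  Hilbert space \<open>\<ell>\<^sup>2(I)\<close> where \<open>I\<close> is the type of all complex functions on the groupoid (possibly
  degenerate representations are allowed): the supremum is unchanged if restricted to cyclic
  representations, and a cyclic representation space has a dense subset that is the image of
  \<open>Cc k\<close>, so its Hilbert dimension is at most the cardinality of \<open>I\<close>.  The supremum is formed in
  the extended nonnegative reals, so that no boundedness has to be presupposed.
\<close>

definition full_norm :: "(nat \<Rightarrow> nat) \<Rightarrow> gfun \<Rightarrow> ennreal" where
  "full_norm k f =
     (SUP \<pi>\<in>{\<pi> :: gfun \<Rightarrow> (gfun \<Rightarrow> complex) \<Rightarrow> (gfun \<Rightarrow> complex). star_rep k \<pi>}.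
        SUP \<xi>\<in>{\<xi>\<in>ell2. ell2_norm \<xi> \<le> 1}. ennreal (ell2_norm (\<pi> f \<xi>)))"

definition full_dist :: "(nat \<Rightarrow> nat) \<Rightarrow> gfun \<Rightarrow> gfun \<Rightarrow> ennreal" where
  "full_dist k f h = full_norm k (\<lambda>g. f g - h g)"

text \<open>
  The C*-algebra of the groupoid is the completion of \<open>Cc k\<close> in the universal norm, realised as
  Cauchy sequences modulo null sequences.
\<close>

definition cauchy_seqs :: "(nat \<Rightarrow> nat) \<Rightarrow> (nat \<Rightarrow> gfun) set" where
  "cauchy_seqs k = {F. (\<forall>n. F n \<in> Cc k) \<and>
     (\<forall>e>0. \<exists>N. \<forall>m\<ge>N. \<forall>n\<ge>N. full_dist k (F m) (F n) < e)}"

definition null_rel :: "(nat \<Rightarrow> nat) \<Rightarrow> ((nat \<Rightarrow> gfun) \<times> (nat \<Rightarrow> gfun)) set" where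
  "null_rel k = {(F, H). F \<in> cauchy_seqs k \<and> H \<in> cauchy_seqs k \<and>
     (\<lambda>n. full_dist k (F n) (H n)) \<longlonglongrightarrow> 0}"

definition Cstar :: "(nat \<Rightarrow> nat) \<Rightarrow> (nat \<Rightarrow> gfun) set set" where
  "Cstar k = cauchy_seqs k // null_rel k"

text \<open>The canonical map from \<open>Cc k\<close> to its completion.\<close>

definition incl :: "(nat \<Rightarrow> nat) \<Rightarrow> gfun \<Rightarrow> (nat \<Rightarrow> gfun) set" where
  "incl k f = null_rel k `` {\<lambda>_. f}"

definition Cstar_dist :: "(nat \<Rightarrow> nat) \<Rightarrow> (nat \<Rightarrow> gfun) set \<Rightarrow> (nat \<Rightarrow> gfun) set \<Rightarrow> ennreal" where
  "Cstar_dist k a b =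
     (THE d. \<exists>F\<in>a. \<exists>H\<in>b. (\<lambda>n. full_dist k (F n) (H n)) \<longlonglongrightarrow> d)"

definition Cstar_closure :: "(nat \<Rightarrow> nat) \<Rightarrow> (nat \<Rightarrow> gfun) set set \<Rightarrow> (nat \<Rightarrow> gfun) set set" where
  "Cstar_closure k S = {a\<in>Cstar k. \<forall>e>0. \<exists>c\<in>S. Cstar_dist k a c < e}"

section \<open>The subalgebras \<open>C\<^sub>i\<close>\<close>

definition beta_pow :: "nat \<Rightarrow> nat \<Rightarrow> mor" where
  "beta_pow i q = path i (replicate q Beta)"

definition Phi :: "(nat \<Rightarrow> nat) \<Rightarrow> nat \<Rightarrow> mor set" where
  "Phi k i = insert (vertex 1) {\<rho>\<in>vLam k 1. len \<rho> \<le> i \<and>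
     (\<exists>\<mu>\<in>Lam k. \<exists>\<epsilon>\<in>Lam2 k. len \<epsilon> = 1 \<and> rng \<epsilon> = src \<mu> \<and> \<rho> = mcomp \<mu> \<epsilon>)}"

definition Epaths :: "(nat \<Rightarrow> nat) \<Rightarrow> nat \<Rightarrow> mor set" where
  "Epaths k i = {\<mu>\<in>vLam k 1. len \<mu> = i}"

definition Fpaths :: "(nat \<Rightarrow> nat) \<Rightarrow> nat \<Rightarrow> mor set" where
  "Fpaths k i = {mcomp \<eta> (beta_pow (src \<eta>) q) | \<eta> q. \<eta> \<in> Phi k i \<and> len \<eta> + q = i + 1}"

definition C_gens :: "(nat \<Rightarrow> nat) \<Rightarrow> nat \<Rightarrow> gfun set" where
  "C_gens k i =
     {indicator (gset k \<nu> \<mu> (Z k (vertex (i + 1)) - Z k (beta_pow (i + 1) 1))) | \<nu> \<mu>.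
        \<nu> \<in> Epaths k i \<and> \<mu> \<in> Epaths k i} \<union>
     {indicator (gset k \<eta> \<xi> (Z k (vertex (i + 2)))) | \<eta> \<xi>. \<eta> \<in> Fpaths k i \<and> \<xi> \<in> Fpaths k i}"

text \<open>The complex linear span of the generators, as functions on the groupoid.\<close>

definition C_fin :: "(nat \<Rightarrow> nat) \<Rightarrow> nat \<Rightarrow> gfun set" where
  "C_fin k i = {(\<lambda>g. \<Sum>\<phi>\<in>A. c \<phi> * \<phi> g) | A c. finite A \<and> A \<subseteq> C_gens k i}"

definition C_AF :: "(nat \<Rightarrow> nat) \<Rightarrow> (nat \<Rightarrow> gfun) set set" where
  "C_AF k = Cstar_closure k (\<Union>i. incl k ` C_fin k i)"

end

theory Submission
  imports Defs
begin

text \<open>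
  The algebra of \<open>G\<close> acts on \<open>\<ell>\<^sup>2\<close> of the unit space by
  \<open>(\<pi>(f)\<xi>)(y) = \<Sum>\<^bsub>r(g) = y\<^esub> f(g) \<xi>(s(g))\<close>.  Since \<open>k\<^sub>i > 0\<close> infinitely often, the non-maximal set
  \<open>\<beta>\<^sup>\<infinity> = {\<beta>\<^sup>q}\<close> belongs to \<open>\<partial>\<Lambda>\<close>.  No generator of any \<open>C\<^sub>i\<close> is supported at a \<open>g\<close> with source
  \<open>\<beta>\<^sup>\<infinity>\<close> and range \<open>\<alpha>\<beta>\<^sup>\<infinity>\<close>: a path of \<open>F\<^sub>i\<close> that is a prefix of \<open>\<alpha>\<beta>\<^sup>\<infinity>\<close> has no \<open>\<gamma>\<close>, so it is a
  power of \<open>\<beta>\<close>, and the sets \<open>Z(v\<^bsub>i+1\<^esub>) - Z(\<beta>\<^bsub>i+1\<^esub>)\<close> miss \<open>\<beta>\<^sup>\<infinity>\<close>.  So the matrix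
  coefficient of \<open>\<pi>(c)\<close> between the points \<open>\<beta>\<^sup>\<infinity>\<close> and \<open>\<alpha>\<beta>\<^sup>\<infinity>\<close> vanishes for \<open>c \<in> \<Union>\<^sub>i C\<^sub>i\<close>, while it is
  \<open>1\<close> for the characteristic function of \<open>[\<alpha>\<^sub>1, \<beta>\<^sub>1, Z(v\<^sub>2)]\<close>, whose distance to
  \<open>\<Union>\<^sub>i C\<^sub>i\<close> is therefore at least \<open>1\<close>.
\<close>

section \<open>Normal forms of words\<close>

text \<open>The universal norm is a supremum over representations, so a lower bound on a distance
  needs only one of them. The work lies in showing that the action on units really is a bounded
  *-representation of \<open>Cc k\<close>. Boundedness comes from compactness: the support of a
  function in \<open>Cc k\<close> is covered by finitely many bisections, so its kernel has
  boundedly many nonzero entries over each range and each source. This calls for compactness of the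
  cylinder sets Z(v_i), for bisections that are closed as well as open, and for an explicit form of
  the equivalence relation on triples. All three rest on the same properties of \<Lambda>: it is
  cancellative on both sides, and two morphisms with a common extension have a least one. The
  relation \<alpha>\<beta> = \<beta>\<alpha> prevents reading these off from words letter by letter,
  whence the normal forms. The asymmetry between \<alpha> and \<beta> that makes the inclusion
  proper stems from \<open>Fpaths\<close>, where paths of \<open>Phi\<close> are continued by edges
  \<beta> only.\<close>

datatype nform = Fin nat nat | Blk nat nat nat nform

text \<open>\<open>Fin a b\<close> stands for \<alpha>^a \<beta>^b, and \<open>Blk a b j c\<close>
  for \<alpha>^a \<beta>^b \<gamma>^(j) followed by \<open>c\<close>. Between two edges \<gamma> the
  relation lets \<alpha> and \<beta> commute freely, so a block is determined by its two counts;
  prepending an edge raises a count or opens a new block.\<close>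

fun push :: "edge \<Rightarrow> nform \<Rightarrow> nform" where
  "push Alpha (Fin a b) = Fin (Suc a) b"
| "push Alpha (Blk a b j c) = Blk (Suc a) b j c"
| "push Beta (Fin a b) = Fin a (Suc b)"
| "push Beta (Blk a b j c) = Blk a (Suc b) j c"
| "push (Gamma j) c = Blk 0 0 j c"

definition nform_of :: "edge list \<Rightarrow> nform" where
  "nform_of w = foldr push w (Fin 0 0)"

fun flat :: "nform \<Rightarrow> edge list" where
  "flat (Fin a b) = replicate a Alpha @ replicate b Beta"
| "flat (Blk a b j c) = replicate a Alpha @ replicate b Beta @ Gamma j # flat c"

fun app :: "nform \<Rightarrow> nform \<Rightarrow> nform" where
  "app (Fin a b) (Fin a' b') = Fin (a + a') (b + b')"
| "app (Fin a b) (Blk a' b' j c) = Blk (a + a') (b + b') j c"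
| "app (Blk a b j c) d = Blk a b j (app c d)"

text \<open>Candidate for the least common extension. A block closed by \<gamma> cannot change under
  extension, while the last block is open and can still grow: hence \<open>max\<close> for two open
  blocks, and the closed block when only one is open. The value is meaningful only if some common
  extension exists, as in \<open>join_least\<close>.\<close>

fun join :: "nform \<Rightarrow> nform \<Rightarrow> nform" where
  "join (Fin a b) (Fin a' b') = Fin (max a a') (max b b')"
| "join (Fin a b) (Blk a' b' j c) = Blk a' b' j c"
| "join (Blk a b j c) (Fin a' b') = Blk a b j c"
| "join (Blk a b j c) (Blk a' b' j' c') = Blk a b j (join c c')"

fun nle :: "nform \<Rightarrow> nform \<Rightarrow> bool" where
  "nle (Fin a b) (Fin a' b') \<longleftrightarrow> a \<le> a' \<and> b \<le> b'"
| "nle (Fin a b) (Blk a' b' j c) \<longleftrightarrow> a \<le> a' \<and> b \<le> b'"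
| "nle (Blk a b j c) (Fin a' b') \<longleftrightarrow> False"
| "nle (Blk a b j c) (Blk a' b' j' c') \<longleftrightarrow> a = a' \<and> b = b' \<and> j = j' \<and> nle c c'"

lemma app_push: "app (push e c) d = push e (app c d)"
  by (cases e; cases c; cases d) auto

lemma app_Fin_0 [simp]: "app (Fin 0 0) d = d"
  by (cases d) auto

lemma nform_of_append: "nform_of (u @ v) = app (nform_of u) (nform_of v)"
  by (induction u) (auto simp: nform_of_def app_push)

lemma push_commute: "push Alpha (push Beta c) = push Beta (push Alpha c)"
  by (cases c) auto

lemma nform_of_swap: "swap u v \<Longrightarrow> nform_of u = nform_of v"
  by (erule swap.cases) (simp add: nform_of_def push_commute)

lemma nform_of_equivclp: "equivclp swap u v \<Longrightarrow> nform_of u = nform_of v"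
  by (induction rule: equivclp_induct) (auto dest: nform_of_swap)

lemma equivclp_Cons: "equivclp swap u v \<Longrightarrow> equivclp swap (e # u) (e # v)"
  using equivclp_swap_append[where c = "[e]" and d = "[]"] by simp

lemma Beta_past_Alphas:
  "equivclp swap (Beta # replicate a Alpha @ w) (replicate a Alpha @ Beta # w)"
proof (induction a)
  case (Suc a)
  have "swap (Alpha # Beta # replicate a Alpha @ w) (Beta # Alpha # replicate a Alpha @ w)"
    using swap.intros[of "[]"] by simp
  then have "equivclp swap (Beta # Alpha # replicate a Alpha @ w) (Alpha # Beta # replicate a Alpha @ w)"
    by (rule converse_r_into_equivclp)
  with equivclp_Cons[OF Suc.IH, of Alpha] show ?case
    by (auto intro: equivclp_trans)
qed simp

lemma flat_push: "equivclp swap (e # flat c) (flat (push e c))"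
proof (cases e)
  case Beta
  then show ?thesis using Beta_past_Alphas by (cases c) (auto simp: replicate_app_Cons_same)
next
  case Alpha then show ?thesis by (cases c) auto
qed auto

lemma flat_nform_of: "equivclp swap w (flat (nform_of w))"
proof (induction w)
  case Nil then show ?case by (simp add: nform_of_def)
next
  case (Cons e w)
  have "nform_of (e # w) = push e (nform_of w)" by (simp add: nform_of_def)
  then show ?case using equivclp_Cons[OF Cons.IH, of e] flat_push by (metis equivclp_trans)
qed

lemma nform_of_replicate_Alpha: "nform_of (replicate a Alpha) = Fin a 0"
  by (induction a) (auto simp: nform_of_def)

lemma nform_of_replicate_Beta: "nform_of (replicate a Beta) = Fin 0 a"
  by (induction a) (auto simp: nform_of_def)

lemma nform_of_Gamma: "nform_of (Gamma j # w) = Blk 0 0 j (nform_of w)"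
  by (simp add: nform_of_def)

lemma nform_of_flat: "nform_of (flat c) = c"
  by (induction c)
    (simp_all add: nform_of_append nform_of_replicate_Alpha nform_of_replicate_Beta nform_of_Gamma)

lift_definition nform :: "word \<Rightarrow> nform" is nform_of
  by (rule nform_of_equivclp)

text \<open>Words with the same normal form are both equivalent to its flattening. Together with
  \<open>surj_nform\<close> this identifies words modulo the congruence with \<open>nform\<close>,
  where prefixes and cancellation are accessible to recursion.\<close>

lemma inj_nform: "inj nform"
  unfolding inj_def
  by transfer (metis flat_nform_of equivclp_sym equivclp_trans)

lemma nform_eq_iff: "nform u = nform v \<longleftrightarrow> u = v"
  using inj_nform by (auto dest: injD)

lemma nform_abs [simp]: "nform (abs_word w) = nform_of w"
  by (simp add: nform.abs_eq)

lemma surj_nform: "\<exists>w. nform w = c"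
  using nform_of_flat[of c] nform_abs by metis

lemma nform_word_append: "nform (word_append u v) = app (nform u) (nform v)"
  by transfer (rule nform_of_append)

lemma app_left_cancel: "app c d = app c d' \<longleftrightarrow> d = d'"
proof (induction c)
  case (Fin a b) then show ?case by (cases d; cases d') auto
qed auto

lemma size_app: "size d \<le> size (app c d)"
proof (induction c)
  case (Fin a b) then show ?case by (cases d) auto
qed auto

text \<open>If one left factor had more blocks than the other, then \<open>d\<close> without its
  first block would equal \<open>app e d\<close> for some \<open>e\<close>, which is impossible
  because \<open>app e d\<close> is at least as large as \<open>d\<close>.\<close>

lemma app_right_cancel: "app c d = app c' d \<Longrightarrow> c = c'"
proof (induction c arbitrary: c')
  case (Fin a b)
  then show ?case
  proof (cases c')
    case (Blk a' b' j e)
    with Fin show ?thesis using size_app[of d e] by (cases d) auto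
  qed (cases d; auto)
next
  case (Blk a b j e)
  then show ?case
  proof (cases c')
    case (Fin a' b')
    with Blk show ?thesis using size_app[of d e] by (cases d) auto
  qed auto
qed

lemma nle_iff: "nle c d \<longleftrightarrow> (\<exists>e. d = app c e)"
proof
  show "nle c d \<Longrightarrow> \<exists>e. d = app c e"
  proof (induction c d rule: nle.induct)
    case (1 a b a' b')
    then have "Fin a' b' = app (Fin a b) (Fin (a' - a) (b' - b))" by simp
    then show ?case by blast
  next
    case (2 a b a' b' j c)
    then have "Blk a' b' j c = app (Fin a b) (Blk (a' - a) (b' - b) j c)" by simp
    then show ?case by blast
  qed auto
  have "nle c (app c e)" for e
  proof (induction c)
    case (Fin a b) then show ?case by (cases e) auto
  qed auto
  then show "\<exists>e. d = app c e \<Longrightarrow> nle c d" by blast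
qed

lemma nle_refl: "nle c c"
  by (induction c) auto

text \<open>The common extension \<open>w\<close> forces the closed blocks of \<open>c\<close> and
  \<open>d\<close> to agree wherever both have one. Without it the total function
  \<open>join\<close> would return a value even for paths with no common extension, such as two that
  start with different edges \<gamma>.\<close>

lemma join_least: "nle c w \<Longrightarrow> nle d w \<Longrightarrow> nle c (join c d) \<and> nle d (join c d) \<and> nle (join c d) w"
proof (induction c d arbitrary: w rule: join.induct)
  case (1 a b a' b') then show ?case by (cases w) auto
next
  case (2 a b a' b' j c) then show ?case by (cases w) (auto simp: nle_refl)
next
  case (3 a b j c a' b') then show ?case by (cases w) (auto simp: nle_refl)
next
  case (4 a b j c a' b' j' c') then show ?case by (cases w) auto
qed

lemma swap_set: "swap u v \<Longrightarrow> set u = set v"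
  by (erule swap.cases) auto

text \<open>A swap only permutes letters, so their set is an invariant of the morphism. It is the
  means by which powers of \<beta> and paths without \<gamma> are recognised.\<close>

lift_definition letters :: "word \<Rightarrow> edge set" is set
proof -
  fix u v assume "equivclp swap u v"
  then show "set u = set v"
    by (induction rule: equivclp_induct) (auto dest: swap_set)
qed

lemma letters_append: "letters (word_append u v) = letters u \<union> letters v"
  by transfer simp

lemma letters_abs [simp]: "letters (abs_word w) = set w"
  by (simp add: letters.abs_eq)

lemma word_length_append: "word_length (word_append u v) = word_length u + word_length v"
  by transfer simp

lemma word_length_abs [simp]: "word_length (abs_word w) = length w"
  by (simp add: word_length.abs_eq)

lemma word_append_abs: "word_append (abs_word u) (abs_word v) = abs_word (u @ v)"
  by (simp add: word_append.abs_eq)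

lemma word_append_assoc: "word_append (word_append u v) w = word_append u (word_append v w)"
  by transfer simp

lemma abs_word_cases: obtains w where "u = abs_word w"
  by (induction u rule: word.abs_induct) auto

lemma word_append_left_cancel: "word_append u v = word_append u v' \<longleftrightarrow> v = v'"
  by (metis app_left_cancel nform_eq_iff nform_word_append)

lemma word_append_right_cancel: "word_append u v = word_append u' v \<Longrightarrow> u = u'"
  by (metis app_right_cancel nform_eq_iff nform_word_append)

definition wle :: "word \<Rightarrow> word \<Rightarrow> bool" where
  "wle u v \<longleftrightarrow> (\<exists>d. v = word_append u d)"

lemma wle_nform: "wle u v \<longleftrightarrow> nle (nform u) (nform v)"
  unfolding wle_def nle_iff by (metis nform_eq_iff nform_word_append surj_nform)

text \<open>The property of \<Lambda> behind the topology and the groupoid: the existence of some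
  common extension in a directed hereditary set turns into membership of one fixed path.\<close>

lemma wle_lub:
  assumes "wle u w" "wle v w"
  shows "\<exists>m. wle u m \<and> wle v m \<and> (\<forall>w'. wle u w' \<longrightarrow> wle v w' \<longrightarrow> wle m w')"
proof -
  obtain m where m: "nform m = join (nform u) (nform v)" using surj_nform by metis
  show ?thesis
    using assms join_least by (intro exI[of _ m]) (auto simp: wle_nform m)
qed

lemma set_eq_Beta_replicate: "set w \<subseteq> {Beta} \<Longrightarrow> w = replicate (length w) Beta"
  by (induction w) auto

lemma letters_Beta: "letters u \<subseteq> {Beta} \<Longrightarrow> u = abs_word (replicate (word_length u) Beta)"
  by (cases u rule: abs_word_cases) (use set_eq_Beta_replicate in auto)

section \<open>Prefix order, directed hereditary sets and shifts\<close>

declare split_paired_Ex [simp del] split_paired_All [simp del]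

text \<open>Recursive form of the bound on the indices of \<gamma> in \<open>Lam\<close>, which
  splits along concatenation. A swap moves no \<gamma> to another level, so the condition descends
  to morphisms.\<close>

fun admissible :: "(nat \<Rightarrow> nat) \<Rightarrow> nat \<Rightarrow> edge list \<Rightarrow> bool" where
  "admissible k i [] \<longleftrightarrow> True"
| "admissible k i (e # w) \<longleftrightarrow> (\<forall>j. e = Gamma j \<longrightarrow> 1 \<le> j \<and> j \<le> k i) \<and> admissible k (Suc i) w"

lemma admissible_append:
  "admissible k i (u @ v) \<longleftrightarrow> admissible k i u \<and> admissible k (i + length u) v"
  by (induction u arbitrary: i) auto

lemma admissible_iff:
  "admissible k i w \<longleftrightarrow> (\<forall>p<length w. \<forall>j. w ! p = Gamma j \<longrightarrow> 1 \<le> j \<and> j \<le> k (i + p))"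
proof (induction w arbitrary: i)
  case (Cons e w)
  show ?case unfolding admissible.simps Cons.IH length_Cons All_less_Suc2 by simp
qed simp

lemma admissible_swap: "swap u v \<Longrightarrow> admissible k i u = admissible k i v"
  by (erule swap.cases) (auto simp: admissible_append)

lift_definition wadm :: "(nat \<Rightarrow> nat) \<Rightarrow> nat \<Rightarrow> word \<Rightarrow> bool" is admissible
proof -
  fix k i u v assume "equivclp swap u v"
  then show "admissible k i u = admissible k i v"
    by (induction rule: equivclp_induct) (auto dest: admissible_swap)
qed

lemma wadm_abs: "wadm k i (abs_word w) = admissible k i w"
  by (simp add: wadm.abs_eq)

lemma wadm_append: "wadm k i (word_append u v) \<longleftrightarrow> wadm k i u \<and> wadm k (i + word_length u) v"
  by transfer (rule admissible_append)

lemma Lam_iff: "\<mu> \<in> Lam k \<longleftrightarrow> 1 \<le> fst \<mu> \<and> wadm k (fst \<mu>) (snd \<mu>)"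
proof
  assume "\<mu> \<in> Lam k"
  then show "1 \<le> fst \<mu> \<and> wadm k (fst \<mu>) (snd \<mu>)"
    by (auto simp: Lam_def path_def wadm_abs admissible_iff)
next
  assume *: "1 \<le> fst \<mu> \<and> wadm k (fst \<mu>) (snd \<mu>)"
  obtain w where w: "snd \<mu> = abs_word w" by (rule abs_word_cases)
  then have "\<mu> = path (fst \<mu>) w" by (simp add: path_def prod_eq_iff)
  with * show "\<mu> \<in> Lam k"
    unfolding Lam_def mem_Collect_eq w wadm_abs admissible_iff by blast
qed

lemma src_path [simp]: "src (path i w) = i + length w"
  by (simp add: src_def rng_def len_def path_def)

lemma rng_path [simp]: "rng (path i w) = i"
  by (simp add: rng_def path_def)

lemma src_vertex [simp]: "src (vertex i) = i" and rng_vertex [simp]: "rng (vertex i) = i"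
  by (simp_all add: vertex_def)

lemma len_path [simp]: "len (path i w) = length w"
  by (simp add: len_def path_def)

lemma rng_mcomp [simp]: "rng (mcomp \<mu> \<nu>) = rng \<mu>"
  by (simp add: rng_def mcomp_def)

lemma len_mcomp [simp]: "len (mcomp \<mu> \<nu>) = len \<mu> + len \<nu>"
  by (simp add: len_def mcomp_def word_length_append)

lemma src_mcomp: "rng \<nu> = src \<mu> \<Longrightarrow> src (mcomp \<mu> \<nu>) = src \<nu>"
  by (simp add: src_def)

lemma mcomp_path: "mcomp (path i u) (path j v) = path i (u @ v)"
  by (simp add: mcomp_def path_def word_append_abs)

lemma mcomp_assoc: "mcomp (mcomp \<mu> \<nu>) \<eta> = mcomp \<mu> (mcomp \<nu> \<eta>)"
  by (simp add: mcomp_def word_append_assoc)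

lemma mcomp_vertex [simp]: "mcomp \<mu> (vertex i) = \<mu>"
  by (cases "snd \<mu>" rule: abs_word_cases)
    (simp add: mcomp_def vertex_def path_def word_append_abs prod_eq_iff)

lemma vertex_mcomp: "rng \<mu> = i \<Longrightarrow> mcomp (vertex i) \<mu> = \<mu>"
  by (cases "snd \<mu>" rule: abs_word_cases)
    (simp add: mcomp_def vertex_def path_def word_append_abs prod_eq_iff rng_def)

lemma mcomp_left_cancel: "rng \<nu> = rng \<nu>' \<Longrightarrow> mcomp \<mu> \<nu> = mcomp \<mu> \<nu>' \<longleftrightarrow> \<nu> = \<nu>'"
  by (auto simp: mcomp_def rng_def prod_eq_iff word_append_left_cancel)

lemma mcomp_right_cancel: "mcomp \<mu> \<nu> = mcomp \<mu>' \<nu> \<Longrightarrow> \<mu> = \<mu>'"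
  by (auto simp: mcomp_def prod_eq_iff dest: word_append_right_cancel)

lemma Lam_mcomp: "rng \<nu> = src \<mu> \<Longrightarrow> mcomp \<mu> \<nu> \<in> Lam k \<longleftrightarrow> \<mu> \<in> Lam k \<and> \<nu> \<in> Lam k"
  by (auto simp: Lam_iff mcomp_def rng_def src_def len_def wadm_append)

lemma vertex_in_Lam: "1 \<le> i \<Longrightarrow> vertex i \<in> Lam k"
  by (simp add: Lam_iff vertex_def path_def wadm_abs)

lemma src_pos: "\<mu> \<in> Lam k \<Longrightarrow> 1 \<le> src \<mu>"
  by (simp add: Lam_iff src_def rng_def)

text \<open>The factor \<open>\<eta>\<close> is not asked to lie in \<open>Lam k\<close>, which
  keeps the order independent of \<open>k\<close>. If \<open>\<rho>\<close> lies in
  \<open>Lam k\<close>, so do \<open>\<mu>\<close> and \<open>\<eta>\<close> by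
  \<open>Lam_mcomp\<close>.\<close>

definition mle :: "mor \<Rightarrow> mor \<Rightarrow> bool" where
  "mle \<mu> \<rho> \<longleftrightarrow> (\<exists>\<eta>. rng \<eta> = src \<mu> \<and> \<rho> = mcomp \<mu> \<eta>)"

lemma mle_wle: "mle \<mu> \<rho> \<longleftrightarrow> fst \<mu> = fst \<rho> \<and> wle (snd \<mu>) (snd \<rho>)"
proof
  assume "fst \<mu> = fst \<rho> \<and> wle (snd \<mu>) (snd \<rho>)"
  then obtain d where "fst \<mu> = fst \<rho>" "snd \<rho> = word_append (snd \<mu>) d" by (auto simp: wle_def)
  then show "mle \<mu> \<rho>"
    unfolding mle_def by (intro exI[of _ "(src \<mu>, d)"]) (simp add: mcomp_def rng_def prod_eq_iff)
qed (auto simp: mle_def wle_def mcomp_def)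

lemma mleI: "rng \<eta> = src \<mu> \<Longrightarrow> mle \<mu> (mcomp \<mu> \<eta>)"
  by (auto simp: mle_def)

lemma mleE:
  assumes "mle \<mu> \<rho>" obtains \<eta> where "rng \<eta> = src \<mu>" "\<rho> = mcomp \<mu> \<eta>"
  using assms by (auto simp: mle_def)

lemma mle_refl [simp]: "mle \<mu> \<mu>"
  using mleI[of "vertex (src \<mu>)" \<mu>] by simp

lemma mle_trans: "mle \<mu> \<nu> \<Longrightarrow> mle \<nu> \<rho> \<Longrightarrow> mle \<mu> \<rho>"
  by (auto simp: mle_wle wle_def word_append_assoc)

lemma mle_rng: "mle \<mu> \<rho> \<Longrightarrow> rng \<mu> = rng \<rho>"
  by (simp add: mle_wle rng_def)

lemma mle_Lam: "mle \<mu> \<rho> \<Longrightarrow> \<rho> \<in> Lam k \<Longrightarrow> \<mu> \<in> Lam k"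
  by (auto elim!: mleE simp: Lam_mcomp)

lemma vertex_mle: "mle (vertex i) \<rho> \<longleftrightarrow> rng \<rho> = i"
  using mle_rng[of "vertex i" \<rho>] mleI[of \<rho> "vertex i"] by (auto simp: vertex_mcomp)

lemma mle_lub:
  assumes "mle \<mu> \<rho>" "mle \<nu> \<rho>"
  obtains \<kappa> where "mle \<mu> \<kappa>" "mle \<nu> \<kappa>" "\<And>\<rho>'. mle \<mu> \<rho>' \<Longrightarrow> mle \<nu> \<rho>' \<Longrightarrow> mle \<kappa> \<rho>'"
proof -
  obtain m where "wle (snd \<mu>) m" "wle (snd \<nu>) m"
    "\<And>w. wle (snd \<mu>) w \<Longrightarrow> wle (snd \<nu>) w \<Longrightarrow> wle m w"
    using wle_lub assms unfolding mle_wle by metis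
  with assms that[of "(fst \<mu>, m)"] show thesis by (simp add: mle_wle)
qed

lemma mle_mcomp: "rng \<nu> = src \<mu> \<Longrightarrow> rng \<nu>' = src \<mu> \<Longrightarrow> mle (mcomp \<mu> \<nu>) (mcomp \<mu> \<nu>') \<longleftrightarrow> mle \<nu> \<nu>'"
  by (auto simp: mle_wle mcomp_def rng_def wle_def word_append_assoc word_append_left_cancel)

lemma extensions_iff: "\<rho> \<in> Lam k \<Longrightarrow> \<rho> \<in> extensions k \<mu> \<longleftrightarrow> mle \<mu> \<rho>"
  by (auto simp: extensions_def mle_def Lam_mcomp)

lemma segments_iff: "\<rho> \<in> Lam k \<Longrightarrow> segments k \<rho> = {\<mu>. mle \<mu> \<rho>}"
  by (auto simp: segments_def extensions_iff dest: mle_Lam)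

section \<open>Directed hereditary sets as ideals of the prefix order, and the removal of
  prefixes\<close>

lemma Lstar_iff:
  "x \<in> Lstar k \<longleftrightarrow> x \<subseteq> Lam k \<and> x \<noteq> {} \<and>
     (\<forall>\<mu>\<in>x. \<forall>\<nu>\<in>x. \<exists>\<rho>\<in>x. mle \<mu> \<rho> \<and> mle \<nu> \<rho>) \<and> (\<forall>\<rho>\<in>x. \<forall>\<mu>. mle \<mu> \<rho> \<longrightarrow> \<mu> \<in> x)"
proof (cases "x \<subseteq> Lam k")
  case True
  have "(x \<inter> extensions k \<mu> \<inter> extensions k \<nu> \<noteq> {}) \<longleftrightarrow> (\<exists>\<rho>\<in>x. mle \<mu> \<rho> \<and> mle \<nu> \<rho>)" for \<mu> \<nu>
    using True extensions_iff by blast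
  moreover have "segments k \<mu> \<subseteq> x \<longleftrightarrow> (\<forall>\<nu>. mle \<nu> \<mu> \<longrightarrow> \<nu> \<in> x)" if "\<mu> \<in> x" for \<mu>
    using True segments_iff that by blast
  ultimately show ?thesis
    unfolding Lstar_def directed_def hereditary_def by simp
qed (auto simp: Lstar_def)

lemma Lstar_Lam: "x \<in> Lstar k \<Longrightarrow> \<mu> \<in> x \<Longrightarrow> \<mu> \<in> Lam k"
  by (auto simp: Lstar_iff)

lemma Lstar_down: "x \<in> Lstar k \<Longrightarrow> \<rho> \<in> x \<Longrightarrow> mle \<mu> \<rho> \<Longrightarrow> \<mu> \<in> x"
  unfolding Lstar_iff by blast

lemma Lstar_directed:
  assumes "x \<in> Lstar k" "\<mu> \<in> x" "\<nu> \<in> x"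
  obtains \<rho> where "\<rho> \<in> x" "mle \<mu> \<rho>" "mle \<nu> \<rho>"
  using assms unfolding Lstar_iff by meson

lemma Lstar_rng: "x \<in> Lstar k \<Longrightarrow> \<mu> \<in> x \<Longrightarrow> \<nu> \<in> x \<Longrightarrow> rng \<mu> = rng \<nu>"
  by (metis Lstar_directed mle_rng)

lemma vertex_in_Lstar: "x \<in> Lstar k \<Longrightarrow> \<mu> \<in> x \<Longrightarrow> vertex i \<in> x \<longleftrightarrow> rng \<mu> = i"
  by (metis Lstar_down Lstar_rng rng_vertex vertex_mle)

lemma segments_Lstar:
  assumes "\<rho> \<in> Lam k" shows "segments k \<rho> \<in> Lstar k"
proof -
  have "\<rho> \<in> {\<mu>. mle \<mu> \<rho>}" by simp
  then show ?thesis
    unfolding Lstar_iff segments_iff[OF assms]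
    using mle_Lam[OF _ assms] mle_trans by (intro conjI) blast+
qed

lemma Zstar_vertex: "Zstar k (vertex i) = {x\<in>Lstar k. \<forall>\<mu>\<in>x. rng \<mu> = i}"
proof -
  have "vertex i \<in> x \<longleftrightarrow> (\<forall>\<mu>\<in>x. rng \<mu> = i)" if "x \<in> Lstar k" for x
  proof -
    have "x \<noteq> {}" using that unfolding Lstar_iff by blast
    then obtain \<mu> where "\<mu> \<in> x" by blast
    then show ?thesis using that by (metis Lstar_rng vertex_in_Lstar rng_vertex)
  qed
  then show ?thesis by (auto simp: Zstar_def)
qed

text \<open>Removal of the prefix \<open>\<mu>\<close>. It inverts \<open>act k \<mu>\<close>, which
  becomes a bijection from the sets with range s(\<mu>) onto those containing \<mu>. Having both
  maps is what lets maximality and membership in the boundary pass in either direction.\<close>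

definition shift :: "mor \<Rightarrow> mor set \<Rightarrow> mor set" where
  "shift \<mu> y = {\<nu>. rng \<nu> = src \<mu> \<and> mcomp \<mu> \<nu> \<in> y}"

lemma act_iff:
  assumes "\<mu> \<in> Lam k" "x \<in> Zstar k (vertex (src \<mu>))"
  shows "\<rho> \<in> act k \<mu> x \<longleftrightarrow> (\<exists>\<nu>\<in>x. mle \<rho> (mcomp \<mu> \<nu>))"
proof -
  have "mcomp \<mu> \<nu> \<in> Lam k" if "\<nu> \<in> x" for \<nu>
    using assms that by (auto simp: Zstar_vertex Lam_mcomp Lstar_Lam)
  then show ?thesis by (auto simp: act_def segments_iff)
qed

lemma mcomp_in_act:
  assumes "\<mu> \<in> Lam k" "x \<in> Zstar k (vertex (src \<mu>))" "rng \<nu> = src \<mu>"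
  shows "mcomp \<mu> \<nu> \<in> act k \<mu> x \<longleftrightarrow> \<nu> \<in> x"
proof -
  have "mle (mcomp \<mu> \<nu>) (mcomp \<mu> \<nu>') \<longleftrightarrow> mle \<nu> \<nu>'" if "\<nu>' \<in> x" for \<nu>'
    using assms that by (intro mle_mcomp) (auto simp: Zstar_vertex)
  then have "mcomp \<mu> \<nu> \<in> act k \<mu> x \<longleftrightarrow> (\<exists>\<nu>'\<in>x. mle \<nu> \<nu>')"
    unfolding act_iff[OF assms(1,2)] by (rule bex_cong[OF refl])
  also have "\<dots> \<longleftrightarrow> \<nu> \<in> x"
    using assms(2) mle_refl Lstar_down unfolding Zstar_def by blast
  finally show ?thesis .
qed

lemma in_act: "\<mu> \<in> Lam k \<Longrightarrow> x \<in> Zstar k (vertex (src \<mu>)) \<Longrightarrow> \<mu> \<in> act k \<mu> x"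
  using mcomp_in_act[of \<mu> k x "vertex (src \<mu>)"] unfolding Zstar_def by simp

lemma shift_act:
  assumes "\<mu> \<in> Lam k" "x \<in> Zstar k (vertex (src \<mu>))"
  shows "shift \<mu> (act k \<mu> x) = x"
proof -
  have "rng \<nu> = src \<mu> \<and> mcomp \<mu> \<nu> \<in> act k \<mu> x \<longleftrightarrow> \<nu> \<in> x" for \<nu>
    using mcomp_in_act[OF assms, of \<nu>] assms(2) unfolding Zstar_vertex by blast
  then show ?thesis by (simp add: shift_def)
qed

lemma act_in_Zstar:
  assumes "\<mu> \<in> Lam k" "x \<in> Zstar k (vertex (src \<mu>))"
  shows "act k \<mu> x \<in> Zstar k \<mu>"
proof -
  have x: "x \<in> Lstar k" "\<And>\<nu>. \<nu> \<in> x \<Longrightarrow> rng \<nu> = src \<mu>"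
    using assms(2) by (auto simp: Zstar_vertex)
  have "\<exists>\<rho>\<in>act k \<mu> x. mle \<rho>1 \<rho> \<and> mle \<rho>2 \<rho>" if \<rho>: "\<rho>1 \<in> act k \<mu> x" "\<rho>2 \<in> act k \<mu> x" for \<rho>1 \<rho>2
  proof -
    obtain \<nu>1 \<nu>2 where \<nu>: "\<nu>1 \<in> x" "\<nu>2 \<in> x" "mle \<rho>1 (mcomp \<mu> \<nu>1)" "mle \<rho>2 (mcomp \<mu> \<nu>2)"
      using \<rho> by (auto simp: act_iff[OF assms])
    obtain \<nu> where \<nu>': "\<nu> \<in> x" "mle \<nu>1 \<nu>" "mle \<nu>2 \<nu>"
      using Lstar_directed[OF x(1) \<nu>(1,2)] by blast
    then have "mle (mcomp \<mu> \<nu>1) (mcomp \<mu> \<nu>)" "mle (mcomp \<mu> \<nu>2) (mcomp \<mu> \<nu>)"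
      using mle_mcomp x(2) \<nu>(1,2) by metis+
    moreover have "mcomp \<mu> \<nu> \<in> act k \<mu> x" using mcomp_in_act[OF assms x(2)] \<nu>'(1) by blast
    ultimately show ?thesis using \<nu> by (meson mle_trans)
  qed
  moreover have "act k \<mu> x \<subseteq> Lam k"
  proof
    fix \<rho> assume "\<rho> \<in> act k \<mu> x"
    then obtain \<nu> where "\<nu> \<in> x" "mle \<rho> (mcomp \<mu> \<nu>)" by (auto simp: act_iff[OF assms])
    then show "\<rho> \<in> Lam k" using assms(1) x by (meson Lam_mcomp Lstar_Lam mle_Lam)
  qed
  moreover have "\<rho>' \<in> act k \<mu> x" if "\<rho> \<in> act k \<mu> x" "mle \<rho>' \<rho>" for \<rho> \<rho>'
    using that by (auto simp: act_iff[OF assms] intro: mle_trans)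
  ultimately show ?thesis
    using in_act[OF assms] by (auto simp: Zstar_def Lstar_iff)
qed

lemma act_in_Lstar:
  "\<mu> \<in> Lam k \<Longrightarrow> x \<in> Zstar k (vertex (src \<mu>)) \<Longrightarrow> act k \<mu> x \<in> Lstar k"
  using act_in_Zstar by (auto simp: Zstar_def)

lemma shift_in_Zstar:
  assumes "y \<in> Zstar k \<mu>"
  shows "shift \<mu> y \<in> Zstar k (vertex (src \<mu>))"
proof -
  have y: "y \<in> Lstar k" "\<mu> \<in> y" using assms by (auto simp: Zstar_def)
  have "\<exists>\<nu>\<in>shift \<mu> y. mle \<nu>1 \<nu> \<and> mle \<nu>2 \<nu>" if \<nu>: "\<nu>1 \<in> shift \<mu> y" "\<nu>2 \<in> shift \<mu> y" for \<nu>1 \<nu>2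
  proof -
    have r: "rng \<nu>1 = src \<mu>" "rng \<nu>2 = src \<mu>" and
      m: "mcomp \<mu> \<nu>1 \<in> y" "mcomp \<mu> \<nu>2 \<in> y" using \<nu> by (auto simp: shift_def)
    obtain \<rho> where \<rho>: "\<rho> \<in> y" "mle (mcomp \<mu> \<nu>1) \<rho>" "mle (mcomp \<mu> \<nu>2) \<rho>"
      using Lstar_directed[OF y(1) m] by blast
    then obtain \<nu> where "rng \<nu> = src \<mu>" "\<rho> = mcomp \<mu> \<nu>"
      using mle_trans[OF mleI[OF r(1)]] by (meson mleE)
    with \<rho> r show ?thesis by (auto simp: shift_def mle_mcomp)
  qed
  moreover have "shift \<mu> y \<subseteq> Lam k"
    using y(1) by (auto simp: shift_def dest!: Lstar_Lam simp: Lam_mcomp)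
  moreover have "vertex (src \<mu>) \<in> shift \<mu> y" using y by (simp add: shift_def)
  moreover have "\<nu>' \<in> shift \<mu> y" if "\<nu> \<in> shift \<mu> y" "mle \<nu>' \<nu>" for \<nu> \<nu>'
    using that y(1) mle_mcomp[of \<nu>' \<mu> \<nu>] mle_rng[OF that(2)]
    by (auto simp: shift_def intro: Lstar_down)
  ultimately show ?thesis by (auto simp: Zstar_def Lstar_iff)
qed

lemma act_shift:
  assumes "y \<in> Zstar k \<mu>"
  shows "act k \<mu> (shift \<mu> y) = y"
proof -
  have y: "y \<in> Lstar k" "\<mu> \<in> y" using assms by (auto simp: Zstar_def)
  then have \<mu>: "\<mu> \<in> Lam k" by (rule Lstar_Lam)
  show ?thesis
  proof (intro set_eqI iffI)
    fix \<rho> assume "\<rho> \<in> act k \<mu> (shift \<mu> y)"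
    then obtain \<nu> where "\<nu> \<in> shift \<mu> y" "mle \<rho> (mcomp \<mu> \<nu>)"
      unfolding act_iff[OF \<mu> shift_in_Zstar[OF assms]] by blast
    then show "\<rho> \<in> y" unfolding shift_def by (blast intro: Lstar_down[OF y(1)])
  next
    fix \<rho> assume "\<rho> \<in> y"
    \<comment> \<open>The path \<open>\<rho>\<close> need not be comparable with
      \<open>\<mu>\<close>; directedness places it below a member of \<open>y\<close> that starts
      with \<open>\<mu>\<close>.\<close>
    then obtain \<kappa> where \<kappa>: "\<kappa> \<in> y" "mle \<mu> \<kappa>" "mle \<rho> \<kappa>" using y by (meson Lstar_directed)
    then obtain \<nu> where "rng \<nu> = src \<mu>" "\<kappa> = mcomp \<mu> \<nu>" by (meson mleE)
    with \<kappa> show "\<rho> \<in> act k \<mu> (shift \<mu> y)"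
      unfolding act_iff[OF \<mu> shift_in_Zstar[OF assms]] by (auto simp: shift_def)
  qed
qed

lemma act_act:
  assumes "\<mu> \<in> Lam k" "\<nu> \<in> Lam k" "rng \<nu> = src \<mu>" "x \<in> Zstar k (vertex (src \<nu>))"
  shows "act k \<mu> (act k \<nu> x) = act k (mcomp \<mu> \<nu>) x"
proof -
  have a: "act k \<nu> x \<in> Zstar k (vertex (src \<mu>))"
    using act_in_Zstar[OF assms(2,4)] assms(3) by (auto simp: Zstar_def vertex_in_Lstar)
  have m: "mcomp \<mu> \<nu> \<in> Lam k" "x \<in> Zstar k (vertex (src (mcomp \<mu> \<nu>)))"
    using assms by (simp_all add: Lam_mcomp src_mcomp)
  have rx: "rng \<eta> = src \<nu>" if "\<eta> \<in> x" for \<eta> using that assms(4) by (auto simp: Zstar_vertex)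
  show ?thesis
  proof (intro set_eqI iffI)
    fix \<rho> assume "\<rho> \<in> act k \<mu> (act k \<nu> x)"
    then obtain \<kappa> \<eta> where "\<eta> \<in> x" "mle \<kappa> (mcomp \<nu> \<eta>)" "mle \<rho> (mcomp \<mu> \<kappa>)"
      by (auto simp: act_iff[OF assms(1) a] act_iff[OF assms(2,4)])
    moreover from this have "mle (mcomp \<mu> \<kappa>) (mcomp \<mu> (mcomp \<nu> \<eta>))"
      using assms(3) mle_rng by (subst mle_mcomp) fastforce+
    ultimately show "\<rho> \<in> act k (mcomp \<mu> \<nu>) x"
      by (auto simp: act_iff[OF m] mcomp_assoc intro: mle_trans)
  next
    fix \<rho> assume "\<rho> \<in> act k (mcomp \<mu> \<nu>) x"
    then obtain \<eta> where \<eta>: "\<eta> \<in> x" "mle \<rho> (mcomp \<mu> (mcomp \<nu> \<eta>))"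
      by (auto simp: act_iff[OF m] mcomp_assoc)
    then have "mcomp \<nu> \<eta> \<in> act k \<nu> x" using mcomp_in_act[OF assms(2,4) rx] by blast
    with \<eta> show "\<rho> \<in> act k \<mu> (act k \<nu> x)" by (auto simp: act_iff[OF assms(1) a])
  qed
qed

lemma act_vertex:
  assumes "1 \<le> i" "x \<in> Zstar k (vertex i)" shows "act k (vertex i) x = x"
proof -
  have "\<rho> \<in> act k (vertex i) x \<longleftrightarrow> \<rho> \<in> x" for \<rho>
    using assms
    by (subst act_iff)
      (auto simp: vertex_in_Lam Zstar_vertex vertex_mcomp intro: Lstar_down bexI[of _ \<rho>])
  then show ?thesis by blast
qed

lemma act_mono: "x \<subseteq> y \<Longrightarrow> act k \<mu> x \<subseteq> act k \<mu> y"
  by (auto simp: act_def)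

lemma shift_mono: "x \<subseteq> y \<Longrightarrow> shift \<mu> x \<subseteq> shift \<mu> y"
  by (auto simp: shift_def)

text \<open>Any set containing \<open>act k \<mu> x\<close> contains \<open>\<mu>\<close> and is
  therefore itself of the form \<open>act k \<mu> y\<close>. As \<open>act\<close> and
  \<open>shift\<close> preserve inclusion, proper enlargements of \<open>x\<close> and of
  \<open>act k \<mu> x\<close> correspond to each other.\<close>

lemma act_Lmax:
  assumes "\<mu> \<in> Lam k" "x \<in> Zstar k (vertex (src \<mu>))"
  shows "act k \<mu> x \<in> Lmax k \<longleftrightarrow> x \<in> Lmax k"
proof
  assume L: "act k \<mu> x \<in> Lmax k"
  have "y = x" if y: "y \<in> Lstar k" "x \<subseteq> y" for y
  proof -
    have yZ: "y \<in> Zstar k (vertex (src \<mu>))" using y assms(2) by (auto simp: Zstar_def)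
    have "act k \<mu> y = act k \<mu> x"
      using L act_in_Lstar[OF assms(1) yZ] act_mono[OF y(2)] by (auto simp: Lmax_def)
    then show "y = x" using shift_act[OF assms(1)] yZ assms(2) by metis
  qed
  then show "x \<in> Lmax k" using assms(2) by (auto simp: Lmax_def Zstar_def)
next
  assume L: "x \<in> Lmax k"
  have "y = act k \<mu> x" if y: "y \<in> Lstar k" "act k \<mu> x \<subseteq> y" for y
  proof -
    have yZ: "y \<in> Zstar k \<mu>" using y in_act[OF assms] by (auto simp: Zstar_def)
    have "x \<subseteq> shift \<mu> y" using shift_mono[OF y(2)] shift_act[OF assms] by metis
    then have "shift \<mu> y = x"
      using L shift_in_Zstar[OF yZ] by (auto simp: Lmax_def Zstar_def)
    then show ?thesis using act_shift[OF yZ] by simp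
  qed
  then show "act k \<mu> x \<in> Lmax k" using act_in_Lstar[OF assms] by (auto simp: Lmax_def)
qed

section \<open>Topology of the boundary\<close>

lemma topspace_Lstar_top [simp]: "topspace (Lstar_top k) = Lstar k"
proof -
  have "x \<in> \<Union> {Zstar k \<rho> - (\<Union>\<mu>\<in>M. Zstar k \<mu>) | \<rho> M. \<rho> \<in> Lam k \<and> finite M \<and> M \<subseteq> Lam k}"
    if x: "x \<in> Lstar k" for x
  proof -
    have "x \<noteq> {}" using x unfolding Lstar_iff by blast
    then obtain \<rho> where "\<rho> \<in> x" by blast
    then have "\<rho> \<in> Lam k" "x \<in> Zstar k \<rho>" using x Lstar_Lam by (auto simp: Zstar_def)
    then show ?thesis by (intro UnionI[of "Zstar k \<rho> - (\<Union>\<mu>\<in>{}. Zstar k \<mu>)"]) blast+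
  qed
  then show ?thesis
    unfolding Lstar_top_def topology_generated_by_topspace by (auto simp: Zstar_def)
qed

lemma openin_Zstar_Diff:
  "\<rho> \<in> Lam k \<Longrightarrow> finite M \<Longrightarrow> M \<subseteq> Lam k \<Longrightarrow>
    openin (Lstar_top k) (Zstar k \<rho> - (\<Union>\<mu>\<in>M. Zstar k \<mu>))"
  unfolding Lstar_top_def by (intro topology_generated_by_Basis) blast

lemma Zstar_outside: "\<rho> \<notin> Lam k \<Longrightarrow> Zstar k \<rho> = {}"
  unfolding Zstar_def by (blast dest: Lstar_Lam)

lemma openin_Zstar: "openin (Lstar_top k) (Zstar k \<rho>)"
  using openin_Zstar_Diff[of \<rho> k "{}"] by (cases "\<rho> \<in> Lam k") (auto simp: Zstar_outside)

lemma closedin_Zstar: "closedin (Lstar_top k) (Zstar k \<rho>)"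
proof (cases "\<rho> \<in> Lam k")
  case True
  have "Lstar k - Zstar k \<rho> = (\<Union>\<nu>\<in>Lam k. Zstar k \<nu> - (\<Union>\<mu>\<in>{\<rho>}. Zstar k \<mu>))"
  proof -
    have "\<exists>\<nu>\<in>Lam k. x \<in> Zstar k \<nu>" if "x \<in> Lstar k" for x
      using that Lstar_Lam[OF that] unfolding Lstar_iff Zstar_def by blast
    then show ?thesis by (auto simp: Zstar_def)
  qed
  moreover have "openin (Lstar_top k) (\<Union>\<nu>\<in>Lam k. Zstar k \<nu> - (\<Union>\<mu>\<in>{\<rho>}. Zstar k \<mu>))"
    using True openin_Zstar_Diff[of _ k "{\<rho>}"] by (intro openin_Union) auto
  ultimately show ?thesis by (auto simp: closedin_def Zstar_def)
qed (simp add: Zstar_outside)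

text \<open>The sets of the base are built from cylinders by complement and finite intersection, so
  it suffices that the preimage of every cylinder is clopen.\<close>

lemma continuous_map_Lstar_top:
  assumes "f \<in> topspace X \<rightarrow> Lstar k"
    and o: "\<And>\<rho>. \<rho> \<in> Lam k \<Longrightarrow> openin X {x\<in>topspace X. \<rho> \<in> f x}"
    and c: "\<And>\<rho>. \<rho> \<in> Lam k \<Longrightarrow> closedin X {x\<in>topspace X. \<rho> \<in> f x}"
  shows "continuous_map X (Lstar_top k) f"
  unfolding continuous_map
proof (intro conjI allI impI)
  show "f ` topspace X \<subseteq> topspace (Lstar_top k)" using assms(1) by auto
next
  fix U assume "openin (Lstar_top k) U"
  then have "generate_topology_on
      {Zstar k \<rho> - (\<Union>\<mu>\<in>M. Zstar k \<mu>) | \<rho> M. \<rho> \<in> Lam k \<and> finite M \<and> M \<subseteq> Lam k} U"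
    unfolding Lstar_top_def by (rule openin_topology_generated_by)
  then show "openin X {x\<in>topspace X. f x \<in> U}"
  proof induction
    case (Int a b)
    have "{x\<in>topspace X. f x \<in> a \<inter> b} = {x\<in>topspace X. f x \<in> a} \<inter> {x\<in>topspace X. f x \<in> b}" by auto
    then show ?case using Int.IH by (simp add: openin_Int)
  next
    case (UN K)
    have "{x\<in>topspace X. f x \<in> \<Union>K} = (\<Union>a\<in>K. {x\<in>topspace X. f x \<in> a})" by auto
    then show ?case using UN.IH by auto
  next
    case (Basis s)
    then obtain \<rho> M where s: "s = Zstar k \<rho> - (\<Union>\<mu>\<in>M. Zstar k \<mu>)" "\<rho> \<in> Lam k" "finite M" "M \<subseteq> Lam k"
      by blast
    have "{x\<in>topspace X. f x \<in> s} =
        {x\<in>topspace X. \<rho> \<in> f x} - (\<Union>\<mu>\<in>M. {x\<in>topspace X. \<mu> \<in> f x})"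
      using assms(1) by (auto simp: s(1) Zstar_def)
    moreover have "closedin X (\<Union>\<mu>\<in>M. {x\<in>topspace X. \<mu> \<in> f x})"
      using s by (intro closedin_Union) (auto intro: c)
    ultimately show ?case using o[OF s(2)] by (simp add: openin_diff)
  qed simp
qed

text \<open>Since \<mu> belongs to \<mu>x, the path \<rho> does so exactly if the least common
  extension \<kappa> = \<mu>\<sigma> of both does, that is, if \<sigma> belongs to x. Without a
  common extension \<rho> never occurs.\<close>

lemma act_preimage:
  assumes "\<mu> \<in> Lam k"
  shows "\<exists>\<sigma>. {x\<in>Zstar k (vertex (src \<mu>)). \<rho> \<in> act k \<mu> x} = Zstar k (vertex (src \<mu>)) \<inter> Zstar k \<sigma> \<or>
    {x\<in>Zstar k (vertex (src \<mu>)). \<rho> \<in> act k \<mu> x} = {}"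
proof (cases "\<exists>\<kappa>. mle \<mu> \<kappa> \<and> mle \<rho> \<kappa>")
  case True
  then obtain \<kappa> where \<kappa>: "mle \<mu> \<kappa>" "mle \<rho> \<kappa>" "\<And>\<kappa>'. mle \<mu> \<kappa>' \<Longrightarrow> mle \<rho> \<kappa>' \<Longrightarrow> mle \<kappa> \<kappa>'"
    using mle_lub by metis
  obtain \<sigma> where \<sigma>: "rng \<sigma> = src \<mu>" "\<kappa> = mcomp \<mu> \<sigma>" using \<kappa>(1) by (rule mleE)
  have "\<rho> \<in> act k \<mu> x \<longleftrightarrow> \<sigma> \<in> x" if x: "x \<in> Zstar k (vertex (src \<mu>))" for x
  proof -
    note a = act_in_Lstar[OF assms x]
    have "\<rho> \<in> act k \<mu> x \<longleftrightarrow> \<kappa> \<in> act k \<mu> x"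
      using in_act[OF assms x] Lstar_directed[OF a] Lstar_down[OF a] \<kappa> by metis
    then show ?thesis using mcomp_in_act[OF assms x \<sigma>(1)] \<sigma>(2) by simp
  qed
  then show ?thesis by (intro exI[of _ \<sigma>]) (auto simp: Zstar_def)
next
  case False
  have "\<rho> \<notin> act k \<mu> x" if x: "x \<in> Zstar k (vertex (src \<mu>))" for x
    using in_act[OF assms x] Lstar_directed[OF act_in_Lstar[OF assms x]] False by metis
  then show ?thesis by blast
qed

lemma continuous_map_act:
  assumes "\<mu> \<in> Lam k"
  shows "continuous_map (subtopology (Lstar_top k) (Zstar k (vertex (src \<mu>)))) (Lstar_top k) (act k \<mu>)"
proof (rule continuous_map_Lstar_top)
  have t: "topspace (subtopology (Lstar_top k) (Zstar k (vertex (src \<mu>)))) = Zstar k (vertex (src \<mu>))"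
    by (auto simp: Zstar_def)
  show "act k \<mu> \<in> topspace (subtopology (Lstar_top k) (Zstar k (vertex (src \<mu>)))) \<rightarrow> Lstar k"
    unfolding t using act_in_Lstar[OF assms] by auto
  fix \<rho>
  show "openin (subtopology (Lstar_top k) (Zstar k (vertex (src \<mu>))))
      {x \<in> topspace (subtopology (Lstar_top k) (Zstar k (vertex (src \<mu>)))). \<rho> \<in> act k \<mu> x}"
    unfolding t using act_preimage[OF assms, of \<rho>]
    by (elim exE disjE) (simp_all only: openin_subtopology_Int2 openin_Zstar openin_empty)
  show "closedin (subtopology (Lstar_top k) (Zstar k (vertex (src \<mu>))))
      {x \<in> topspace (subtopology (Lstar_top k) (Zstar k (vertex (src \<mu>)))). \<rho> \<in> act k \<mu> x}"
    unfolding t using act_preimage[OF assms, of \<rho>]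
    by (elim exE disjE) (simp_all only: closedin_subtopology_Int_closed closedin_Zstar closedin_empty)
qed

lemma continuous_map_shift:
  "continuous_map (subtopology (Lstar_top k) (Zstar k \<mu>)) (Lstar_top k) (shift \<mu>)"
proof (rule continuous_map_Lstar_top)
  have t: "topspace (subtopology (Lstar_top k) (Zstar k \<mu>)) = Zstar k \<mu>"
    by (auto simp: Zstar_def)
  show "shift \<mu> \<in> topspace (subtopology (Lstar_top k) (Zstar k \<mu>)) \<rightarrow> Lstar k"
    unfolding t using shift_in_Zstar by (auto simp: Zstar_def)
  fix \<rho>
  have e: "{x \<in> Zstar k \<mu>. \<rho> \<in> shift \<mu> x} =
      (if rng \<rho> = src \<mu> then Zstar k \<mu> \<inter> Zstar k (mcomp \<mu> \<rho>) else {})"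
    by (auto simp: shift_def Zstar_def)
  show "openin (subtopology (Lstar_top k) (Zstar k \<mu>))
      {x \<in> topspace (subtopology (Lstar_top k) (Zstar k \<mu>)). \<rho> \<in> shift \<mu> x}"
    unfolding t e using openin_Zstar by (auto simp: openin_subtopology_Int2)
  show "closedin (subtopology (Lstar_top k) (Zstar k \<mu>))
      {x \<in> topspace (subtopology (Lstar_top k) (Zstar k \<mu>)). \<rho> \<in> shift \<mu> x}"
    unfolding t e using closedin_Zstar by (auto simp: closedin_subtopology_Int_closed)
qed

lemma bd_subset_Lstar: "bd k \<subseteq> Lstar k"
  using closure_of_subset_topspace[of "Lstar_top k" "Lmax k"] by (simp add: bd_def)

lemma in_bd_iff:
  "x \<in> bd k \<longleftrightarrow> x \<in> Lstar k \<and> (\<forall>U. openin (Lstar_top k) U \<and> x \<in> U \<longrightarrow> (\<exists>y\<in>Lmax k. y \<in> U))"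
  by (auto simp: bd_def in_closure_of)

lemma openin_preimage:
  assumes "continuous_map (subtopology X S) Y f" "openin X S" "openin Y U"
  shows "openin X {x\<in>S. f x \<in> U}"
proof -
  have "openin (subtopology X S) {x \<in> topspace (subtopology X S). f x \<in> U}"
    using assms(1,3) by (rule openin_continuous_map_preimage)
  moreover have "topspace (subtopology X S) = S"
    using openin_subset[OF assms(2)] by auto
  ultimately show ?thesis using openin_trans_full[OF _ assms(2)] by (simp only:)
qed

lemma closedin_preimage:
  assumes "continuous_map (subtopology X S) Y f" "closedin X S" "closedin Y U"
  shows "closedin X {x\<in>S. f x \<in> U}"
proof -
  have "closedin (subtopology X S) {x \<in> topspace (subtopology X S). f x \<in> U}"
    using assms(1,3) by (rule closedin_continuous_map_preimage)
  moreover have "topspace (subtopology X S) = S"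
    using closedin_subset[OF assms(2)] by auto
  ultimately show ?thesis using closedin_trans_full[OF _ assms(2)] by (simp only:)
qed

text \<open>The boundary is a closure, so maximal elements near one point have to be carried to the
  other. \<open>act\<close> and \<open>shift\<close> are mutually inverse, continuous on open
  cylinders, and respect maximality by \<open>act_Lmax\<close>.\<close>

lemma act_bd:
  assumes \<mu>: "\<mu> \<in> Lam k" and x: "x \<in> Zstar k (vertex (src \<mu>))"
  shows "act k \<mu> x \<in> bd k \<longleftrightarrow> x \<in> bd k"
proof
  assume a: "act k \<mu> x \<in> bd k"
  show "x \<in> bd k" unfolding in_bd_iff
  proof (intro conjI allI impI)
    fix U assume U: "openin (Lstar_top k) U \<and> x \<in> U"
    let ?V = "{y\<in>Zstar k \<mu>. shift \<mu> y \<in> U}"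
    have "openin (Lstar_top k) ?V"
      using continuous_map_shift openin_Zstar U by (blast intro: openin_preimage)
    moreover have "act k \<mu> x \<in> ?V"
      using act_in_Zstar[OF assms] shift_act[OF assms] U by auto
    ultimately obtain y where y: "y \<in> Lmax k" "y \<in> ?V" using a unfolding in_bd_iff by blast
    then have "act k \<mu> (shift \<mu> y) = y" "shift \<mu> y \<in> Zstar k (vertex (src \<mu>))"
      using act_shift shift_in_Zstar by auto
    then have "shift \<mu> y \<in> Lmax k" using y(1) act_Lmax[OF \<mu>] by metis
    then show "\<exists>y\<in>Lmax k. y \<in> U" using y by auto
  qed (use x in \<open>auto simp: Zstar_def\<close>)
next
  assume a: "x \<in> bd k"
  show "act k \<mu> x \<in> bd k" unfolding in_bd_iff
  proof (intro conjI allI impI)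
    fix U assume U: "openin (Lstar_top k) U \<and> act k \<mu> x \<in> U"
    let ?V = "{y\<in>Zstar k (vertex (src \<mu>)). act k \<mu> y \<in> U}"
    have "openin (Lstar_top k) ?V"
      using continuous_map_act[OF \<mu>] openin_Zstar U by (blast intro: openin_preimage)
    moreover have "x \<in> ?V" using x U by auto
    ultimately obtain y where y: "y \<in> Lmax k" "y \<in> ?V" using a unfolding in_bd_iff by blast
    then have "act k \<mu> y \<in> Lmax k" using act_Lmax[OF \<mu>] by auto
    then show "\<exists>y\<in>Lmax k. y \<in> U" using y by auto
  qed (rule act_in_Lstar[OF assms])
qed

lemma Z_eq: "Z k \<mu> = bd k \<inter> Zstar k \<mu>"
  using bd_subset_Lstar by (auto simp: Z_def Zstar_def)

lemma vbd_eq: "vbd k i = Z k (vertex i)"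
  using bd_subset_Lstar by (auto simp: Z_eq Zstar_vertex vbd_def)

lemma topspace_bd_top [simp]: "topspace (bd_top k) = bd k"
  using bd_subset_Lstar by (auto simp: bd_top_def)

lemma openin_Z: "openin (bd_top k) (Z k \<mu>)" and closedin_Z: "closedin (bd_top k) (Z k \<mu>)"
  unfolding Z_eq bd_top_def
  by (auto intro: openin_subtopology_Int2 closedin_subtopology_Int_closed openin_Zstar closedin_Zstar)

text \<open>Sets of paths are coded by their characteristic functions in a product of two-point
  spaces, compact by Tychonoff. The codes of the sets in question form a closed subset, and decoding
  is continuous on it.\<close>

lemma compactin_Zstar_vertex: "compactin (Lstar_top k) (Zstar k (vertex i))"
proof -
  let ?P = "product_topology (\<lambda>_. discrete_topology (UNIV :: bool set)) (Lam k)"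
  define A where "A \<mu> = {f\<in>topspace ?P. f \<mu>}" for \<mu>
  define N where "N \<mu> = {f\<in>topspace ?P. \<not> f \<mu>}" for \<mu>
  define set_of where "set_of f = {\<mu>\<in>Lam k. f \<mu>}" for f
  have cm: "continuous_map ?P (discrete_topology UNIV) (\<lambda>f. f \<mu>)" if "\<mu> \<in> Lam k" for \<mu>
    using that by (rule continuous_map_product_projection)
  have oA: "openin ?P (A \<mu>)" and cA: "closedin ?P (A \<mu>)" and cN: "closedin ?P (N \<mu>)"
    if "\<mu> \<in> Lam k" for \<mu>
    using openin_continuous_map_preimage[OF cm[OF that], of "{True}"]
      closedin_continuous_map_preimage[OF cm[OF that], of "{True}"]
      closedin_continuous_map_preimage[OF cm[OF that], of "{False}"]
    by (simp_all add: A_def N_def)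
  have "continuous_map (subtopology ?P S) (Lstar_top k) set_of"
    if S: "set_of ` S \<subseteq> Lstar k" for S
  proof (rule continuous_map_Lstar_top)
    show "set_of \<in> topspace (subtopology ?P S) \<rightarrow> Lstar k" using S by auto
    fix \<rho> assume \<rho>: "\<rho> \<in> Lam k"
    have "{x \<in> topspace (subtopology ?P S). \<rho> \<in> set_of x} = S \<inter> A \<rho>"
      using \<rho> by (auto simp: A_def set_of_def)
    then show "openin (subtopology ?P S) {x \<in> topspace (subtopology ?P S). \<rho> \<in> set_of x}"
      "closedin (subtopology ?P S) {x \<in> topspace (subtopology ?P S). \<rho> \<in> set_of x}"
      using oA[OF \<rho>] cA[OF \<rho>] by (simp_all add: openin_subtopology_Int2 closedin_subtopology_Int_closed)
  qed
  note cont = this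
  show ?thesis
  proof (cases "1 \<le> i")
    case True
    \<comment> \<open>Each member constrains at most three coordinates, hence is closed. They say
      that v_i is present, that the set is hereditary, that it contains the least common extension
      of two members having one, and that no two members lack a common extension. The last two
      replace directedness, whose existential over all paths would only exhibit a possibly infinite
      union of closed sets.\<close>
    define \<F> where "\<F> = {A (vertex i)} \<union> {N \<rho> \<union> A \<mu> | \<mu> \<rho>. mle \<mu> \<rho> \<and> \<rho> \<in> Lam k} \<union>
      {N \<mu> \<union> N \<nu> \<union> A \<kappa> | \<mu> \<nu> \<kappa>. \<mu> \<in> Lam k \<and> \<nu> \<in> Lam k \<and> \<kappa> \<in> Lam k \<and> mle \<mu> \<kappa> \<and> mle \<nu> \<kappa> \<and>
        (\<forall>\<rho>. mle \<mu> \<rho> \<longrightarrow> mle \<nu> \<rho> \<longrightarrow> mle \<kappa> \<rho>)} \<union>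
      {N \<mu> \<union> N \<nu> | \<mu> \<nu>. \<mu> \<in> Lam k \<and> \<nu> \<in> Lam k \<and> \<not> (\<exists>\<rho>\<in>Lam k. mle \<mu> \<rho> \<and> mle \<nu> \<rho>)}"
    have "closedin ?P (\<Inter>\<F>)"
    proof (rule closedin_Inter)
      show "\<F> \<noteq> {}" by (simp add: \<F>_def)
      show "closedin ?P K" if "K \<in> \<F>" for K
        using that unfolding \<F>_def
        by (elim UnE) (auto intro!: closedin_Un cA cN vertex_in_Lam[OF True] intro: mle_Lam)
    qed
    moreover have "compact_space ?P"
      by (intro compact_space_product_topology[THEN iffD2]) (auto simp: compact_space_discrete_topology)
    ultimately have "compactin ?P (\<Inter>\<F>)" by (rule closedin_compact_space[rotated])
    moreover have im: "set_of ` (\<Inter>\<F>) = Zstar k (vertex i)"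
    proof (intro equalityI subsetI)
      fix x assume "x \<in> set_of ` (\<Inter>\<F>)"
      then obtain f where f: "x = set_of f" "\<And>K. K \<in> \<F> \<Longrightarrow> f \<in> K" by blast
      have v: "vertex i \<in> x"
        using f(2)[of "A (vertex i)"] vertex_in_Lam[OF True] by (simp add: \<F>_def f(1) set_of_def A_def)
      have d: "\<mu> \<in> x" if "\<rho> \<in> x" "mle \<mu> \<rho>" for \<mu> \<rho>
      proof -
        have "\<rho> \<in> Lam k" "f \<rho>" using that f(1) by (auto simp: set_of_def)
        moreover have "f \<in> N \<rho> \<union> A \<mu>" by (rule f(2)) (use that calculation in \<open>auto simp: \<F>_def\<close>)
        ultimately show ?thesis using that(2) by (auto simp: f(1) set_of_def A_def N_def intro: mle_Lam)
      qed
      have j: "\<exists>\<rho>\<in>x. mle \<mu> \<rho> \<and> mle \<nu> \<rho>" if "\<mu> \<in> x" "\<nu> \<in> x" for \<mu> \<nu>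
      proof -
        have m: "\<mu> \<in> Lam k" "f \<mu>" "\<nu> \<in> Lam k" "f \<nu>" using that f(1) by (auto simp: set_of_def)
        then have "f \<notin> N \<mu> \<union> N \<nu>" by (auto simp: N_def)
        then have "N \<mu> \<union> N \<nu> \<notin> \<F>" using f(2) by blast
        then obtain \<rho> where \<rho>: "\<rho> \<in> Lam k" "mle \<mu> \<rho>" "mle \<nu> \<rho>" using m unfolding \<F>_def by blast
        obtain \<kappa> where \<kappa>: "mle \<mu> \<kappa>" "mle \<nu> \<kappa>" "\<And>\<rho>'. mle \<mu> \<rho>' \<Longrightarrow> mle \<nu> \<rho>' \<Longrightarrow> mle \<kappa> \<rho>'"
          using mle_lub[OF \<rho>(2,3)] by blast
        then have \<kappa>': "\<kappa> \<in> Lam k" using \<rho> mle_Lam by blast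
        then have "N \<mu> \<union> N \<nu> \<union> A \<kappa> \<in> \<F>" using \<kappa> m unfolding \<F>_def by blast
        then have "f \<in> A \<kappa>" using f(2) \<open>f \<notin> N \<mu> \<union> N \<nu>\<close> by blast
        then have "\<kappa> \<in> x" using \<kappa>' by (simp add: f(1) set_of_def A_def)
        then show ?thesis using \<kappa> by blast
      qed
      have "x \<subseteq> Lam k" by (auto simp: f(1) set_of_def)
      then show "x \<in> Zstar k (vertex i)"
        unfolding Zstar_def Lstar_iff using v d j by blast
    next
      fix x assume "x \<in> Zstar k (vertex i)"
      then have x: "x \<in> Lstar k" "vertex i \<in> x" by (auto simp: Zstar_def)
      let ?f = "restrict (\<lambda>\<mu>. \<mu> \<in> x) (Lam k)"
      have f: "?f \<in> topspace ?P" by auto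
      have "set_of ?f = x" using Lstar_Lam[OF x(1)] by (auto simp: set_of_def)
      moreover have "?f \<in> K" if "K \<in> \<F>" for K
      proof -
        have "?f \<in> N \<mu> \<union> N \<nu> \<union> A \<kappa>" if "\<mu> \<in> Lam k" "\<nu> \<in> Lam k" "\<kappa> \<in> Lam k"
          "\<And>\<rho>. mle \<mu> \<rho> \<Longrightarrow> mle \<nu> \<rho> \<Longrightarrow> mle \<kappa> \<rho>" for \<mu> \<nu> \<kappa>
        proof (cases "\<mu> \<in> x \<and> \<nu> \<in> x")
          case True
          then obtain \<rho> where "\<rho> \<in> x" "mle \<mu> \<rho>" "mle \<nu> \<rho>" using Lstar_directed[OF x(1)] by blast
          then have "\<kappa> \<in> x" using that(4) Lstar_down[OF x(1)] by blast
          then show ?thesis using that(3) f by (simp add: A_def)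
        qed (use that f in \<open>auto simp: N_def\<close>)
        moreover have "?f \<in> N \<mu> \<union> N \<nu>" if "\<mu> \<in> Lam k" "\<nu> \<in> Lam k"
          "\<not> (\<exists>\<rho>\<in>Lam k. mle \<mu> \<rho> \<and> mle \<nu> \<rho>)" for \<mu> \<nu>
        proof -
          have "\<mu> \<notin> x \<or> \<nu> \<notin> x" using that(3) Lstar_directed[OF x(1)] Lstar_Lam[OF x(1)] by metis
          then show ?thesis using that f by (auto simp: N_def)
        qed
        moreover have "?f \<in> N \<rho> \<union> A \<mu>" if "mle \<mu> \<rho>" "\<rho> \<in> Lam k" for \<mu> \<rho>
          using Lstar_down[OF x(1) _ that(1)] mle_Lam[OF that] that f by (auto simp: A_def N_def)
        moreover have "?f \<in> A (vertex i)" using f x(2) vertex_in_Lam[OF True] by (simp add: A_def)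
        ultimately show ?thesis using \<open>K \<in> \<F>\<close> unfolding \<F>_def by (elim UnE) blast+
      qed
      ultimately show "x \<in> set_of ` (\<Inter>\<F>)" by blast
    qed
    moreover have "compactin (subtopology ?P (\<Inter>\<F>)) (\<Inter>\<F>)"
      using calculation(1) by (simp add: compactin_subtopology)
    moreover have "continuous_map (subtopology ?P (\<Inter>\<F>)) (Lstar_top k) set_of"
      by (rule cont) (auto simp: im Zstar_def)
    ultimately show ?thesis using image_compactin by metis
  next
    case False
    \<comment> \<open>Here \<open>i\<close> is 0, which is not the index of an object.\<close>
    then have "Zstar k (vertex i) = {}"
      by (intro Zstar_outside) (simp add: Lam_iff vertex_def path_def)
    then show ?thesis by simp
  qed
qed

lemma compactin_bd_top:
  assumes "closedin (bd_top k) E" "E \<subseteq> vbd k i"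
  shows "compactin (bd_top k) E"
proof -
  have "closedin (Lstar_top k) (bd k)" by (simp add: bd_def)
  then have "compactin (Lstar_top k) (Z k (vertex i))"
    using closed_Int_compactin[OF _ compactin_Zstar_vertex] by (simp add: Z_eq)
  then have "compactin (bd_top k) (Z k (vertex i))"
    by (simp add: bd_top_def compactin_subtopology Z_eq)
  then show ?thesis using closed_compactin assms by (metis vbd_eq)
qed

lemma shift_vbd:
  assumes "y \<in> Z k \<mu>" shows "shift \<mu> y \<in> vbd k (src \<mu>)"
proof -
  have y: "y \<in> bd k" "y \<in> Zstar k \<mu>" using assms by (auto simp: Z_eq)
  then have \<mu>: "\<mu> \<in> Lam k" using Zstar_outside by blast
  note s = shift_in_Zstar[OF y(2)]
  show ?thesis using act_bd[OF \<mu> s] act_shift[OF y(2)] s y(1) by (simp add: vbd_eq Z_eq)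
qed

text \<open>\<open>act k \<epsilon> \<circ> shift \<epsilon>'\<close> replaces the prefix
  \<epsilon>' by \<epsilon>. Two bisections overlap along such a map, see
  \<open>trel_minimal\<close>, and clopen sets are pulled back through it.\<close>

lemma clopen_transport:
  assumes \<epsilon>: "\<epsilon> \<in> Lam k" "src \<epsilon> = src \<epsilon>'"
    and E: "openin (bd_top k) E" "closedin (bd_top k) E"
  shows "openin (bd_top k) {x\<in>Z k \<epsilon>'. act k \<epsilon> (shift \<epsilon>' x) \<in> E}"
    "closedin (bd_top k) {x\<in>Z k \<epsilon>'. act k \<epsilon> (shift \<epsilon>' x) \<in> E}"
proof -
  have sh: "shift \<epsilon>' x \<in> Zstar k (vertex (src \<epsilon>))" "shift \<epsilon>' x \<in> bd k" if "x \<in> Z k \<epsilon>'" for x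
    using shift_vbd[OF that] \<epsilon>(2) by (auto simp: vbd_eq Z_eq)
  have "continuous_map (subtopology (Lstar_top k) (Z k \<epsilon>')) (Lstar_top k) (shift \<epsilon>')"
    by (rule continuous_map_from_subtopology_mono[OF continuous_map_shift]) (auto simp: Z_eq)
  then have "continuous_map (subtopology (Lstar_top k) (Z k \<epsilon>'))
      (subtopology (Lstar_top k) (Zstar k (vertex (src \<epsilon>)))) (shift \<epsilon>')"
    using sh by (auto simp: continuous_map_in_subtopology)
  then have "continuous_map (subtopology (Lstar_top k) (Z k \<epsilon>')) (Lstar_top k) (act k \<epsilon> \<circ> shift \<epsilon>')"
    by (rule continuous_map_compose) (rule continuous_map_act[OF \<epsilon>(1)])
  then have "continuous_map (subtopology (Lstar_top k) (Z k \<epsilon>')) (bd_top k) (act k \<epsilon> \<circ> shift \<epsilon>')"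
    using sh act_bd[OF \<epsilon>(1)] by (auto simp: bd_top_def continuous_map_in_subtopology)
  moreover have "subtopology (Lstar_top k) (Z k \<epsilon>') = subtopology (bd_top k) (Z k \<epsilon>')"
  proof -
    have "bd k \<inter> Z k \<epsilon>' = Z k \<epsilon>'" by (auto simp: Z_eq)
    then show ?thesis by (simp add: bd_top_def subtopology_subtopology)
  qed
  ultimately have "continuous_map (subtopology (bd_top k) (Z k \<epsilon>')) (bd_top k) (act k \<epsilon> \<circ> shift \<epsilon>')"
    by simp
  from openin_preimage[OF this openin_Z E(1)] closedin_preimage[OF this closedin_Z E(2)]
  show "openin (bd_top k) {x\<in>Z k \<epsilon>'. act k \<epsilon> (shift \<epsilon>' x) \<in> E}"
    "closedin (bd_top k) {x\<in>Z k \<epsilon>'. act k \<epsilon> (shift \<epsilon>' x) \<in> E}"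
    by simp_all
qed

section \<open>The groupoid and its compact open bisections\<close>

lemma triples_iff:
  "(\<mu>, \<nu>, x) \<in> triples k \<longleftrightarrow> \<mu> \<in> Lam k \<and> \<nu> \<in> Lam k \<and> rng \<mu> = 1 \<and> rng \<nu> = 1 \<and> src \<mu> = src \<nu> \<and>
    x \<in> vbd k (src \<mu>)"
  by (auto simp: triples_def vLam_def)

lemma vbd_Zstar: "x \<in> vbd k i \<Longrightarrow> x \<in> Zstar k (vertex i)"
  by (simp add: vbd_eq Z_eq)

lemma act_in_Zstar_vertex:
  assumes "\<mu> \<in> Lam k" "x \<in> Zstar k (vertex (src \<mu>))"
  shows "act k \<mu> x \<in> Zstar k (vertex (rng \<mu>))"
  using act_in_Zstar[OF assms] vertex_in_Lstar[of "act k \<mu> x" k \<mu> "rng \<mu>"] by (simp add: Zstar_def)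

text \<open>Closed form of the relation generated by \<open>gstep\<close>: two triples are related
  if one step from each leads to the same triple. One existential thus replaces zigzags of arbitrary
  length.\<close>

definition trel :: "(nat \<Rightarrow> nat) \<Rightarrow> triple \<Rightarrow> triple \<Rightarrow> bool" where
  "trel k t t' \<longleftrightarrow> t \<in> triples k \<and> t' \<in> triples k \<and>
    (\<exists>\<epsilon> \<epsilon>' z. \<epsilon> \<in> Lam k \<and> \<epsilon>' \<in> Lam k \<and> rng \<epsilon> = src (fst t) \<and> rng \<epsilon>' = src (fst t') \<and>
      mcomp (fst t) \<epsilon> = mcomp (fst t') \<epsilon>' \<and> mcomp (fst (snd t)) \<epsilon> = mcomp (fst (snd t')) \<epsilon>' \<and>
      z \<in> vbd k (src \<epsilon>) \<and> snd (snd t) = act k \<epsilon> z \<and> snd (snd t') = act k \<epsilon>' z)"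

lemma trel_iff:
  "trel k (\<mu>, \<nu>, x) (\<mu>', \<nu>', x') \<longleftrightarrow> (\<mu>, \<nu>, x) \<in> triples k \<and> (\<mu>', \<nu>', x') \<in> triples k \<and>
    (\<exists>\<epsilon> \<epsilon>' z. \<epsilon> \<in> Lam k \<and> \<epsilon>' \<in> Lam k \<and> rng \<epsilon> = src \<mu> \<and> rng \<epsilon>' = src \<mu>' \<and>
      mcomp \<mu> \<epsilon> = mcomp \<mu>' \<epsilon>' \<and> mcomp \<nu> \<epsilon> = mcomp \<nu>' \<epsilon>' \<and>
      z \<in> vbd k (src \<epsilon>) \<and> x = act k \<epsilon> z \<and> x' = act k \<epsilon>' z)"
  by (simp add: trel_def)

lemma src_eq_of_mcomp_eq:
  "mcomp \<mu> \<epsilon> = mcomp \<mu>' \<epsilon>' \<Longrightarrow> rng \<epsilon> = src \<mu> \<Longrightarrow> rng \<epsilon>' = src \<mu>' \<Longrightarrow> src \<epsilon> = src \<epsilon>'"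
  by (metis src_mcomp)

lemma trel_sym: "trel k t t' \<Longrightarrow> trel k t' t"
proof -
  obtain \<mu> \<nu> x \<mu>' \<nu>' x' where t: "t = (\<mu>, \<nu>, x)" "t' = (\<mu>', \<nu>', x')" by (metis prod.exhaust)
  show "trel k t t' \<Longrightarrow> trel k t' t"
    unfolding t trel_iff using src_eq_of_mcomp_eq by metis
qed

lemma trel_refl:
  assumes "(\<mu>, \<nu>, x) \<in> triples k" shows "trel k (\<mu>, \<nu>, x) (\<mu>, \<nu>, x)"
proof -
  have "1 \<le> src \<mu>" "x \<in> vbd k (src \<mu>)" using assms src_pos[of \<mu> k] by (auto simp: triples_iff)
  moreover from this have "act k (vertex (src \<mu>)) x = x" using act_vertex vbd_Zstar by blast
  ultimately show ?thesis
    unfolding trel_iff using assms vertex_in_Lam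
    by (intro conjI exI[of _ "vertex (src \<mu>)"] exI[of _ x]) auto
qed

text \<open>The set \<epsilon>z = \<delta>w contains both \<epsilon> and \<delta>, hence by
  directedness some \<kappa> above both; removing \<kappa> from it gives \<open>u\<close>, and left
  cancellation of prefixes recovers \<open>z\<close> and \<open>w\<close>.\<close>

lemma common_refinement:
  assumes \<epsilon>: "\<epsilon> \<in> Lam k" "z \<in> vbd k (src \<epsilon>)" and \<delta>: "\<delta> \<in> Lam k" "w \<in> vbd k (src \<delta>)"
    and eq: "act k \<epsilon> z = act k \<delta> w"
  obtains \<sigma> \<tau> u where "\<sigma> \<in> Lam k" "\<tau> \<in> Lam k" "rng \<sigma> = src \<epsilon>" "rng \<tau> = src \<delta>"
    "mcomp \<epsilon> \<sigma> = mcomp \<delta> \<tau>" "u \<in> vbd k (src \<sigma>)" "src \<sigma> = src \<tau>" "z = act k \<sigma> u" "w = act k \<tau> u"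
proof -
  let ?x = "act k \<epsilon> z"
  note z = vbd_Zstar[OF \<epsilon>(2)] and w = vbd_Zstar[OF \<delta>(2)]
  have x: "?x \<in> Lstar k" "\<epsilon> \<in> ?x" "\<delta> \<in> ?x"
    using act_in_Lstar[OF \<epsilon>(1) z] in_act[OF \<epsilon>(1) z] in_act[OF \<delta>(1) w] eq by auto
  have xb: "?x \<in> bd k" using act_bd[OF \<epsilon>(1) z] \<epsilon>(2) by (simp add: vbd_eq Z_eq)
  obtain \<kappa> where \<kappa>: "\<kappa> \<in> ?x" "mle \<epsilon> \<kappa>" "mle \<delta> \<kappa>" using Lstar_directed[OF x] .
  obtain \<sigma> where \<sigma>: "rng \<sigma> = src \<epsilon>" "\<kappa> = mcomp \<epsilon> \<sigma>" using \<kappa>(2) by (rule mleE)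
  obtain \<tau> where \<tau>: "rng \<tau> = src \<delta>" "\<kappa> = mcomp \<delta> \<tau>" using \<kappa>(3) by (rule mleE)
  have \<kappa>L: "\<kappa> \<in> Lam k" using x(1) \<kappa>(1) by (rule Lstar_Lam)
  have L: "\<sigma> \<in> Lam k" "\<tau> \<in> Lam k" using \<kappa>L \<sigma> \<tau> Lam_mcomp by metis+
  let ?u = "shift \<kappa> ?x"
  have s: "src \<kappa> = src \<sigma>" "src \<kappa> = src \<tau>" using \<sigma> \<tau> src_mcomp by metis+
  have xZ: "?x \<in> Zstar k \<kappa>" using x \<kappa> by (simp add: Zstar_def)
  have u: "?u \<in> vbd k (src \<sigma>)" using shift_vbd[of ?x k \<kappa>] xb xZ s by (simp add: Z_eq)
  have u': "?u \<in> Zstar k (vertex (src \<sigma>))" "?u \<in> Zstar k (vertex (src \<tau>))"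
    using vbd_Zstar[OF u] s by auto
  have a: "act k \<sigma> ?u \<in> Zstar k (vertex (src \<epsilon>))" "act k \<tau> ?u \<in> Zstar k (vertex (src \<delta>))"
    using act_in_Zstar_vertex[OF L(1) u'(1)] act_in_Zstar_vertex[OF L(2) u'(2)] \<sigma>(1) \<tau>(1) by simp_all
  have "act k \<epsilon> (act k \<sigma> ?u) = ?x" "act k \<delta> (act k \<tau> ?u) = ?x"
    using act_act[OF \<epsilon>(1) L(1) \<sigma>(1) u'(1)] act_act[OF \<delta>(1) L(2) \<tau>(1) u'(2)]
      act_shift[OF xZ] \<sigma>(2) \<tau>(2) by auto
  then have "act k \<sigma> ?u = z" "act k \<tau> ?u = w"
    using shift_act[OF \<epsilon>(1) z] shift_act[OF \<epsilon>(1) a(1)] shift_act[OF \<delta>(1) w]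
      shift_act[OF \<delta>(1) a(2)] eq by metis+
  with that[of \<sigma> \<tau> ?u] L \<sigma> \<tau> u s show thesis by simp
qed

text \<open>Makes the product of classes independent of representatives. Each hypothesis brings its
  own refinement of \<open>x\<close>, and \<open>common_refinement\<close> merges the two.\<close>

lemma trel_compose:
  assumes a: "trel k (\<mu>, \<nu>, x) (\<mu>', \<nu>', x')" and b: "trel k (\<nu>, \<eta>, x) (\<nu>', \<eta>', x')"
  shows "trel k (\<mu>, \<eta>, x) (\<mu>', \<eta>', x')"
proof -
  obtain \<epsilon> \<epsilon>' z where e: "\<epsilon> \<in> Lam k" "\<epsilon>' \<in> Lam k" "rng \<epsilon> = src \<mu>" "rng \<epsilon>' = src \<mu>'"
    "mcomp \<mu> \<epsilon> = mcomp \<mu>' \<epsilon>'" "mcomp \<nu> \<epsilon> = mcomp \<nu>' \<epsilon>'" "z \<in> vbd k (src \<epsilon>)"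
    "x = act k \<epsilon> z" "x' = act k \<epsilon>' z" using a unfolding trel_iff by blast
  obtain \<delta> \<delta>' w where d: "\<delta> \<in> Lam k" "\<delta>' \<in> Lam k" "rng \<delta> = src \<nu>" "rng \<delta>' = src \<nu>'"
    "mcomp \<nu> \<delta> = mcomp \<nu>' \<delta>'" "mcomp \<eta> \<delta> = mcomp \<eta>' \<delta>'" "w \<in> vbd k (src \<delta>)"
    "x = act k \<delta> w" "x' = act k \<delta>' w" using b unfolding trel_iff by blast
  obtain \<sigma> \<tau> u where r: "\<sigma> \<in> Lam k" "\<tau> \<in> Lam k" "rng \<sigma> = src \<epsilon>" "rng \<tau> = src \<delta>"
    "mcomp \<epsilon> \<sigma> = mcomp \<delta> \<tau>" "u \<in> vbd k (src \<sigma>)" "src \<sigma> = src \<tau>" "z = act k \<sigma> u" "w = act k \<tau> u"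
    using common_refinement[OF e(1,7) d(1,7)] e(8) d(8) by metis
  have s: "src \<epsilon> = src \<epsilon>'" using src_eq_of_mcomp_eq e by blast
  have "src \<mu> = src \<nu>" "src \<mu>' = src \<nu>'" using a by (auto simp: trel_iff triples_iff)
  moreover have "src \<delta> = src \<delta>'" using src_eq_of_mcomp_eq d by blast
  \<comment> \<open>The merging concerned the unprimed side only. Cancelling \<open>\<nu>'\<close>
    on the left carries it over to the primed side.\<close>
  moreover have "mcomp \<nu>' (mcomp \<epsilon>' \<sigma>) = mcomp \<nu>' (mcomp \<delta>' \<tau>)"
    using e(6) d(5) r(5) mcomp_assoc by metis
  ultimately have eq: "mcomp \<epsilon>' \<sigma> = mcomp \<delta>' \<tau>"
    using mcomp_left_cancel[of "mcomp \<epsilon>' \<sigma>" "mcomp \<delta>' \<tau>" \<nu>'] e d by simp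
  have "mcomp \<mu> (mcomp \<epsilon> \<sigma>) = mcomp \<mu>' (mcomp \<epsilon>' \<sigma>)" using e(5) mcomp_assoc by metis
  moreover have "mcomp \<eta> (mcomp \<epsilon> \<sigma>) = mcomp \<eta>' (mcomp \<epsilon>' \<sigma>)"
    using d(6) mcomp_assoc r(5) eq by metis
  moreover have "x = act k (mcomp \<epsilon> \<sigma>) u" "x' = act k (mcomp \<epsilon>' \<sigma>) u"
    using act_act[OF e(1) r(1) r(3) vbd_Zstar[OF r(6)]] act_act[OF e(2) r(1) _ vbd_Zstar[OF r(6)]]
      e(8,9) r(3,8) s by auto
  moreover have "mcomp \<epsilon> \<sigma> \<in> Lam k" "mcomp \<epsilon>' \<sigma> \<in> Lam k" "src (mcomp \<epsilon> \<sigma>) = src \<sigma>"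
    using e(1-4) r(1,3) s by (simp_all add: Lam_mcomp src_mcomp)
  ultimately show ?thesis
    using a b e(3,4) r(6) unfolding trel_iff
    by (intro conjI exI[of _ "mcomp \<epsilon> \<sigma>"] exI[of _ "mcomp \<epsilon>' \<sigma>"] exI[of _ u])
      (auto simp: triples_iff)
qed

text \<open>The middle point \<open>x'\<close> is given through two refinements; merging them at
  \<open>x'\<close> refines both outer triples to the same one.\<close>

lemma trel_trans: 
  assumes "trel k t t'" "trel k t' t''" shows "trel k t t''"
proof -
  obtain \<mu> \<nu> x \<mu>' \<nu>' x' \<mu>'' \<nu>'' x''
    where t: "t = (\<mu>, \<nu>, x)" "t' = (\<mu>', \<nu>', x')" "t'' = (\<mu>'', \<nu>'', x'')" by (metis prod.exhaust)
  obtain \<epsilon> \<epsilon>' z where e: "\<epsilon> \<in> Lam k" "\<epsilon>' \<in> Lam k" "rng \<epsilon> = src \<mu>" "rng \<epsilon>' = src \<mu>'"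
    "mcomp \<mu> \<epsilon> = mcomp \<mu>' \<epsilon>'" "mcomp \<nu> \<epsilon> = mcomp \<nu>' \<epsilon>'" "z \<in> vbd k (src \<epsilon>)"
    "x = act k \<epsilon> z" "x' = act k \<epsilon>' z" using assms(1) unfolding t trel_iff by blast
  obtain \<delta> \<delta>' w where d: "\<delta> \<in> Lam k" "\<delta>' \<in> Lam k" "rng \<delta> = src \<mu>'" "rng \<delta>' = src \<mu>''"
    "mcomp \<mu>' \<delta> = mcomp \<mu>'' \<delta>'" "mcomp \<nu>' \<delta> = mcomp \<nu>'' \<delta>'" "w \<in> vbd k (src \<delta>)"
    "x' = act k \<delta> w" "x'' = act k \<delta>' w" using assms(2) unfolding t trel_iff by blast
  have s: "src \<epsilon> = src \<epsilon>'" "src \<delta> = src \<delta>'" using src_eq_of_mcomp_eq e d by blast+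
  have "z \<in> vbd k (src \<epsilon>')" using e s by simp
  from common_refinement[OF e(2) this d(1,7)] e(9) d(8)
  obtain \<sigma> \<tau> u where r: "\<sigma> \<in> Lam k" "\<tau> \<in> Lam k" "rng \<sigma> = src \<epsilon>'" "rng \<tau> = src \<delta>"
    "mcomp \<epsilon>' \<sigma> = mcomp \<delta> \<tau>" "u \<in> vbd k (src \<sigma>)" "src \<sigma> = src \<tau>" "z = act k \<sigma> u" "w = act k \<tau> u"
    by metis
  have u': "u \<in> Zstar k (vertex (src \<sigma>))" "u \<in> Zstar k (vertex (src \<tau>))"
    using vbd_Zstar[OF r(6)] r(7) by auto
  have "mcomp \<mu> (mcomp \<epsilon> \<sigma>) = mcomp \<mu>'' (mcomp \<delta>' \<tau>)" "mcomp \<nu> (mcomp \<epsilon> \<sigma>) = mcomp \<nu>'' (mcomp \<delta>' \<tau>)"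
    using e(5,6) d(5,6) r(5) mcomp_assoc by metis+
  moreover have "x = act k (mcomp \<epsilon> \<sigma>) u" "x'' = act k (mcomp \<delta>' \<tau>) u"
    using act_act[OF e(1) r(1) _ u'(1)] act_act[OF d(2) r(2) _ u'(2)] e(8) d(9) r s by auto
  moreover have "mcomp \<epsilon> \<sigma> \<in> Lam k" "mcomp \<delta>' \<tau> \<in> Lam k" "src (mcomp \<epsilon> \<sigma>) = src \<sigma>"
    using e(1,3) d(2) r(1-4,7) s by (simp_all add: Lam_mcomp src_mcomp)
  ultimately show ?thesis
    using assms e(3) d(4) r(6) unfolding t trel_iff
    by (intro conjI exI[of _ "mcomp \<epsilon> \<sigma>"] exI[of _ "mcomp \<delta>' \<tau>"] exI[of _ u]) auto
qed

lemma gstep_trel: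
  assumes "gstep k t t'" shows "trel k t t'"
  using assms
proof cases
  case (1 \<eta> \<mu> \<nu> x)
  have x: "x \<in> vbd k (src \<eta>)" using 1 by (auto simp: triples_iff src_mcomp)
  then have "act k (vertex (src \<eta>)) x = x"
    using act_vertex[OF src_pos[OF \<open>\<eta> \<in> Lam k\<close>] vbd_Zstar] by blast
  moreover have "vertex (src \<eta>) \<in> Lam k" using src_pos[OF 1(3)] by (rule vertex_in_Lam)
  moreover have "src (mcomp \<mu> \<eta>) = src \<eta>" using 1(4) by (rule src_mcomp)
  ultimately show ?thesis
    unfolding 1(1,2) trel_iff using 1(3-6) x
    by (intro conjI exI[of _ \<eta>] exI[of _ "vertex (src \<eta>)"] exI[of _ x]) simp_all
qed

lemma gstep_refine:
  assumes "(\<mu>, \<nu>, act k \<eta> x) \<in> triples k" "\<eta> \<in> Lam k" "rng \<eta> = src \<mu>" "x \<in> vbd k (src \<eta>)"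
  shows "gstep k (\<mu>, \<nu>, act k \<eta> x) (mcomp \<mu> \<eta>, mcomp \<nu> \<eta>, x)"
  using assms by (intro gstep.intros) (auto simp: triples_iff Lam_mcomp src_mcomp)

lemma equivclp_gstep_iff:
  assumes "t \<in> triples k" shows "equivclp (gstep k) t t' \<longleftrightarrow> trel k t t'"
proof
  assume "equivclp (gstep k) t t'"
  then show "trel k t t'"
  proof (induction rule: equivclp_induct)
    case base
    obtain \<mu> \<nu> x where "t = (\<mu>, \<nu>, x)" by (metis prod.exhaust)
    with assms show ?case using trel_refl by simp
  qed (blast intro: trel_trans trel_sym dest: gstep_trel)
next
  assume "trel k t t'"
  moreover obtain \<mu> \<nu> x \<mu>' \<nu>' x' where t: "t = (\<mu>, \<nu>, x)" "t' = (\<mu>', \<nu>', x')" by (metis prod.exhaust)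
  ultimately obtain \<epsilon> \<epsilon>' z where e: "\<epsilon> \<in> Lam k" "\<epsilon>' \<in> Lam k" "rng \<epsilon> = src \<mu>" "rng \<epsilon>' = src \<mu>'"
    "mcomp \<mu> \<epsilon> = mcomp \<mu>' \<epsilon>'" "mcomp \<nu> \<epsilon> = mcomp \<nu>' \<epsilon>'" "z \<in> vbd k (src \<epsilon>)"
    "x = act k \<epsilon> z" "x' = act k \<epsilon>' z" "(\<mu>, \<nu>, x) \<in> triples k" "(\<mu>', \<nu>', x') \<in> triples k"
    unfolding t trel_iff by blast
  have "src \<epsilon> = src \<epsilon>'" using src_eq_of_mcomp_eq e by blast
  then have "gstep k t (mcomp \<mu> \<epsilon>, mcomp \<nu> \<epsilon>, z)" "gstep k t' (mcomp \<mu>' \<epsilon>', mcomp \<nu>' \<epsilon>', z)"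
    unfolding t using gstep_refine[OF e(10)[unfolded e(8)] e(1,3,7)]
      gstep_refine[OF e(11)[unfolded e(9)] e(2,4)] e(7-9) by simp_all
  then show "equivclp (gstep k) t t'"
    using e(5,6) by (metis r_into_equivclp converse_r_into_equivclp equivclp_trans)
qed

lemma gclass_eq: "t \<in> triples k \<Longrightarrow> gclass k t = {t'. trel k t t'}"
  by (simp add: gclass_def equivclp_gstep_iff)

lemma in_gclass: "t \<in> triples k \<Longrightarrow> t \<in> gclass k t"
  by (simp add: gclass_def)

lemma gclass_eq_iff:
  "t \<in> triples k \<Longrightarrow> t' \<in> triples k \<Longrightarrow> gclass k t = gclass k t' \<longleftrightarrow> trel k t t'"
  using in_gclass[of t' k] by (auto simp: gclass_eq intro: trel_trans trel_sym)

lemma trel_triples: "trel k t t' \<Longrightarrow> t \<in> triples k \<and> t' \<in> triples k"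
  by (simp add: trel_def)

lemma G_cases:
  assumes "g \<in> G k"
  obtains \<mu> \<nu> x where "(\<mu>, \<nu>, x) \<in> triples k" "g = gclass k (\<mu>, \<nu>, x)"
proof -
  obtain t where t: "t \<in> triples k" "g = gclass k t" using assms by (auto simp: G_def)
  obtain \<mu> \<nu> x where "t = (\<mu>, \<nu>, x)" by (metis prod.exhaust)
  with t that show thesis by blast
qed

lemma trel_act_eq:
  assumes "trel k (\<mu>, \<nu>, x) (\<mu>', \<nu>', x')"
  shows "act k \<mu> x = act k \<mu>' x'" "act k \<nu> x = act k \<nu>' x'"
proof -
  obtain \<epsilon> \<epsilon>' z where e: "\<epsilon> \<in> Lam k" "\<epsilon>' \<in> Lam k" "rng \<epsilon> = src \<mu>" "rng \<epsilon>' = src \<mu>'"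
    "mcomp \<mu> \<epsilon> = mcomp \<mu>' \<epsilon>'" "mcomp \<nu> \<epsilon> = mcomp \<nu>' \<epsilon>'" "z \<in> vbd k (src \<epsilon>)"
    "x = act k \<epsilon> z" "x' = act k \<epsilon>' z" "(\<mu>, \<nu>, x) \<in> triples k" "(\<mu>', \<nu>', x') \<in> triples k"
    using assms unfolding trel_iff by blast
  have z: "z \<in> Zstar k (vertex (src \<epsilon>))" "z \<in> Zstar k (vertex (src \<epsilon>'))"
    using vbd_Zstar[OF e(7)] src_eq_of_mcomp_eq[OF e(5,3,4)] by auto
  have m: "\<mu> \<in> Lam k" "\<nu> \<in> Lam k" "\<mu>' \<in> Lam k" "\<nu>' \<in> Lam k" "src \<mu> = src \<nu>" "src \<mu>' = src \<nu>'"
    using e(10,11) by (auto simp: triples_iff)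
  show "act k \<mu> x = act k \<mu>' x'"
    using act_act[OF m(1) e(1,3) z(1)] act_act[OF m(3) e(2,4) z(2)] e(5,8,9) by simp
  show "act k \<nu> x = act k \<nu>' x'"
    using act_act[OF m(2) e(1) _ z(1)] act_act[OF m(4) e(2) _ z(2)] e m by simp
qed

lemma gsrc_gclass: 
  assumes "(\<mu>, \<nu>, x) \<in> triples k" shows "gsrc k (gclass k (\<mu>, \<nu>, x)) = act k \<nu> x"
proof -
  have "y = act k \<nu> x" if "\<exists>(\<mu>, \<nu>, x)\<in>gclass k (\<mu>, \<nu>, x). y = act k \<nu> x" for y
  proof -
    from that obtain \<mu>' \<nu>' x' where "trel k (\<mu>, \<nu>, x) (\<mu>', \<nu>', x')" "y = act k \<nu>' x'"
      unfolding gclass_eq[OF assms] by blast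
    then show ?thesis using trel_act_eq(2) by metis
  qed
  moreover have "\<exists>(\<mu>, \<nu>, x')\<in>gclass k (\<mu>, \<nu>, x). act k \<nu> x = act k \<nu> x'"
    using in_gclass[OF assms] by blast
  ultimately show ?thesis
    unfolding gsrc_def using in_gclass[OF assms] by (intro the_equality) blast+
qed

lemma grng_gclass: 
  assumes "(\<mu>, \<nu>, x) \<in> triples k" shows "grng k (gclass k (\<mu>, \<nu>, x)) = act k \<mu> x"
proof -
  have "y = act k \<mu> x" if "\<exists>(\<mu>, \<nu>, x)\<in>gclass k (\<mu>, \<nu>, x). y = act k \<mu> x" for y
  proof -
    from that obtain \<mu>' \<nu>' x' where "trel k (\<mu>, \<nu>, x) (\<mu>', \<nu>', x')" "y = act k \<mu>' x'"
      unfolding gclass_eq[OF assms] by blast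
    then show ?thesis using trel_act_eq(1) by metis
  qed
  then show ?thesis
    unfolding grng_def using in_gclass[OF assms] by (intro the_equality) blast+
qed

lemma trel_swap: "trel k (\<mu>, \<nu>, x) (\<mu>', \<nu>', x') \<Longrightarrow> trel k (\<nu>, \<mu>, x) (\<nu>', \<mu>', x')"
  unfolding trel_iff triples_iff by metis

lemma triples_swap: "(\<mu>, \<nu>, x) \<in> triples k \<Longrightarrow> (\<nu>, \<mu>, x) \<in> triples k"
  by (auto simp: triples_iff)

lemma ginv_gclass:
  assumes "(\<mu>, \<nu>, x) \<in> triples k" shows "ginv (gclass k (\<mu>, \<nu>, x)) = gclass k (\<nu>, \<mu>, x)"
  unfolding ginv_def gclass_eq[OF assms] gclass_eq[OF triples_swap[OF assms]]
  by (auto dest: trel_swap)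

lemma ginv_props:
  assumes "g \<in> G k"
  shows "ginv g \<in> G k" "ginv (ginv g) = g" "gsrc k (ginv g) = grng k g" "grng k (ginv g) = gsrc k g"
proof -
  obtain \<mu> \<nu> x where g: "(\<mu>, \<nu>, x) \<in> triples k" "g = gclass k (\<mu>, \<nu>, x)" using assms by (rule G_cases)
  note s = triples_swap[OF g(1)]
  show "ginv g \<in> G k" "ginv (ginv g) = g" "gsrc k (ginv g) = grng k g" "grng k (ginv g) = gsrc k g"
    unfolding g(2) ginv_gclass[OF g(1)] ginv_gclass[OF s] gsrc_gclass[OF g(1)] gsrc_gclass[OF s]
      grng_gclass[OF g(1)] grng_gclass[OF s] using s by (auto simp: G_def)
qed

text \<open>\<open>gmult\<close> is a definite description; \<open>trel_compose\<close> shows that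
  all admissible representatives yield one class.\<close>

lemma gmult_gclass:
  assumes a: "(\<mu>, \<nu>, x) \<in> triples k" and b: "(\<nu>, \<eta>, x) \<in> triples k"
  shows "gmult k (gclass k (\<mu>, \<nu>, x)) (gclass k (\<nu>, \<eta>, x)) = gclass k (\<mu>, \<eta>, x)"
  unfolding gmult_def
proof (rule the_equality)
  show "\<exists>\<mu>' \<nu>' \<eta>' x'. (\<mu>', \<nu>', x') \<in> gclass k (\<mu>, \<nu>, x) \<and> (\<nu>', \<eta>', x') \<in> gclass k (\<nu>, \<eta>, x) \<and>
      gclass k (\<mu>, \<eta>, x) = gclass k (\<mu>', \<eta>', x')"
    using in_gclass[OF a] in_gclass[OF b] by blast
  fix c assume "\<exists>\<mu>' \<nu>' \<eta>' x'. (\<mu>', \<nu>', x') \<in> gclass k (\<mu>, \<nu>, x) \<and> (\<nu>', \<eta>', x') \<in> gclass k (\<nu>, \<eta>, x) \<and>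
      c = gclass k (\<mu>', \<eta>', x')"
  then obtain \<mu>' \<nu>' \<eta>' x' where *: "trel k (\<mu>, \<nu>, x) (\<mu>', \<nu>', x')" "trel k (\<nu>, \<eta>, x) (\<nu>', \<eta>', x')"
    "c = gclass k (\<mu>', \<eta>', x')" by (auto simp: gclass_eq[OF a] gclass_eq[OF b])
  from trel_compose[OF *(1,2)] show "c = gclass k (\<mu>, \<eta>, x)"
    using *(3) gclass_eq_iff trel_triples by metis
qed

text \<open>The description of the product asks for representatives that share the middle path and
  the point. Composability only says \<nu>x = \<nu>'y, and \<open>common_refinement\<close> turns
  this into such representatives.\<close>

lemma gmult_props:
  assumes "a \<in> G k" "b \<in> G k" "gsrc k a = grng k b"
  shows "gmult k a b \<in> G k" "grng k (gmult k a b) = grng k a" "gsrc k (gmult k a b) = gsrc k b"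
proof -
  obtain \<mu> \<nu> x where a: "(\<mu>, \<nu>, x) \<in> triples k" "a = gclass k (\<mu>, \<nu>, x)" using assms(1) by (rule G_cases)
  obtain \<nu>' \<eta> y where b: "(\<nu>', \<eta>, y) \<in> triples k" "b = gclass k (\<nu>', \<eta>, y)" using assms(2) by (rule G_cases)
  have eq: "act k \<nu> x = act k \<nu>' y"
    using assms(3) a b by (simp add: gsrc_gclass grng_gclass)
  have m: "\<nu> \<in> Lam k" "x \<in> vbd k (src \<nu>)" "\<nu>' \<in> Lam k" "y \<in> vbd k (src \<nu>')"
    using a b by (auto simp: triples_iff)
  obtain \<sigma> \<tau> u where r: "\<sigma> \<in> Lam k" "\<tau> \<in> Lam k" "rng \<sigma> = src \<nu>" "rng \<tau> = src \<nu>'"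
    "mcomp \<nu> \<sigma> = mcomp \<nu>' \<tau>" "u \<in> vbd k (src \<sigma>)" "src \<sigma> = src \<tau>" "x = act k \<sigma> u" "y = act k \<tau> u"
    using common_refinement[OF m eq] .
  have "gstep k (\<mu>, \<nu>, x) (mcomp \<mu> \<sigma>, mcomp \<nu> \<sigma>, u)"
    using a r unfolding r(8) by (intro gstep_refine) (auto simp: triples_iff)
  then have ta: "trel k (\<mu>, \<nu>, x) (mcomp \<mu> \<sigma>, mcomp \<nu> \<sigma>, u)" by (rule gstep_trel)
  have "gstep k (\<nu>', \<eta>, y) (mcomp \<nu>' \<tau>, mcomp \<eta> \<tau>, u)"
    using b r unfolding r(9) by (intro gstep_refine) (auto simp: triples_iff)
  then have tb: "trel k (\<nu>', \<eta>, y) (mcomp \<nu> \<sigma>, mcomp \<eta> \<tau>, u)" unfolding r(5) by (rule gstep_trel)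
  note t = ta[THEN trel_triples, THEN conjunct2] tb[THEN trel_triples, THEN conjunct2]
  have t': "(mcomp \<mu> \<sigma>, mcomp \<eta> \<tau>, u) \<in> triples k" using t by (auto simp: triples_iff)
  have a': "a = gclass k (mcomp \<mu> \<sigma>, mcomp \<nu> \<sigma>, u)" and b': "b = gclass k (mcomp \<nu> \<sigma>, mcomp \<eta> \<tau>, u)"
    using a b ta tb t gclass_eq_iff by metis+
  have "gmult k a b = gclass k (mcomp \<mu> \<sigma>, mcomp \<eta> \<tau>, u)"
    unfolding a' b' using t by (rule gmult_gclass)
  with t' show "gmult k a b \<in> G k" "grng k (gmult k a b) = grng k a" "gsrc k (gmult k a b) = gsrc k b"
    unfolding a' b' using t by (auto simp: G_def grng_gclass gsrc_gclass)
qed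

text \<open>
  All pairs \<open>(\<delta>, \<delta>')\<close> with \<open>\<mu>\<delta> = \<mu>'\<delta>'\<close> and \<open>\<nu>\<delta> = \<nu>'\<delta>'\<close> factor through a single one, because
  \<open>\<mu>\<close> and \<open>\<mu>'\<close> have a least common extension and \<open>\<Lambda>\<close> is right cancellative.
\<close>

lemma trel_minimal:
  assumes "src \<mu> = src \<nu>" "src \<mu>' = src \<nu>'"
  shows "(\<forall>x x'. \<not> trel k (\<mu>, \<nu>, x) (\<mu>', \<nu>', x')) \<or>
    (\<exists>\<epsilon> \<epsilon>'. \<epsilon> \<in> Lam k \<and> \<epsilon>' \<in> Lam k \<and> rng \<epsilon>' = src \<mu>' \<and> src \<epsilon> = src \<epsilon>' \<and>
      (\<forall>x x'. (\<mu>, \<nu>, x) \<in> triples k \<longrightarrow> (\<mu>', \<nu>', x') \<in> triples k \<longrightarrow>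
        (trel k (\<mu>, \<nu>, x) (\<mu>', \<nu>', x') \<longleftrightarrow> \<epsilon>' \<in> x' \<and> x = act k \<epsilon> (shift \<epsilon>' x'))))"
proof (cases "\<exists>x x'. trel k (\<mu>, \<nu>, x) (\<mu>', \<nu>', x')")
  case True
  then obtain \<delta> \<delta>' where d: "\<delta> \<in> Lam k" "\<delta>' \<in> Lam k" "rng \<delta> = src \<mu>" "rng \<delta>' = src \<mu>'"
    "mcomp \<mu> \<delta> = mcomp \<mu>' \<delta>'" "mcomp \<nu> \<delta> = mcomp \<nu>' \<delta>'"
    unfolding trel_iff by blast
  have "mle \<mu> (mcomp \<mu> \<delta>)" "mle \<mu>' (mcomp \<mu> \<delta>)"
    using mleI[OF d(3)] mleI[OF d(4)] d(5) by auto
  then obtain \<kappa> where \<kappa>: "mle \<mu> \<kappa>" "mle \<mu>' \<kappa>" "\<And>\<rho>. mle \<mu> \<rho> \<Longrightarrow> mle \<mu>' \<rho> \<Longrightarrow> mle \<kappa> \<rho>"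
    using mle_lub by metis
  obtain \<epsilon> where \<epsilon>: "rng \<epsilon> = src \<mu>" "\<kappa> = mcomp \<mu> \<epsilon>" using \<kappa>(1) by (rule mleE)
  obtain \<epsilon>' where \<epsilon>': "rng \<epsilon>' = src \<mu>'" "\<kappa> = mcomp \<mu>' \<epsilon>'" using \<kappa>(2) by (rule mleE)
  have src: "src \<epsilon> = src \<epsilon>'" using src_eq_of_mcomp_eq \<epsilon> \<epsilon>' by metis
  have factor: "\<exists>\<sigma>. rng \<sigma> = src \<epsilon> \<and> \<delta> = mcomp \<epsilon> \<sigma> \<and> \<delta>' = mcomp \<epsilon>' \<sigma>"
    if h: "rng \<delta> = src \<mu>" "rng \<delta>' = src \<mu>'" "mcomp \<mu> \<delta> = mcomp \<mu>' \<delta>'" for \<delta> \<delta>'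
  proof -
    have "mle \<kappa> (mcomp \<mu> \<delta>)" using \<kappa>(3) mleI[OF h(1)] mleI[OF h(2)] h(3) by simp
    then obtain \<sigma> where \<sigma>: "rng \<sigma> = src \<kappa>" "mcomp \<mu> \<delta> = mcomp \<kappa> \<sigma>" by (rule mleE)
    have "mcomp \<mu> \<delta> = mcomp \<mu> (mcomp \<epsilon> \<sigma>)" "mcomp \<mu>' \<delta>' = mcomp \<mu>' (mcomp \<epsilon>' \<sigma>)"
      using \<sigma> h(3) \<epsilon>(2) \<epsilon>'(2) mcomp_assoc by metis+
    then have "\<delta> = mcomp \<epsilon> \<sigma>" "\<delta>' = mcomp \<epsilon>' \<sigma>"
      using mcomp_left_cancel[of \<delta> "mcomp \<epsilon> \<sigma>" \<mu>]
        mcomp_left_cancel[of \<delta>' "mcomp \<epsilon>' \<sigma>" \<mu>'] h \<epsilon> \<epsilon>' by auto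
    moreover have "rng \<sigma> = src \<epsilon>" using \<sigma>(1) \<epsilon> src_mcomp by metis
    ultimately show ?thesis by blast
  qed
  obtain \<sigma> where \<sigma>: "rng \<sigma> = src \<epsilon>" "\<delta> = mcomp \<epsilon> \<sigma>" "\<delta>' = mcomp \<epsilon>' \<sigma>" using factor[OF d(3,4,5)] by blast
  have L: "\<epsilon> \<in> Lam k" "\<epsilon>' \<in> Lam k" using d(1,2) \<sigma> src Lam_mcomp by metis+
  have "mcomp (mcomp \<nu> \<epsilon>) \<sigma> = mcomp (mcomp \<nu>' \<epsilon>') \<sigma>" using d(6) \<sigma> mcomp_assoc by metis
  then have \<nu>: "mcomp \<nu> \<epsilon> = mcomp \<nu>' \<epsilon>'" by (rule mcomp_right_cancel)
  have "trel k (\<mu>, \<nu>, x) (\<mu>', \<nu>', x') \<longleftrightarrow> \<epsilon>' \<in> x' \<and> x = act k \<epsilon> (shift \<epsilon>' x')"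
    if t: "(\<mu>, \<nu>, x) \<in> triples k" "(\<mu>', \<nu>', x') \<in> triples k" for x x'
  proof
    assume "trel k (\<mu>, \<nu>, x) (\<mu>', \<nu>', x')"
    then obtain \<delta> \<delta>' z where d: "\<delta> \<in> Lam k" "\<delta>' \<in> Lam k" "rng \<delta> = src \<mu>" "rng \<delta>' = src \<mu>'"
      "mcomp \<mu> \<delta> = mcomp \<mu>' \<delta>'" "z \<in> vbd k (src \<delta>)" "x = act k \<delta> z" "x' = act k \<delta>' z"
      unfolding trel_iff by blast
    obtain \<sigma> where \<sigma>: "rng \<sigma> = src \<epsilon>" "\<delta> = mcomp \<epsilon> \<sigma>" "\<delta>' = mcomp \<epsilon>' \<sigma>" using factor[OF d(3,4,5)] by blast
    have \<sigma>L: "\<sigma> \<in> Lam k" using d(1) \<sigma> Lam_mcomp by metis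
    have z: "z \<in> Zstar k (vertex (src \<sigma>))" using vbd_Zstar[OF d(6)] \<sigma> src_mcomp by metis
    have a: "x = act k \<epsilon> (act k \<sigma> z)" "x' = act k \<epsilon>' (act k \<sigma> z)"
      using act_act[OF L(1) \<sigma>L \<sigma>(1) z] act_act[OF L(2) \<sigma>L _ z] \<sigma> src d(7,8) by auto
    have "act k \<sigma> z \<in> Zstar k (vertex (src \<epsilon>'))"
      using act_in_Zstar_vertex[OF \<sigma>L z] \<sigma>(1) src by simp
    then have "\<epsilon>' \<in> x'" "shift \<epsilon>' x' = act k \<sigma> z" using in_act shift_act L(2) a(2) by auto
    then show "\<epsilon>' \<in> x' \<and> x = act k \<epsilon> (shift \<epsilon>' x')" using a(1) by simp
  next
    assume *: "\<epsilon>' \<in> x' \<and> x = act k \<epsilon> (shift \<epsilon>' x')"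
    then have x': "x' \<in> Z k \<epsilon>'" using t(2) by (simp add: triples_iff vbd_eq Z_def)
    then have "shift \<epsilon>' x' \<in> vbd k (src \<epsilon>)" "x' = act k \<epsilon>' (shift \<epsilon>' x')"
      using shift_vbd src act_shift by (auto simp: Z_eq)
    moreover have "mcomp \<mu> \<epsilon> = mcomp \<mu>' \<epsilon>'" using \<epsilon> \<epsilon>' by simp
    ultimately show "trel k (\<mu>, \<nu>, x) (\<mu>', \<nu>', x')"
      unfolding trel_iff using * t L \<epsilon> \<epsilon>' \<nu> by blast
  qed
  then show ?thesis using L \<epsilon>'(1) src by blast
qed blast

text \<open>\<open>P\<close> is the set of coordinates x' for which the class of (\<mu>', \<nu>',
  x') lies in [\<mu>, \<nu>, E]. By \<open>trel_minimal\<close> it is empty or the preimage of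
  \<open>E\<close> under a replacement of prefixes. Compactness and closedness of bisections both
  reduce to this.\<close>

lemma clopen_trel_preimage:
  assumes E: "openin (bd_top k) E" "closedin (bd_top k) E" "E \<subseteq> vbd k (src \<mu>)"
    and \<mu>: "\<mu> \<in> vLam k 1" "\<nu> \<in> vLam k 1" "src \<mu> = src \<nu>"
    and \<mu>': "\<mu>' \<in> vLam k 1" "\<nu>' \<in> vLam k 1" "src \<mu>' = src \<nu>'"
  defines "P \<equiv> {x'\<in>vbd k (src \<mu>'). \<exists>x\<in>E. trel k (\<mu>, \<nu>, x) (\<mu>', \<nu>', x')}"
  shows "openin (bd_top k) P" "closedin (bd_top k) P"
proof -
  have "openin (bd_top k) P \<and> closedin (bd_top k) P"
    using trel_minimal[OF \<mu>(3) \<mu>'(3), of k]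
  proof (elim disjE exE conjE)
    assume "\<forall>x x'. \<not> trel k (\<mu>, \<nu>, x) (\<mu>', \<nu>', x')"
    then have "P = {}" by (auto simp: P_def)
    then show ?thesis by simp
  next
    fix \<epsilon> \<epsilon>'
    assume \<epsilon>: "\<epsilon> \<in> Lam k" "\<epsilon>' \<in> Lam k" "rng \<epsilon>' = src \<mu>'" "src \<epsilon> = src \<epsilon>'"
      "\<forall>x x'. (\<mu>, \<nu>, x) \<in> triples k \<longrightarrow> (\<mu>', \<nu>', x') \<in> triples k \<longrightarrow>
        (trel k (\<mu>, \<nu>, x) (\<mu>', \<nu>', x') \<longleftrightarrow> \<epsilon>' \<in> x' \<and> x = act k \<epsilon> (shift \<epsilon>' x'))"
    have 1: "(\<mu>, \<nu>, x) \<in> triples k" if "x \<in> E" for x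
      using that \<mu> E(3) by (auto simp: triples_def)
    have 2: "(\<mu>', \<nu>', x) \<in> triples k" if "x \<in> vbd k (src \<mu>')" for x
      using that \<mu>' by (auto simp: triples_def)
    have 3: "x \<in> vbd k (src \<mu>')" if "x \<in> Z k \<epsilon>'" for x
      using that \<epsilon>(3) bd_subset_Lstar vertex_in_Lstar[of x k \<epsilon>' "src \<mu>'"] by (auto simp: vbd_eq Z_def)
    have "P = {x\<in>Z k \<epsilon>'. act k \<epsilon> (shift \<epsilon>' x) \<in> E}"
    proof (intro set_eqI iffI)
      fix x' assume x': "x' \<in> P"
      then obtain x where x: "x \<in> E" "trel k (\<mu>, \<nu>, x) (\<mu>', \<nu>', x')" by (auto simp: P_def)
      have v: "x' \<in> vbd k (src \<mu>')" using x' by (auto simp: P_def)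
      have "\<epsilon>' \<in> x'" "x = act k \<epsilon> (shift \<epsilon>' x')" using \<epsilon>(5) 1[OF x(1)] 2[OF v] x(2) by blast+
      then show "x' \<in> {x\<in>Z k \<epsilon>'. act k \<epsilon> (shift \<epsilon>' x) \<in> E}" using v x(1) by (auto simp: vbd_eq Z_def)
    next
      fix x' assume "x' \<in> {x\<in>Z k \<epsilon>'. act k \<epsilon> (shift \<epsilon>' x) \<in> E}"
      then have x': "x' \<in> Z k \<epsilon>'" "act k \<epsilon> (shift \<epsilon>' x') \<in> E" by auto
      then have "trel k (\<mu>, \<nu>, act k \<epsilon> (shift \<epsilon>' x')) (\<mu>', \<nu>', x')"
        using \<epsilon>(5) 1[OF x'(2)] 2[OF 3[OF x'(1)]] by (auto simp: Z_def)
      then show "x' \<in> P" using 3[OF x'(1)] x'(2) by (auto simp: P_def)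
    qed
    then show ?thesis using clopen_transport[OF \<epsilon>(1,4) E(1,2)] by simp
  qed
  then show "openin (bd_top k) P" "closedin (bd_top k) P" by auto
qed

lemma gclass_in_gset:
  assumes "\<mu> \<in> vLam k 1" "\<nu> \<in> vLam k 1" "src \<mu> = src \<nu>" "E \<subseteq> vbd k (src \<mu>)" "t \<in> triples k"
  shows "gclass k t \<in> gset k \<mu> \<nu> E \<longleftrightarrow> (\<exists>x\<in>E. trel k (\<mu>, \<nu>, x) t)"
proof -
  have "(\<mu>, \<nu>, x) \<in> triples k" if "x \<in> E" for x using that assms by (auto simp: triples_def)
  then have "gclass k t = gclass k (\<mu>, \<nu>, x) \<longleftrightarrow> trel k (\<mu>, \<nu>, x) t" if "x \<in> E" for x
    using that assms(5) gclass_eq_iff by metis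
  then show ?thesis unfolding gset_def by blast
qed

lemma gset_subset_G:
  "\<mu> \<in> vLam k 1 \<Longrightarrow> \<nu> \<in> vLam k 1 \<Longrightarrow> src \<mu> = src \<nu> \<Longrightarrow> E \<subseteq> vbd k (src \<mu>) \<Longrightarrow> gset k \<mu> \<nu> E \<subseteq> G k"
  by (auto simp: gset_def G_def triples_def intro!: imageI)

text \<open>The base of \<open>G_top\<close> with closed in place of compact. The two agree for
  subsets of one \<open>vbd k i\<close>, a compact Hausdorff space, and closedness is what preimages
  preserve.\<close>

definition gbase :: "(nat \<Rightarrow> nat) \<Rightarrow> gelt set set" where
  "gbase k = {gset k \<mu> \<nu> E | \<mu> \<nu> E. \<mu> \<in> vLam k 1 \<and> \<nu> \<in> vLam k 1 \<and> src \<mu> = src \<nu> \<and>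
     E \<subseteq> vbd k (src \<mu>) \<and> openin (bd_top k) E \<and> closedin (bd_top k) E}"

lemma G_top_gbase: "G_top k = topology_generated_by (gbase k)"
proof -
  have h: "Hausdorff_space (bd_top k)"
  proof -
    have "\<exists>U V. openin (bd_top k) U \<and> openin (bd_top k) V \<and> x \<in> U \<and> y \<in> V \<and> disjnt U V"
      if "x \<in> bd k" "y \<in> bd k" "\<rho> \<in> x" "\<rho> \<notin> y" for x y \<rho>
    proof -
      have "openin (bd_top k) (topspace (bd_top k) - Z k \<rho>)" using closedin_Z by blast
      moreover have "x \<in> Z k \<rho>" "y \<in> topspace (bd_top k) - Z k \<rho>" using that by (auto simp: Z_def)
      moreover have "disjnt (Z k \<rho>) (topspace (bd_top k) - Z k \<rho>)" by (auto simp: disjnt_def)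
      ultimately show ?thesis using openin_Z by blast
    qed
    then have "\<exists>U V. openin (bd_top k) U \<and> openin (bd_top k) V \<and> x \<in> U \<and> y \<in> V \<and> disjnt U V"
      if "x \<in> bd k" "y \<in> bd k" "x \<noteq> y" for x y
      using that by (metis disjnt_sym subset_antisym subsetI)
    then show ?thesis by (simp add: Hausdorff_space_def)
  qed
  have "closedin (bd_top k) E \<longleftrightarrow> compactin (bd_top k) E" if "E \<subseteq> vbd k i" for E i
    using compactin_bd_top[OF _ that] compactin_imp_closedin[OF h] by blast
  then show ?thesis
    unfolding G_top_def gbase_def by (intro arg_cong[of _ _ topology_generated_by] Collect_cong) metis
qed

lemma topspace_G_top [simp]: "topspace (G_top k) = G k"
proof -
  have "\<Union> (gbase k) \<subseteq> G k" unfolding gbase_def using gset_subset_G by blast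
  moreover have "G k \<subseteq> \<Union> (gbase k)"
  proof
    fix g assume "g \<in> G k"
    then obtain \<mu> \<nu> x where g: "(\<mu>, \<nu>, x) \<in> triples k" "g = gclass k (\<mu>, \<nu>, x)" by (rule G_cases)
    then have "g \<in> gset k \<mu> \<nu> (vbd k (src \<mu>))" by (auto simp: gset_def triples_def)
    moreover have "gset k \<mu> \<nu> (vbd k (src \<mu>)) \<in> gbase k"
      using g(1) openin_Z closedin_Z unfolding gbase_def triples_def vbd_eq by blast
    ultimately show "g \<in> \<Union> (gbase k)" by blast
  qed
  ultimately show ?thesis by (auto simp: G_top_gbase)
qed

context
  fixes k \<mu> \<nu> E
  assumes \<mu>: "\<mu> \<in> vLam k 1" "\<nu> \<in> vLam k 1" "src \<mu> = src \<nu>"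
    and E: "E \<subseteq> vbd k (src \<mu>)" "openin (bd_top k) E" "closedin (bd_top k) E"
begin

lemma openin_gset: "openin (G_top k) (gset k \<mu> \<nu> E)"
  unfolding G_top_gbase by (rule topology_generated_by_Basis) (use \<mu> E in \<open>unfold gbase_def, blast\<close>)

text \<open>Image of the compact set \<open>E\<close> under x \<mapsto> [\<mu>, \<nu>, x], which is
  continuous by \<open>clopen_trel_preimage\<close>.\<close>

lemma compactin_gset: "compactin (G_top k) (gset k \<mu> \<nu> E)"
proof -
  let ?X = "subtopology (bd_top k) (vbd k (src \<mu>))"
  have tX: "topspace ?X = vbd k (src \<mu>)" by (auto simp: vbd_eq Z_def)
  have "continuous_map ?X (G_top k) (\<lambda>x. gclass k (\<mu>, \<nu>, x))"
    unfolding G_top_gbase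
  proof (rule continuous_on_generated_topo)
    fix U assume "U \<in> gbase k"
    then obtain \<mu>' \<nu>' E' where U: "U = gset k \<mu>' \<nu>' E'" "\<mu>' \<in> vLam k 1" "\<nu>' \<in> vLam k 1"
      "src \<mu>' = src \<nu>'" "E' \<subseteq> vbd k (src \<mu>')" "openin (bd_top k) E'" "closedin (bd_top k) E'"
      by (auto simp: gbase_def)
    have t: "(\<mu>, \<nu>, x) \<in> triples k" if "x \<in> vbd k (src \<mu>)" for x using that \<mu> by (auto simp: triples_def)
    have "(\<lambda>x. gclass k (\<mu>, \<nu>, x)) -` U \<inter> topspace ?X =
        {x\<in>vbd k (src \<mu>). \<exists>x'\<in>E'. trel k (\<mu>', \<nu>', x') (\<mu>, \<nu>, x)}"
      unfolding tX U(1) using gclass_in_gset[OF U(2-5) t] by blast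
    moreover have "openin (bd_top k) \<dots>"
      using clopen_trel_preimage(1)[OF U(6,7,5,2,3,4) \<mu>] .
    moreover have "openin (bd_top k) (vbd k (src \<mu>))" using openin_Z by (simp add: vbd_eq)
    ultimately show "openin ?X ((\<lambda>x. gclass k (\<mu>, \<nu>, x)) -` U \<inter> topspace ?X)"
      by (auto simp: openin_open_subtopology)
  next
    have "gset k \<mu> \<nu> (vbd k (src \<mu>)) \<in> gbase k"
      using \<mu> openin_Z closedin_Z unfolding gbase_def vbd_eq by blast
    then show "(\<lambda>x. gclass k (\<mu>, \<nu>, x)) ` topspace ?X \<subseteq> \<Union> (gbase k)"
      unfolding tX gset_def by blast
  qed
  moreover have "compactin ?X E"
    using compactin_bd_top[OF E(3,1)] E(1) by (simp add: compactin_subtopology)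
  moreover have "gset k \<mu> \<nu> E = (\<lambda>x. gclass k (\<mu>, \<nu>, x)) ` E" by (auto simp: gset_def)
  ultimately show ?thesis using image_compactin by metis
qed

text \<open>A class outside the bisection has a coordinate in the clopen set \<open>?V - ?P\<close>,
  which spans a basic neighbourhood missing the bisection. Closedness keeps the closure of a support
  in \<open>Cc\<close> under control and makes indicators continuous.\<close>

lemma closedin_gset: "closedin (G_top k) (gset k \<mu> \<nu> E)"
  unfolding closedin_def
proof
  show "gset k \<mu> \<nu> E \<subseteq> topspace (G_top k)" using gset_subset_G \<mu> E by simp
  show "openin (G_top k) (topspace (G_top k) - gset k \<mu> \<nu> E)"
  proof (subst openin_subopen, intro ballI)
    fix g assume g: "g \<in> topspace (G_top k) - gset k \<mu> \<nu> E"
    then obtain \<mu>' \<nu>' x' where g': "(\<mu>', \<nu>', x') \<in> triples k" "g = gclass k (\<mu>', \<nu>', x')"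
      using G_cases topspace_G_top by blast
    let ?V = "vbd k (src \<mu>')"
    let ?P = "{x'\<in>?V. \<exists>x\<in>E. trel k (\<mu>, \<nu>, x) (\<mu>', \<nu>', x')}"
    have \<mu>': "\<mu>' \<in> vLam k 1" "\<nu>' \<in> vLam k 1" "src \<mu>' = src \<nu>'" "x' \<in> ?V"
      using g'(1) by (auto simp: triples_def)
    have t: "(\<mu>', \<nu>', x) \<in> triples k" if "x \<in> ?V" for x using that \<mu>' by (auto simp: triples_def)
    have P: "openin (bd_top k) ?P" "closedin (bd_top k) ?P"
      using clopen_trel_preimage[OF E(2,3,1) \<mu> \<mu>'(1-3)] .
    have V: "openin (bd_top k) ?V" "closedin (bd_top k) ?V" using openin_Z closedin_Z by (auto simp: vbd_eq)
    have "gset k \<mu>' \<nu>' (?V - ?P) \<in> gbase k"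
      unfolding gbase_def using \<mu>' openin_diff[OF V(1) P(2)] closedin_diff[OF V(2) P(1)] by blast
    then have "openin (G_top k) (gset k \<mu>' \<nu>' (?V - ?P))"
      unfolding G_top_gbase by (rule topology_generated_by_Basis)
    moreover have "g \<in> gset k \<mu>' \<nu>' (?V - ?P)"
    proof -
      have "x' \<notin> ?P" using g gclass_in_gset[OF \<mu> E(1) g'(1)] g'(2) by blast
      then show ?thesis using g'(2) \<mu>'(4) by (auto simp: gset_def)
    qed
    moreover have "gset k \<mu>' \<nu>' (?V - ?P) \<subseteq> topspace (G_top k) - gset k \<mu> \<nu> E"
    proof
      fix h assume "h \<in> gset k \<mu>' \<nu>' (?V - ?P)"
      then obtain x where x: "h = gclass k (\<mu>', \<nu>', x)" "x \<in> ?V" "x \<notin> ?P" by (auto simp: gset_def)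
      then have "h \<notin> gset k \<mu> \<nu> E" using gclass_in_gset[OF \<mu> E(1) t[OF x(2)]] by blast
      then show "h \<in> topspace (G_top k) - gset k \<mu> \<nu> E" using x t by (auto simp: G_def)
    qed
    ultimately show "\<exists>T. openin (G_top k) T \<and> g \<in> T \<and> T \<subseteq> topspace (G_top k) - gset k \<mu> \<nu> E" by blast
  qed
qed

end

section \<open>Continuous functions with compact support on the groupoid\<close>

lemma CcI:
  assumes "continuous_map (G_top k) euclidean f" "compactin (G_top k) K" "closedin (G_top k) K"
    "\<And>g. f g \<noteq> 0 \<Longrightarrow> g \<in> K"
  shows "f \<in> Cc k"
proof -
  have K: "K \<subseteq> G k" using assms(3) closedin_subset by fastforce
  have "G_top k closure_of {g\<in>G k. f g \<noteq> 0} \<subseteq> K"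
    using assms(3,4) by (intro closure_of_minimal) auto
  then have "compactin (G_top k) (G_top k closure_of {g\<in>G k. f g \<noteq> 0})"
    using closed_compactin[OF assms(2)] closedin_closure_of by blast
  moreover have "f g = 0" if "g \<notin> G k" for g using that assms(4)[of g] subsetD[OF K, of g] by argo
  ultimately show ?thesis using assms(1) unfolding Cc_def by blast
qed

lemma indicator_in_Cc:
  assumes \<mu>: "\<mu> \<in> vLam k 1" "\<nu> \<in> vLam k 1" "src \<mu> = src \<nu>"
    and E: "E \<subseteq> vbd k (src \<mu>)" "openin (bd_top k) E" "closedin (bd_top k) E"
  shows "indicator (gset k \<mu> \<nu> E) \<in> Cc k"
proof (rule CcI[OF _ compactin_gset[OF assms] closedin_gset[OF assms]])
  let ?A = "gset k \<mu> \<nu> E"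
  show "continuous_map (G_top k) euclidean (indicator ?A :: gelt \<Rightarrow> complex)"
    unfolding continuous_map
  proof (intro conjI allI impI)
    fix U :: "complex set"
    have "{x \<in> topspace (G_top k). indicator ?A x \<in> U} =
      (if 1 \<in> U then ?A else {}) \<union> (if 0 \<in> U then topspace (G_top k) - ?A else {})"
      using gset_subset_G[OF \<mu> E(1)] by (auto simp: indicator_def split: if_splits)
    then show "openin (G_top k) {x \<in> topspace (G_top k). indicator ?A x \<in> U}"
      using openin_gset[OF assms] closedin_gset[OF assms, unfolded closedin_def]
      by (cases "1 \<in> U"; cases "0 \<in> U") (simp_all only: if_True if_False openin_Un openin_empty)
  qed simp
qed (simp add: indicator_def split: if_splits)

lemma Cc_support:
  assumes "f \<in> Cc k"
  shows "\<exists>K. compactin (G_top k) K \<and> closedin (G_top k) K \<and> (\<forall>g. f g \<noteq> 0 \<longrightarrow> g \<in> K)"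
proof -
  let ?K = "G_top k closure_of {g\<in>G k. f g \<noteq> 0}"
  have "g \<in> ?K" if "f g \<noteq> 0" for g
    using that assms closure_of_subset[of "{g\<in>G k. f g \<noteq> 0}" "G_top k"] by (auto simp: Cc_def)
  with assms show ?thesis unfolding Cc_def by (intro exI[of _ ?K]) simp
qed

lemma Cc_lincomb:
  assumes "f \<in> Cc k" "h \<in> Cc k" shows "(\<lambda>g. c * f g + d * h g) \<in> Cc k"
proof -
  obtain K where K: "compactin (G_top k) K" "closedin (G_top k) K" "\<And>g. f g \<noteq> 0 \<Longrightarrow> g \<in> K"
    using Cc_support[OF assms(1)] by blast
  obtain L where L: "compactin (G_top k) L" "closedin (G_top k) L" "\<And>g. h g \<noteq> 0 \<Longrightarrow> g \<in> L"
    using Cc_support[OF assms(2)] by blast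
  show ?thesis
  proof (rule CcI)
    have fh: "continuous_map (G_top k) euclidean f" "continuous_map (G_top k) euclidean h"
      using assms by (auto simp: Cc_def)
    have m: "continuous_map euclidean euclidean (\<lambda>z::complex. c * z)" for c by (simp add: continuous_intros)
    have "continuous_map (G_top k) euclidean (\<lambda>g. c * f g)" "continuous_map (G_top k) euclidean (\<lambda>g. d * h g)"
      using continuous_map_compose[OF fh(1) m] continuous_map_compose[OF fh(2) m] by (simp_all add: o_def)
    then show "continuous_map (G_top k) euclidean (\<lambda>g. c * f g + d * h g)" by (rule continuous_map_add)
    show "compactin (G_top k) (K \<union> L)" "closedin (G_top k) (K \<union> L)"
      using K L by (auto intro: compactin_Un closedin_Un)
  qed (use K L in force)
qed

lemma Cc_zero: "(\<lambda>_. 0) \<in> Cc k"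
  by (rule CcI[of _ _ "{}"]) auto

lemma Cc_diff: "f \<in> Cc k \<Longrightarrow> h \<in> Cc k \<Longrightarrow> (\<lambda>g. f g - h g) \<in> Cc k"
  using Cc_lincomb[of f k h 1 "-1"] by simp

lemma Cc_sum:
  assumes "finite A" "A \<subseteq> Cc k" shows "(\<lambda>g. \<Sum>\<phi>\<in>A. c \<phi> * \<phi> g) \<in> Cc k"
  using assms
proof (induction A rule: finite_induct)
  case (insert \<phi> A)
  then show ?case using Cc_lincomb[of \<phi> k "\<lambda>g. \<Sum>\<phi>\<in>A. c \<phi> * \<phi> g" "c \<phi>" 1] by simp
qed (simp add: Cc_zero)

lemma Cc_bounded:
  assumes "f \<in> Cc k" shows "\<exists>B. \<forall>g. cmod (f g) \<le> B"
proof -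
  let ?K = "G_top k closure_of {g\<in>G k. f g \<noteq> 0}"
  have "compactin euclidean (f ` ?K)" using assms image_compactin unfolding Cc_def by blast
  then have "bounded (f ` ?K)" by (simp add: compact_imp_bounded)
  then obtain B where B: "\<And>g. g \<in> ?K \<Longrightarrow> cmod (f g) \<le> B" by (auto simp: bounded_iff)
  have "cmod (f g) \<le> max B 0" for g
  proof (cases "f g = 0")
    case False
    then have "g \<in> ?K"
      using assms closure_of_subset[of "{g\<in>G k. f g \<noteq> 0}" "G_top k"] by (auto simp: Cc_def)
    then show ?thesis using B by fastforce
  qed simp
  then show ?thesis by blast
qed

text \<open>The bisection property: \<open>act k \<mu>\<close> and \<open>act k \<nu>\<close> are
  injective because \<open>shift\<close> undoes them, so either the range or the source determines
  the coordinate.\<close>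

lemma gset_unique:
  assumes "\<mu> \<in> vLam k 1" "\<nu> \<in> vLam k 1" "src \<mu> = src \<nu>" "E \<subseteq> vbd k (src \<mu>)"
    and g: "g \<in> gset k \<mu> \<nu> E" "g' \<in> gset k \<mu> \<nu> E"
    and eq: "grng k g = grng k g' \<or> gsrc k g = gsrc k g'"
  shows "g = g'"
proof -
  obtain x x' where x: "x \<in> E" "g = gclass k (\<mu>, \<nu>, x)" "x' \<in> E" "g' = gclass k (\<mu>, \<nu>, x')"
    using g by (auto simp: gset_def)
  have t: "(\<mu>, \<nu>, x) \<in> triples k" "(\<mu>, \<nu>, x') \<in> triples k" using x assms by (auto simp: triples_def)
  then have L: "\<mu> \<in> Lam k" "\<nu> \<in> Lam k" "x \<in> Zstar k (vertex (src \<mu>))" "x' \<in> Zstar k (vertex (src \<mu>))"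
    using vbd_Zstar by (auto simp: triples_iff)
  have "act k \<mu> x = act k \<mu> x' \<or> act k \<nu> x = act k \<nu> x'"
    using eq t by (simp add: x gsrc_gclass grng_gclass)
  then have "x = x'" using shift_act L assms(3) by metis
  then show ?thesis using x by simp
qed

text \<open>The support of \<open>f\<close> is covered by finitely many bisections.\<close>

lemma Cc_fibres:
  assumes "f \<in> Cc k"
  shows "\<exists>N. \<forall>y.
    finite {g\<in>G k. f g \<noteq> 0 \<and> grng k g = y} \<and> card {g\<in>G k. f g \<noteq> 0 \<and> grng k g = y} \<le> N \<and>
    finite {g\<in>G k. f g \<noteq> 0 \<and> gsrc k g = y} \<and> card {g\<in>G k. f g \<noteq> 0 \<and> gsrc k g = y} \<le> N"
proof -
  obtain K where K: "compactin (G_top k) K" "closedin (G_top k) K" "\<And>g. f g \<noteq> 0 \<Longrightarrow> g \<in> K"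
    using Cc_support[OF assms] by blast
  have "K \<subseteq> \<Union> (gbase k)" using closedin_subset[OF K(2)] unfolding G_top_gbase by simp
  then obtain \<F> where \<F>: "finite \<F>" "\<F> \<subseteq> gbase k" "K \<subseteq> \<Union>\<F>"
    using compactinD[OF K(1), of "gbase k"] topology_generated_by_Basis unfolding G_top_gbase by metis
  have u: "g = g'" if "V \<in> \<F>" "g \<in> V" "g' \<in> V" "grng k g = grng k g' \<or> gsrc k g = gsrc k g'" for V g g'
    using that \<F>(2) gset_unique unfolding gbase_def by blast
  have "finite S \<and> card S \<le> card \<F>"
    if S: "\<And>g. g \<in> S \<Longrightarrow> f g \<noteq> 0" "\<And>g g'. g \<in> S \<Longrightarrow> g' \<in> S \<Longrightarrow> grng k g = grng k g' \<or> gsrc k g = gsrc k g'" for S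
  proof -
    have "\<forall>g\<in>S. \<exists>V\<in>\<F>. g \<in> V" using S(1) K(3) \<F>(3) by blast
    then obtain V where V: "\<And>g. g \<in> S \<Longrightarrow> V g \<in> \<F> \<and> g \<in> V g" by metis
    have "inj_on V S" using V u S(2) by (metis inj_onI)
    moreover have "V ` S \<subseteq> \<F>" using V by blast
    ultimately show ?thesis using \<F>(1) by (meson card_inj_on_le inj_on_finite)
  qed
  from this[of "{g\<in>G k. f g \<noteq> 0 \<and> grng k g = y}" for y] this[of "{g\<in>G k. f g \<noteq> 0 \<and> gsrc k g = y}" for y]
  show ?thesis by (intro exI[of _ "card \<F>"]) auto
qed

section \<open>The representation on square summable functions of units\<close>

lemma ell2_norm_nonneg: "0 \<le> ell2_norm \<xi>"
  by (simp add: ell2_norm_def infsum_nonneg)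

lemma ell2_sum_le:
  assumes "\<xi> \<in> ell2" "finite F" shows "(\<Sum>i\<in>F. (cmod (\<xi> i))\<^sup>2) \<le> (ell2_norm \<xi>)\<^sup>2"
proof -
  have "(\<Sum>i\<in>F. (cmod (\<xi> i))\<^sup>2) \<le> (\<Sum>\<^sub>\<infinity>i. (cmod (\<xi> i))\<^sup>2)"
    using assms by (intro finite_sum_le_infsum) (auto simp: ell2_def)
  then show ?thesis by (simp add: ell2_norm_def infsum_nonneg)
qed

text \<open>Membership and norm bound come together from finite partial sums, so that later
  estimates only deal with finite sums.\<close>

lemma ell2I:
  assumes "0 \<le> C" "\<And>F. finite F \<Longrightarrow> (\<Sum>i\<in>F. (cmod (\<xi> i))\<^sup>2) \<le> C\<^sup>2"
  shows "\<xi> \<in> ell2" "ell2_norm \<xi> \<le> C"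
proof -
  have s: "(\<lambda>i. (cmod (\<xi> i))\<^sup>2) summable_on UNIV"
    using assms(2) by (intro nonneg_bdd_above_summable_on bdd_aboveI[of _ "C\<^sup>2"]) auto
  then show "\<xi> \<in> ell2" by (simp add: ell2_def)
  have "(\<Sum>\<^sub>\<infinity>i. (cmod (\<xi> i))\<^sup>2) \<le> C\<^sup>2"
    using s assms(2) by (intro infsum_le_finite_sums) auto
  then show "ell2_norm \<xi> \<le> C" using assms(1) by (simp add: ell2_norm_def real_le_lsqrt)
qed

lemma ell2_add:
  assumes "\<xi> \<in> ell2" "\<eta> \<in> ell2"
  shows "ell2_norm (\<lambda>i. \<xi> i + \<eta> i) \<le> ell2_norm \<xi> + ell2_norm \<eta>"
proof (rule ell2I(2))
  show "0 \<le> ell2_norm \<xi> + ell2_norm \<eta>" by (simp add: ell2_norm_nonneg)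
  fix F :: "'a set" assume F: "finite F"
  have L: "L2_set (\<lambda>i. cmod (\<zeta> i)) F \<le> ell2_norm \<zeta>" if "\<zeta> \<in> ell2" for \<zeta> :: "'a \<Rightarrow> complex"
    using ell2_sum_le[OF that F] ell2_norm_nonneg[of \<zeta>] by (simp add: L2_set_def real_le_lsqrt)
  have "L2_set (\<lambda>i. cmod (\<xi> i + \<eta> i)) F \<le> L2_set (\<lambda>i. cmod (\<xi> i) + cmod (\<eta> i)) F"
    by (intro L2_set_mono norm_triangle_ineq) auto
  also have "\<dots> \<le> ell2_norm \<xi> + ell2_norm \<eta>"
    using L2_set_triangle_ineq[of "\<lambda>i. cmod (\<xi> i)" "\<lambda>i. cmod (\<eta> i)" F] L[OF assms(1)] L[OF assms(2)]
    by linarith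
  finally have "(L2_set (\<lambda>i. cmod (\<xi> i + \<eta> i)) F)\<^sup>2 \<le> (ell2_norm \<xi> + ell2_norm \<eta>)\<^sup>2"
    by (intro power_mono) auto
  then show "(\<Sum>i\<in>F. (cmod (\<xi> i + \<eta> i))\<^sup>2) \<le> (ell2_norm \<xi> + ell2_norm \<eta>)\<^sup>2"
    by (simp add: L2_set_def sum_nonneg)
qed

lemma ell2_norm_scale: "ell2_norm (\<lambda>i. c * \<xi> i) = cmod c * ell2_norm \<xi>"
  by (simp add: ell2_norm_def norm_mult power_mult_distrib infsum_cmult_right' real_sqrt_mult)

lemma ell2_coordinate_le:
  assumes "\<xi> \<in> ell2" shows "cmod (\<xi> i) \<le> ell2_norm \<xi>"
proof -
  have "(cmod (\<xi> i))\<^sup>2 \<le> (ell2_norm \<xi>)\<^sup>2" using ell2_sum_le[OF assms, of "{i}"] by simp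
  then show ?thesis by (rule power2_le_imp_le) (rule ell2_norm_nonneg)
qed

lemma ell2_point: "(\<lambda>j. if j = i then 1 else 0) \<in> ell2" "ell2_norm (\<lambda>j. if j = i then 1 else 0) \<le> 1"
proof -
  have "(\<Sum>j\<in>F. (cmod (if j = i then 1 else 0))\<^sup>2) \<le> 1\<^sup>2" if "finite F" for F :: "'a set"
  proof -
    have "(\<Sum>j\<in>F. (cmod (if j = i then 1 else 0))\<^sup>2) = (\<Sum>j\<in>F. if j = i then 1 else 0)"
      by (intro sum.cong) auto
    then show ?thesis using that by simp
  qed
  from ell2I[OF _ this] show "(\<lambda>j. if j = i then 1 else 0) \<in> ell2" "ell2_norm (\<lambda>j. if j = i then 1 else 0) \<le> 1"
    by auto
qed

text \<open>Collects the facts about the groupoid on which the representation depends.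
  \<open>R\<close> and \<open>S\<close> take values in the index type of the Hilbert space, which
  absorbs the encoding of units as functions.\<close>

locale involutive_graph =
  fixes A :: "'g set" and R S :: "'g \<Rightarrow> 'i" and inv :: "'g \<Rightarrow> 'g" and mult :: "'g \<Rightarrow> 'g \<Rightarrow> 'g"
  assumes inv_in: "g \<in> A \<Longrightarrow> inv g \<in> A"
    and inv_inv: "g \<in> A \<Longrightarrow> inv (inv g) = g"
    and S_inv: "g \<in> A \<Longrightarrow> S (inv g) = R g"
    and mult_in: "a \<in> A \<Longrightarrow> b \<in> A \<Longrightarrow> S a = R b \<Longrightarrow> mult a b \<in> A"
    and R_mult: "a \<in> A \<Longrightarrow> b \<in> A \<Longrightarrow> S a = R b \<Longrightarrow> R (mult a b) = R a"
    and S_mult: "a \<in> A \<Longrightarrow> b \<in> A \<Longrightarrow> S a = R b \<Longrightarrow> S (mult a b) = S b"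
begin

lemma R_inv: "g \<in> A \<Longrightarrow> R (inv g) = S g"
  using S_inv inv_in inv_inv by metis

definition op :: "('g \<Rightarrow> complex) \<Rightarrow> ('i \<Rightarrow> complex) \<Rightarrow> 'i \<Rightarrow> complex" where
  "op f \<xi> i = (\<Sum>\<^sub>\<infinity>g\<in>{g\<in>A. R g = i}. f g * \<xi> (S g))"

definition fib :: "('g \<Rightarrow> complex) \<Rightarrow> 'i \<Rightarrow> 'g set" where
  "fib f i = {g\<in>A. f g \<noteq> 0 \<and> R g = i}"

text \<open>A Schur type condition: values bounded by \<open>B\<close>, and at most \<open>N\<close>
  nonzero ones over each range and each source. It also makes the sums in \<open>op\<close> finite.
  For a function in \<open>Cc k\<close>, a suitable \<open>N\<close> is the number of bisections
  covering its support.\<close>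

definition bounded_kernel :: "real \<Rightarrow> nat \<Rightarrow> ('g \<Rightarrow> complex) \<Rightarrow> bool" where
  "bounded_kernel B N f \<longleftrightarrow> (\<forall>g. cmod (f g) \<le> B) \<and> (\<forall>i. finite (fib f i) \<and> card (fib f i) \<le> N) \<and>
    (\<forall>i. finite {g\<in>A. f g \<noteq> 0 \<and> S g = i} \<and> card {g\<in>A. f g \<noteq> 0 \<and> S g = i} \<le> N)"

lemma op_eq_sum:
  assumes "finite T" "fib f i \<subseteq> T" "T \<subseteq> {g\<in>A. R g = i}"
  shows "op f \<xi> i = (\<Sum>g\<in>T. f g * \<xi> (S g))"
proof -
  have "op f \<xi> i = (\<Sum>\<^sub>\<infinity>g\<in>T. f g * \<xi> (S g))"
    unfolding op_def using assms by (intro infsum_cong_neutral) (auto simp: fib_def)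
  then show ?thesis using assms(1) by simp
qed

lemma op_fib: "finite (fib f i) \<Longrightarrow> op f \<xi> i = (\<Sum>g\<in>fib f i. f g * \<xi> (S g))"
  by (rule op_eq_sum) (auto simp: fib_def)

lemma op_add_left:
  assumes "finite (fib f i)" "finite (fib h i)"
  shows "op (\<lambda>g. f g + h g) \<xi> i = op f \<xi> i + op h \<xi> i"
proof -
  let ?T = "fib f i \<union> fib h i"
  have T: "finite ?T" "?T \<subseteq> {g\<in>A. R g = i}" "fib f i \<subseteq> ?T" "fib h i \<subseteq> ?T"
    "fib (\<lambda>g. f g + h g) i \<subseteq> ?T" using assms by (auto simp: fib_def)
  show ?thesis
    using op_eq_sum[OF T(1,3,2)] op_eq_sum[OF T(1,4,2)] op_eq_sum[OF T(1,5,2)]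
    by (simp add: sum.distrib algebra_simps)
qed

lemma op_scale_left: "op (\<lambda>g. c * f g) \<xi> i = c * op f \<xi> i"
  by (simp add: op_def mult.assoc infsum_cmult_right')

lemma op_add_right:
  "finite (fib f i) \<Longrightarrow> op f (\<lambda>i. \<xi> i + \<eta> i) i = op f \<xi> i + op f \<eta> i"
  by (simp add: op_fib sum.distrib algebra_simps)

lemma op_scale_right: "op f (\<lambda>i. c * \<xi> i) i = c * op f \<xi> i"
  unfolding op_def infsum_cmult_right'[symmetric] by (intro infsum_cong) simp

lemma sum_over_fibres_le:
  fixes q :: "'g \<Rightarrow> 'i"
  assumes \<xi>: "\<xi> \<in> ell2" and T: "finite T" and q: "\<And>j. card {g\<in>T. q g = j} \<le> N"
  shows "(\<Sum>g\<in>T. (cmod (\<xi> (q g)))\<^sup>2) \<le> real N * (ell2_norm \<xi>)\<^sup>2"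
proof -
  have "(\<Sum>g\<in>T. (cmod (\<xi> (q g)))\<^sup>2) = (\<Sum>j\<in>q ` T. \<Sum>g\<in>{g\<in>T. q g = j}. (cmod (\<xi> (q g)))\<^sup>2)"
    using T by (rule sum.image_gen)
  also have "\<dots> = (\<Sum>j\<in>q ` T. real (card {g\<in>T. q g = j}) * (cmod (\<xi> j))\<^sup>2)"
    by (intro sum.cong) simp_all
  also have "\<dots> \<le> (\<Sum>j\<in>q ` T. real N * (cmod (\<xi> j))\<^sup>2)"
    using q by (intro sum_mono mult_right_mono) auto
  also have "\<dots> \<le> real N * (ell2_norm \<xi>)\<^sup>2"
    unfolding sum_distrib_left[symmetric] using T ell2_sum_le[OF \<xi>] by (intro mult_left_mono) auto
  finally show ?thesis .
qed

text \<open>Cauchy-Schwarz for the at most \<open>N\<close> terms over one range gives a factor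
  \<open>N\<close>. After summation over ranges each coordinate of \<open>\<xi>\<close> is met at
  most \<open>N\<close> times, which gives the second one; the square root of N^2 B^2 is the
  constant.\<close>

lemma
  assumes f: "bounded_kernel B N f" and \<xi>: "\<xi> \<in> ell2"
  shows op_in_ell2: "op f \<xi> \<in> ell2" and op_bounded: "ell2_norm (op f \<xi>) \<le> real N * B * ell2_norm \<xi>"
proof -
  have B: "cmod (f g) \<le> B" for g using f by (simp add: bounded_kernel_def)
  have B0: "0 \<le> B" using B[of undefined] norm_ge_zero order_trans by blast
  have fin: "finite (fib f i)" "card (fib f i) \<le> N"
    "finite {g\<in>A. f g \<noteq> 0 \<and> S g = i}" "card {g\<in>A. f g \<noteq> 0 \<and> S g = i} \<le> N" for i
    using f by (simp_all add: bounded_kernel_def)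
  have "(\<Sum>i\<in>F. (cmod (op f \<xi> i))\<^sup>2) \<le> (real N * B * ell2_norm \<xi>)\<^sup>2" if F: "finite F" for F
  proof -
    have "(cmod (op f \<xi> i))\<^sup>2 \<le> real N * B\<^sup>2 * (\<Sum>g\<in>fib f i. (cmod (\<xi> (S g)))\<^sup>2)" for i
    proof -
      have "(cmod (op f \<xi> i))\<^sup>2 \<le> (\<Sum>g\<in>fib f i. cmod (f g * \<xi> (S g)))\<^sup>2"
        unfolding op_fib[OF fin(1)] by (intro power_mono norm_sum) simp
      also have "\<dots> \<le> (\<Sum>g\<in>fib f i. (cmod (f g * \<xi> (S g)))\<^sup>2) * real (card (fib f i))"
        by (rule sum_squared_le_sum_of_squares)
      also have "\<dots> \<le> (\<Sum>g\<in>fib f i. B\<^sup>2 * (cmod (\<xi> (S g)))\<^sup>2) * real N"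
        using fin(2) B by (intro mult_mono sum_mono)
          (auto simp: norm_mult power_mult_distrib intro!: mult_right_mono power_mono sum_nonneg)
      finally show ?thesis by (simp add: sum_distrib_left mult_ac)
    qed
    then have "(\<Sum>i\<in>F. (cmod (op f \<xi> i))\<^sup>2) \<le> 
        (\<Sum>i\<in>F. real N * B\<^sup>2 * (\<Sum>g\<in>fib f i. (cmod (\<xi> (S g)))\<^sup>2))" by (rule sum_mono)
    also have "\<dots> = real N * B\<^sup>2 * (\<Sum>g\<in>(\<Union>i\<in>F. fib f i). (cmod (\<xi> (S g)))\<^sup>2)"
      using F fin(1) by (subst sum.UNION_disjoint) (auto simp: sum_distrib_left fib_def)
    also have "\<dots> \<le> real N * B\<^sup>2 * (real N * (ell2_norm \<xi>)\<^sup>2)"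
    proof (intro mult_left_mono sum_over_fibres_le[OF \<xi>])
      show "finite (\<Union>i\<in>F. fib f i)" using F fin(1) by blast
      fix j
      have "{g \<in> \<Union>i\<in>F. fib f i. S g = j} \<subseteq> {g\<in>A. f g \<noteq> 0 \<and> S g = j}" by (auto simp: fib_def)
      then show "card {g \<in> \<Union>i\<in>F. fib f i. S g = j} \<le> N"
        by (rule le_trans[OF card_mono[OF fin(3)] fin(4)])
    qed simp
    finally show ?thesis by (simp add: power_mult_distrib power2_eq_square mult_ac)
  qed
  from ell2I[OF _ this] show "op f \<xi> \<in> ell2" "ell2_norm (op f \<xi>) \<le> real N * B * ell2_norm \<xi>"
    using B0 ell2_norm_nonneg[of \<xi>] by auto
qed

lemma op_bounded_op:
  assumes "bounded_kernel B N f" shows "ell2_bounded_op (op f)"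
proof -
  have "finite (fib f i)" for i using assms by (simp add: bounded_kernel_def)
  then show ?thesis
    unfolding ell2_bounded_op_def using op_in_ell2[OF assms] op_bounded[OF assms]
    by (auto simp: op_add_right op_scale_right fun_eq_iff)
qed

text \<open>Both sides are sums over the finite set \<open>T\<close> of composable pairs (a, b) with
  range \<open>i\<close> and nonzero f(a), h(b): grouped by the product ab they give the operator of
  the convolution, grouped by a the composition.\<close>

lemma op_mult:
  assumes f: "\<And>i. finite (fib f i)" and h: "\<And>i. finite (fib h i)"
  defines "c \<equiv> \<lambda>g. \<Sum>\<^sub>\<infinity>(a, b)\<in>{(a, b). a \<in> A \<and> b \<in> A \<and> S a = R b \<and> mult a b = g}. f a * h b"
  shows "op c \<xi> i = op f (op h \<xi>) i"
proof -
  define T where "T = (SIGMA a:fib f i. fib h (S a))"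
  define m where "m = (\<lambda>(a, b). mult a b)"
  have T: "finite T" using f h by (auto simp: T_def)
  have inT: "a \<in> A \<and> b \<in> A \<and> S a = R b \<and> R a = i" if "(a, b) \<in> T" for a b
    using that by (auto simp: T_def fib_def)
  have m: "m p \<in> A" "R (m p) = i" "S (m p) = S (snd p)" if "p \<in> T" for p
    using inT[of "fst p" "snd p"] that mult_in R_mult S_mult by (auto simp: m_def split: prod.splits)
  have c: "c g = (\<Sum>p\<in>{p\<in>T. m p = g}. f (fst p) * h (snd p))" if "g \<in> A" "R g = i" for g
  proof -
    have "c g = (\<Sum>\<^sub>\<infinity>p\<in>{p\<in>T. m p = g}. f (fst p) * h (snd p))"
      unfolding c_def
    proof (rule infsum_cong_neutral)
      fix p assume p: "p \<in> {(a, b). a \<in> A \<and> b \<in> A \<and> S a = R b \<and> mult a b = g} - {p\<in>T. m p = g}"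
      obtain a b where ab: "p = (a, b)" by (rule prod.exhaust)
      have "R a = i" using p R_mult[of a b] that(2) unfolding ab by simp
      with p have "f a = 0 \<or> h b = 0" unfolding ab T_def fib_def m_def by auto
      then show "(case p of (a, b) \<Rightarrow> f a * h b) = 0" unfolding ab by auto
    next
      fix p assume p: "p \<in> {p\<in>T. m p = g} - {(a, b). a \<in> A \<and> b \<in> A \<and> S a = R b \<and> mult a b = g}"
      obtain a b where ab: "p = (a, b)" by (rule prod.exhaust)
      show "f (fst p) * h (snd p) = 0" using p inT[of a b] unfolding ab m_def by simp
    qed auto
    then show ?thesis using T by simp
  qed
  have "op c \<xi> i = (\<Sum>\<^sub>\<infinity>g\<in>m ` T. c g * \<xi> (S g))"
    unfolding op_def
  proof (rule infsum_cong_neutral)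
    fix g assume g: "g \<in> {g\<in>A. R g = i} - m ` T"
    then have "{p\<in>T. m p = g} = {}" by blast
    then show "c g * \<xi> (S g) = 0" using c[of g] g by (simp only:) simp
  qed (use m in auto)
  also have "\<dots> = (\<Sum>g\<in>m ` T. \<Sum>p\<in>{p\<in>T. m p = g}. f (fst p) * h (snd p) * \<xi> (S (snd p)))"
  proof -
    have "c g * \<xi> (S g) = (\<Sum>p\<in>{p\<in>T. m p = g}. f (fst p) * h (snd p) * \<xi> (S (snd p)))"
      if g: "g \<in> m ` T" for g
    proof -
      have "g \<in> A" "R g = i" using g m by auto
      moreover have "S (snd p) = S g" if "p \<in> T" "m p = g" for p using m(3) that by metis
      ultimately show ?thesis by (simp add: c sum_distrib_right)
    qed
    then show ?thesis using T by simp
  qed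
  also have "\<dots> = (\<Sum>p\<in>T. f (fst p) * h (snd p) * \<xi> (S (snd p)))"
    by (rule sum.image_gen[OF T, symmetric])
  also have "\<dots> = (\<Sum>a\<in>fib f i. \<Sum>b\<in>fib h (S a). f a * h b * \<xi> (S b))"
    unfolding T_def using f h by (subst sum.Sigma) (auto simp: case_prod_beta)
  also have "\<dots> = op f (op h \<xi>) i"
    by (simp add: op_fib[OF f] op_fib[OF h] sum_distrib_left mult.assoc)
  finally show ?thesis .
qed

lemma infsum_fibres:
  fixes p :: "'g \<Rightarrow> complex"
  assumes "p summable_on A"
  shows "(\<Sum>\<^sub>\<infinity>i. \<Sum>\<^sub>\<infinity>g\<in>{g\<in>A. R g = i}. p g) = infsum p A"
proof -
  have i: "inj_on (\<lambda>g. (R g, g)) A" by (auto simp: inj_on_def)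
  have e: "(SIGMA i:UNIV. {g\<in>A. R g = i}) = (\<lambda>g. (R g, g)) ` A" by auto
  have "(\<lambda>(i, g). p g) summable_on (SIGMA i:UNIV. {g\<in>A. R g = i})"
    unfolding e using assms by (subst summable_on_reindex[OF i]) (simp add: o_def)
  then have "(\<Sum>\<^sub>\<infinity>i. \<Sum>\<^sub>\<infinity>g\<in>{g\<in>A. R g = i}. p g) =
      (\<Sum>\<^sub>\<infinity>(i, g)\<in>(SIGMA i:UNIV. {g\<in>A. R g = i}). p g)"
    by (rule infsum_Sigma'_banach)
  also have "\<dots> = infsum p A"
    unfolding e by (subst infsum_reindex[OF i]) (simp add: o_def)
  finally show ?thesis .
qed

text \<open>Both inner products are the sum of \<open>p\<close> over all of \<open>A\<close>, one
  grouped by ranges, the other after substituting inverses. Absolute summability, which permits the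
  regrouping, follows from xy \<le> x^2 + y^2 and the bound \<open>N\<close> on the number of times
  each coordinate occurs.\<close>

lemma op_adjoint:
  assumes f: "bounded_kernel B N f" and \<xi>: "\<xi> \<in> ell2" and \<eta>: "\<eta> \<in> ell2"
  shows "ell2_inner (op (\<lambda>g. cnj (f (inv g))) \<xi>) \<eta> = ell2_inner \<xi> (op f \<eta>)"
proof -
  have B: "cmod (f g) \<le> B" for g using f by (simp add: bounded_kernel_def)
  have B0: "0 \<le> B" using B[of undefined] norm_ge_zero order_trans by blast
  have fin: "finite (fib f i)" "card (fib f i) \<le> N"
    "finite {g\<in>A. f g \<noteq> 0 \<and> S g = i}" "card {g\<in>A. f g \<noteq> 0 \<and> S g = i} \<le> N" for i
    using f by (simp_all add: bounded_kernel_def)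
  define p where "p g = \<xi> (R g) * cnj (f g * \<eta> (S g))" for g
  have "(\<Sum>g\<in>F. cmod (p g)) \<le> B * (real N * (ell2_norm \<xi>)\<^sup>2 + real N * (ell2_norm \<eta>)\<^sup>2)"
    if F: "finite F" "F \<subseteq> A" for F
  proof -
    let ?T = "{g\<in>F. f g \<noteq> 0}"
    have T: "finite ?T" using F by simp
    have c: "card {g\<in>?T. R g = j} \<le> N" "card {g\<in>?T. S g = j} \<le> N" for j
    proof -
      have "{g\<in>?T. R g = j} \<subseteq> fib f j" "{g\<in>?T. S g = j} \<subseteq> {g\<in>A. f g \<noteq> 0 \<and> S g = j}"
        using F by (auto simp: fib_def)
      then show "card {g\<in>?T. R g = j} \<le> N" "card {g\<in>?T. S g = j} \<le> N"
        using le_trans[OF card_mono[OF fin(1)] fin(2)] le_trans[OF card_mono[OF fin(3)] fin(4)] by simp_all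
    qed
    have le: "cmod (p g) \<le> B * ((cmod (\<xi> (R g)))\<^sup>2 + (cmod (\<eta> (S g)))\<^sup>2)" for g
    proof -
      have *: "x * y \<le> x\<^sup>2 + y\<^sup>2" for x y :: real
        using sum_squares_bound[of x y] zero_le_power2[of x] zero_le_power2[of y] by linarith
      have "cmod (p g) = cmod (f g) * (cmod (\<xi> (R g)) * cmod (\<eta> (S g)))"
        by (simp add: p_def norm_mult)
      also have "\<dots> \<le> B * ((cmod (\<xi> (R g)))\<^sup>2 + (cmod (\<eta> (S g)))\<^sup>2)"
        using B B0 * by (intro mult_mono) auto
      finally show ?thesis .
    qed
    have "(\<Sum>g\<in>F. cmod (p g)) = (\<Sum>g\<in>?T. cmod (p g))"
      using F by (intro sum.mono_neutral_right) (auto simp: p_def)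
    also have "\<dots> \<le> (\<Sum>g\<in>?T. B * ((cmod (\<xi> (R g)))\<^sup>2 + (cmod (\<eta> (S g)))\<^sup>2))"
      using le by (rule sum_mono)
    also have "\<dots> = B * ((\<Sum>g\<in>?T. (cmod (\<xi> (R g)))\<^sup>2) + (\<Sum>g\<in>?T. (cmod (\<eta> (S g)))\<^sup>2))"
      by (simp only: sum_distrib_left[symmetric] sum.distrib)
    also have "\<dots> \<le> B * (real N * (ell2_norm \<xi>)\<^sup>2 + real N * (ell2_norm \<eta>)\<^sup>2)"
      using sum_over_fibres_le[OF \<xi> T c(1)] sum_over_fibres_le[OF \<eta> T c(2)] B0
      by (intro mult_left_mono add_mono)
    finally show ?thesis .
  qed
  then have "(\<lambda>g. cmod (p g)) summable_on A"
    by (intro nonneg_bdd_above_summable_on bdd_aboveI) auto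
  then have s: "p summable_on A" by (rule abs_summable_summable)
  have bij: "bij_betw inv A A"
    by (rule bij_betw_byWitness[of _ inv]) (use inv_in inv_inv in auto)
  have s': "(\<lambda>g. p (inv g)) summable_on A"
    using s summable_on_reindex_bij_betw[OF bij, of p] by simp
  have "ell2_inner \<xi> (op f \<eta>) = (\<Sum>\<^sub>\<infinity>i. \<Sum>\<^sub>\<infinity>g\<in>{g\<in>A. R g = i}. p g)"
    unfolding ell2_inner_def
  proof (rule infsum_cong)
    fix i
    have "(\<Sum>\<^sub>\<infinity>g\<in>{g\<in>A. R g = i}. p g) = (\<Sum>\<^sub>\<infinity>g\<in>fib f i. p g)"
      by (intro infsum_cong_neutral) (auto simp: fib_def p_def)
    also have "\<dots> = (\<Sum>g\<in>fib f i. \<xi> i * cnj (f g * \<eta> (S g)))"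
      using fin(1) by (simp add: p_def fib_def)
    also have "\<dots> = \<xi> i * cnj (op f \<eta> i)"
      by (simp add: op_fib[OF fin(1)] sum_distrib_left)
    finally show "\<xi> i * cnj (op f \<eta> i) = (\<Sum>\<^sub>\<infinity>g\<in>{g\<in>A. R g = i}. p g)" by simp
  qed
  also have "\<dots> = infsum p A" using s by (rule infsum_fibres)
  also have "\<dots> = (\<Sum>\<^sub>\<infinity>g\<in>A. p (inv g))" using infsum_reindex_bij_betw[OF bij, of p] by simp
  also have "\<dots> = (\<Sum>\<^sub>\<infinity>i. \<Sum>\<^sub>\<infinity>g\<in>{g\<in>A. R g = i}. p (inv g))" using infsum_fibres[OF s'] by simp
  also have "\<dots> = ell2_inner (op (\<lambda>g. cnj (f (inv g))) \<xi>) \<eta>"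
    unfolding ell2_inner_def op_def infsum_cmult_left'[symmetric]
    by (intro infsum_cong) (auto simp: p_def R_inv S_inv)
  finally show ?thesis by simp
qed

end

text \<open>The Hilbert space of \<open>star_rep\<close> is indexed by functions on the groupoid, so points are encoded as such.\<close>

definition point :: "mor set \<Rightarrow> gfun" where
  "point y = indicator {{(vertex 1, vertex 1, y)}}"

lemma inj_point: "point y = point z \<longleftrightarrow> y = z"
proof
  assume "point y = point z"
  then have "point y {(vertex 1, vertex 1, y)} = point z {(vertex 1, vertex 1, y)}" by simp
  then show "y = z" by (simp add: point_def indicator_def split: if_splits)
qed simp

interpretation gpd: involutive_graph "G k" "\<lambda>g. point (grng k g)" "\<lambda>g. point (gsrc k g)" ginv "gmult k" for k
  by unfold_locales (simp_all add: ginv_props gmult_props inj_point)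

lemma bounded_kernel_Cc:
  assumes "f \<in> Cc k" shows "\<exists>B N. gpd.bounded_kernel k B N f"
proof -
  obtain B where B: "\<And>g. cmod (f g) \<le> B" using Cc_bounded[OF assms] by blast
  obtain N :: nat where N:
    "\<And>y. finite {g\<in>G k. f g \<noteq> 0 \<and> grng k g = y} \<and> card {g\<in>G k. f g \<noteq> 0 \<and> grng k g = y} \<le> N"
    "\<And>y. finite {g\<in>G k. f g \<noteq> 0 \<and> gsrc k g = y} \<and> card {g\<in>G k. f g \<noteq> 0 \<and> gsrc k g = y} \<le> N"
    using Cc_fibres[OF assms] by meson
  \<comment> \<open>Most indices of the Hilbert space encode no unit; their fibres are empty. All
    other fibres are those over a single unit.\<close>
  have e: "{g\<in>G k. f g \<noteq> 0 \<and> point (q g) = i} = {} \<or>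
      (\<exists>y. {g\<in>G k. f g \<noteq> 0 \<and> point (q g) = i} = {g\<in>G k. f g \<noteq> 0 \<and> q g = y})" for q i
  proof (cases "\<exists>y. i = point y")
    case True then show ?thesis by (auto simp: inj_point)
  qed blast
  have "gpd.bounded_kernel k B N f"
    unfolding gpd.bounded_kernel_def gpd.fib_def
  proof (intro conjI allI B)
    fix i
    show "finite {g\<in>G k. f g \<noteq> 0 \<and> point (grng k g) = i}" "card {g\<in>G k. f g \<noteq> 0 \<and> point (grng k g) = i} \<le> N"
      using e[of "grng k" i] N(1) by (elim disjE exE; simp only: finite.emptyI card.empty le0)+
    show "finite {g\<in>G k. f g \<noteq> 0 \<and> point (gsrc k g) = i}" "card {g\<in>G k. f g \<noteq> 0 \<and> point (gsrc k g) = i} \<le> N"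
      using e[of "gsrc k" i] N(2) by (elim disjE exE; simp only: finite.emptyI card.empty le0)+
  qed
  then show ?thesis by blast
qed

text \<open>The representation is degenerate, since coordinates that encode no unit are annihilated;
  \<open>star_rep\<close> admits this.\<close>

lemma star_rep_op: "star_rep k (gpd.op k)"
proof -
  have fin: "finite (gpd.fib k f i)" if "f \<in> Cc k" for f i
    using bounded_kernel_Cc[OF that] by (auto simp: gpd.bounded_kernel_def)
  have "gpd.op k (conv k f h) \<xi> = gpd.op k f (gpd.op k h \<xi>)" if "f \<in> Cc k" "h \<in> Cc k" for f h \<xi>
    using gpd.op_mult[of k f h \<xi>, OF fin[OF that(1)] fin[OF that(2)]]
    by (intro ext) (simp add: conv_def inj_point)
  moreover have "ell2_inner (gpd.op k (invol f) \<xi>) \<eta> = ell2_inner \<xi> (gpd.op k f \<eta>)"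
    if "f \<in> Cc k" "\<xi> \<in> ell2" "\<eta> \<in> ell2" for f \<xi> \<eta>
    using bounded_kernel_Cc[OF that(1)] gpd.op_adjoint that(2,3) unfolding invol_def by blast
  moreover have "ell2_bounded_op (gpd.op k f)" if "f \<in> Cc k" for f
    using bounded_kernel_Cc[OF that] gpd.op_bounded_op by blast
  ultimately show ?thesis
    unfolding star_rep_def by (auto simp: gpd.op_add_left fin gpd.op_scale_left fun_eq_iff)
qed

section \<open>Distances in the completion and the proper inclusion\<close>

lemma full_norm_ge:
  fixes \<pi> :: "gfun \<Rightarrow> (gfun \<Rightarrow> complex) \<Rightarrow> gfun \<Rightarrow> complex"
  assumes "star_rep k \<pi>" "\<xi> \<in> ell2" "ell2_norm \<xi> \<le> 1"
  shows "ennreal (ell2_norm (\<pi> f \<xi>)) \<le> full_norm k f"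
  unfolding full_norm_def using assms
  by (intro SUP_upper2[of \<pi>] SUP_upper2[of \<xi>]) auto

definition rep_bound :: "(gfun \<Rightarrow> (gfun \<Rightarrow> complex) \<Rightarrow> gfun \<Rightarrow> complex) \<Rightarrow> gfun \<Rightarrow> ennreal \<Rightarrow> bool" where
  "rep_bound \<pi> f C \<longleftrightarrow> (\<forall>\<xi>\<in>ell2. ell2_norm \<xi> \<le> 1 \<longrightarrow> ennreal (ell2_norm (\<pi> f \<xi>)) \<le> C)"

lemma full_norm_leI:
  assumes "\<And>\<pi>. star_rep k \<pi> \<Longrightarrow> rep_bound \<pi> f C"
  shows "full_norm k f \<le> C"
  unfolding full_norm_def
proof (rule SUP_least)
  fix \<pi> :: "gfun \<Rightarrow> (gfun \<Rightarrow> complex) \<Rightarrow> gfun \<Rightarrow> complex"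
  assume "\<pi> \<in> {\<pi>. star_rep k \<pi>}"
  then have "rep_bound \<pi> f C" using assms by blast
  then show "(SUP \<xi>\<in>{\<xi>\<in>ell2. ell2_norm \<xi> \<le> 1}. ennreal (ell2_norm (\<pi> f \<xi>))) \<le> C"
    unfolding rep_bound_def by (intro SUP_least) simp
qed

lemma star_repD:
  assumes "star_rep k \<pi>" "f \<in> Cc k" "\<xi> \<in> ell2"
  shows "\<pi> f \<xi> \<in> ell2" "\<pi> (\<lambda>g. c * f g) \<xi> = (\<lambda>i. c * \<pi> f \<xi> i)"
    "h \<in> Cc k \<Longrightarrow> \<pi> (\<lambda>g. f g + h g) \<xi> = (\<lambda>i. \<pi> f \<xi> i + \<pi> h \<xi> i)"
  using assms by (simp_all add: star_rep_def ell2_bounded_op_def)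

lemma full_dist_self: "full_dist k f f = 0"
proof -
  have "full_norm k (\<lambda>g. f g - f g) \<le> 0"
  proof (rule full_norm_leI)
    fix \<pi> :: "gfun \<Rightarrow> (gfun \<Rightarrow> complex) \<Rightarrow> gfun \<Rightarrow> complex"
    assume "star_rep k \<pi>"
    \<comment> \<open>That 0 is represented by 0 is no clause of \<open>star_rep\<close>; it follows
      from homogeneity with the scalar 0.\<close>
    then have "\<pi> (\<lambda>g. f g - f g) \<xi> = (\<lambda>i. 0)" if "\<xi> \<in> ell2" for \<xi>
      using star_repD(2)[OF _ Cc_zero that, of k \<pi> 0] by simp
    then show "rep_bound \<pi> (\<lambda>g. f g - f g) 0" by (simp add: rep_bound_def ell2_norm_def)
  qed
  then show ?thesis by (simp add: full_dist_def)
qed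

lemma full_dist_triangle:
  assumes "f \<in> Cc k" "g \<in> Cc k" "h \<in> Cc k"
  shows "full_dist k f h \<le> full_dist k f g + full_dist k g h"
  unfolding full_dist_def
proof (rule full_norm_leI)
  fix \<pi> :: "gfun \<Rightarrow> (gfun \<Rightarrow> complex) \<Rightarrow> gfun \<Rightarrow> complex"
  assume "star_rep k \<pi>"
  show "rep_bound \<pi> (\<lambda>x. f x - h x) (full_norm k (\<lambda>x. f x - g x) + full_norm k (\<lambda>x. g x - h x))"
    unfolding rep_bound_def
  proof (intro ballI impI)
    fix \<xi> :: "gfun \<Rightarrow> complex" assume "\<xi> \<in> ell2" "ell2_norm \<xi> \<le> 1"
    note p = \<open>star_rep k \<pi>\<close> this
    note d = Cc_diff[OF assms(1,2)] Cc_diff[OF assms(2,3)]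
    have "\<pi> (\<lambda>x. f x - h x) \<xi> = (\<lambda>i. \<pi> (\<lambda>x. f x - g x) \<xi> i + \<pi> (\<lambda>x. g x - h x) \<xi> i)"
      using star_repD(3)[OF p(1) d(1) p(2) d(2)] by simp
    then have "ell2_norm (\<pi> (\<lambda>x. f x - h x) \<xi>) \<le>
        ell2_norm (\<pi> (\<lambda>x. f x - g x) \<xi>) + ell2_norm (\<pi> (\<lambda>x. g x - h x) \<xi>)"
      using ell2_add[OF star_repD(1)[OF p(1) d(1) p(2)] star_repD(1)[OF p(1) d(2) p(2)]] by simp
    then have "ennreal (ell2_norm (\<pi> (\<lambda>x. f x - h x) \<xi>)) \<le>
        ennreal (ell2_norm (\<pi> (\<lambda>x. f x - g x) \<xi>)) + ennreal (ell2_norm (\<pi> (\<lambda>x. g x - h x) \<xi>))"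
      by (simp add: ell2_norm_nonneg flip: ennreal_plus)
    also have "\<dots> \<le> full_norm k (\<lambda>x. f x - g x) + full_norm k (\<lambda>x. g x - h x)"
      using full_norm_ge[OF p] by (intro add_mono)
    finally show "ennreal (ell2_norm (\<pi> (\<lambda>x. f x - h x) \<xi>)) \<le>
      full_norm k (\<lambda>x. f x - g x) + full_norm k (\<lambda>x. g x - h x)" .
  qed
qed

lemma full_dist_commute:
  assumes "f \<in> Cc k" "h \<in> Cc k" shows "full_dist k f h = full_dist k h f"
proof -
  have "full_dist k f h \<le> full_dist k h f" if "f \<in> Cc k" "h \<in> Cc k" for f h
    unfolding full_dist_def
  proof (rule full_norm_leI)
    fix \<pi> :: "gfun \<Rightarrow> (gfun \<Rightarrow> complex) \<Rightarrow> gfun \<Rightarrow> complex"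
    assume "star_rep k \<pi>"
    show "rep_bound \<pi> (\<lambda>g. f g - h g) (full_norm k (\<lambda>g. h g - f g))"
      unfolding rep_bound_def
    proof (intro ballI impI)
      fix \<xi> :: "gfun \<Rightarrow> complex" assume "\<xi> \<in> ell2" "ell2_norm \<xi> \<le> 1"
      note p = \<open>star_rep k \<pi>\<close> this
      have "\<pi> (\<lambda>g. f g - h g) \<xi> = (\<lambda>i. - 1 * \<pi> (\<lambda>g. h g - f g) \<xi> i)"
        using star_repD(2)[OF p(1) Cc_diff[OF that(2,1)] p(2), of "- 1"] by simp
      then have "ell2_norm (\<pi> (\<lambda>g. f g - h g) \<xi>) = ell2_norm (\<pi> (\<lambda>g. h g - f g) \<xi>)"
        using ell2_norm_scale[of "- 1"] by simp
      then show "ennreal (ell2_norm (\<pi> (\<lambda>g. f g - h g) \<xi>)) \<le> full_norm k (\<lambda>g. h g - f g)"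
        using full_norm_ge[OF p] by simp
    qed
  qed
  then show ?thesis using assms by (meson antisym)
qed

lemma incl_iff:
  assumes "f \<in> Cc k"
  shows "F \<in> incl k f \<longleftrightarrow> F \<in> cauchy_seqs k \<and> (\<lambda>n. full_dist k f (F n)) \<longlonglongrightarrow> 0"
  using assms by (auto simp: incl_def null_rel_def cauchy_seqs_def full_dist_self)

lemma const_in_incl: "f \<in> Cc k \<Longrightarrow> (\<lambda>_. f) \<in> incl k f"
  by (auto simp: incl_iff cauchy_seqs_def full_dist_self)

lemma incl_in_Cstar: "f \<in> Cc k \<Longrightarrow> incl k f \<in> Cstar k"
  unfolding incl_def Cstar_def by (rule quotientI) (simp add: cauchy_seqs_def full_dist_self)

text \<open>\<open>Cstar_dist\<close> is a definite description, so every choice of representing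
  sequences must have the same limit. Two triangle inequalities squeeze it; they are arranged with
  sums only, because distances live in the extended reals.\<close>

lemma Cstar_dist_incl:
  assumes f: "f \<in> Cc k" and h: "h \<in> Cc k"
  shows "Cstar_dist k (incl k f) (incl k h) = full_dist k f h"
  unfolding Cstar_dist_def
proof (rule the_equality)
  show "\<exists>F\<in>incl k f. \<exists>H\<in>incl k h. (\<lambda>n. full_dist k (F n) (H n)) \<longlonglongrightarrow> full_dist k f h"
    using const_in_incl[OF f] const_in_incl[OF h] by (intro bexI) auto
next
  fix d assume "\<exists>F\<in>incl k f. \<exists>H\<in>incl k h. (\<lambda>n. full_dist k (F n) (H n)) \<longlonglongrightarrow> d"
  then obtain F H where F: "F \<in> incl k f" and H: "H \<in> incl k h"
    and d: "(\<lambda>n. full_dist k (F n) (H n)) \<longlonglongrightarrow> d" by blast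
  have Fn: "F n \<in> Cc k" and Hn: "H n \<in> Cc k" for n
    using F H by (auto simp: incl_iff[OF f] incl_iff[OF h] cauchy_seqs_def)
  have F0: "(\<lambda>n. full_dist k f (F n)) \<longlonglongrightarrow> 0" and H0: "(\<lambda>n. full_dist k h (H n)) \<longlonglongrightarrow> 0"
    using F H by (simp_all add: incl_iff[OF f] incl_iff[OF h])
  have "(\<lambda>n. full_dist k f (F n) + full_dist k f h + full_dist k h (H n)) \<longlonglongrightarrow> 0 + full_dist k f h + 0"
    using F0 H0 by (intro tendsto_add tendsto_const)
  moreover have "full_dist k (F n) (H n) \<le> full_dist k f (F n) + full_dist k f h + full_dist k h (H n)" for n
    using full_dist_triangle[OF Fn f Hn, of n n] full_dist_triangle[OF f h Hn, of n]
      full_dist_commute[OF f Fn, of n] by (metis add.assoc add_left_mono order_trans)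
  ultimately have "d \<le> 0 + full_dist k f h + 0" using d by (intro LIMSEQ_le) auto
  moreover have "(\<lambda>n. full_dist k f (F n) + full_dist k (F n) (H n) + full_dist k h (H n)) \<longlonglongrightarrow> 0 + d + 0"
    using F0 H0 d by (intro tendsto_add)
  moreover have "full_dist k f h \<le> full_dist k f (F n) + full_dist k (F n) (H n) + full_dist k h (H n)" for n
    using full_dist_triangle[OF f Fn h, of n] full_dist_triangle[OF Fn Hn h, of n n]
      full_dist_commute[OF h Hn, of n] by (metis add.assoc add_left_mono order_trans)
  ultimately show "d = full_dist k f h"
    by (intro antisym[OF _ LIMSEQ_le_const]) auto
qed

section \<open>The generators of the finite dimensional subalgebras\<close>

lemma closedin_Z_Diff: "closedin (bd_top k) (Z k \<mu> - Z k \<nu>)"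
  and openin_Z_Diff: "openin (bd_top k) (Z k \<mu> - Z k \<nu>)"
  by (intro closedin_diff openin_diff openin_Z closedin_Z)+

lemma Epaths_props:
  assumes "\<mu> \<in> Epaths k i" shows "\<mu> \<in> vLam k 1" "src \<mu> = i + 1" "len \<mu> = i"
  using assms by (auto simp: Epaths_def vLam_def src_def)

lemma beta_pow_in_Lam: "1 \<le> i \<Longrightarrow> beta_pow i q \<in> Lam k"
proof -
  have "admissible k i (replicate q Beta)" for i by (induction q arbitrary: i) auto
  then show "1 \<le> i \<Longrightarrow> beta_pow i q \<in> Lam k"
    by (simp add: Lam_iff beta_pow_def path_def wadm_abs)
qed

lemma rng_beta_pow [simp]: "rng (beta_pow i q) = i" and len_beta_pow [simp]: "len (beta_pow i q) = q"
  by (simp_all add: beta_pow_def)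

lemma Fpaths_props:
  assumes "\<mu> \<in> Fpaths k i" shows "\<mu> \<in> vLam k 1" "src \<mu> = i + 2" "len \<mu> = i + 1"
proof -
  obtain \<eta> q where \<mu>: "\<mu> = mcomp \<eta> (beta_pow (src \<eta>) q)" "\<eta> \<in> Phi k i" "len \<eta> + q = i + 1"
    using assms unfolding Fpaths_def by blast
  have \<eta>: "\<eta> \<in> Lam k" "rng \<eta> = 1" using \<mu>(2) by (auto simp: Phi_def vLam_def vertex_in_Lam)
  then have "beta_pow (src \<eta>) q \<in> Lam k" using src_pos by (intro beta_pow_in_Lam)
  with \<eta> \<mu> show "\<mu> \<in> vLam k 1" "src \<mu> = i + 2" "len \<mu> = i + 1"
    by (auto simp: vLam_def Lam_mcomp src_def)
qed

lemma C_gens_subset_Cc: "C_gens k i \<subseteq> Cc k"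
proof
  fix \<phi> assume "\<phi> \<in> C_gens k i"
  then consider (E) \<nu> \<mu> where "\<nu> \<in> Epaths k i" "\<mu> \<in> Epaths k i"
      "\<phi> = indicator (gset k \<nu> \<mu> (Z k (vertex (i + 1)) - Z k (beta_pow (i + 1) 1)))"
    | (F) \<eta> \<xi> where "\<eta> \<in> Fpaths k i" "\<xi> \<in> Fpaths k i" "\<phi> = indicator (gset k \<eta> \<xi> (Z k (vertex (i + 2))))"
    unfolding C_gens_def by blast
  then show "\<phi> \<in> Cc k"
  proof cases
    case E
    then show ?thesis
      using Epaths_props[OF E(1)] Epaths_props[OF E(2)]
      by (auto intro!: indicator_in_Cc openin_Z_Diff closedin_Z_Diff simp: vbd_eq)
  next
    case F
    then show ?thesis
      using Fpaths_props[OF F(1)] Fpaths_props[OF F(2)]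
      by (auto intro!: indicator_in_Cc openin_Z closedin_Z simp: vbd_eq)
  qed
qed

lemma C_fin_subset_Cc: "C_fin k i \<subseteq> Cc k"
  using C_gens_subset_Cc unfolding C_fin_def by (blast intro: Cc_sum)

section \<open>The infinite path of edges \<beta> as a boundary point\<close>

definition beta_inf :: "nat \<Rightarrow> mor set" where
  "beta_inf i = range (beta_pow i)"

lemma snd_beta_pow: "snd (beta_pow i q) = abs_word (replicate q Beta)"
  by (simp add: beta_pow_def path_def)

lemma letters_beta_pow: "letters (snd (beta_pow i q)) \<subseteq> {Beta}"
  by (auto simp: snd_beta_pow)

lemma letters_beta_inf: "\<mu> \<in> beta_inf i \<Longrightarrow> letters (snd \<mu>) \<subseteq> {Beta}"
  unfolding beta_inf_def by (elim rangeE) (simp only: letters_beta_pow)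

lemma beta_powI:
  assumes "letters (snd \<mu>) \<subseteq> {Beta}" shows "\<mu> = beta_pow (rng \<mu>) (len \<mu>)"
  using letters_Beta[OF assms] by (simp add: beta_pow_def path_def rng_def len_def prod_eq_iff)

lemma mle_letters: "mle \<mu> \<rho> \<Longrightarrow> letters (snd \<mu>) \<subseteq> letters (snd \<rho>)"
  by (auto simp: mle_def mcomp_def letters_append)

lemma beta_pow_add: "mcomp (beta_pow i p) (beta_pow j q) = beta_pow i (p + q)"
  by (simp add: beta_pow_def mcomp_path replicate_add)

lemma src_beta_pow [simp]: "src (beta_pow i q) = i + q"
  by (simp add: src_def)

lemma beta_pow_mono: "p \<le> q \<Longrightarrow> mle (beta_pow i p) (beta_pow i q)"
  using mleI[of "beta_pow (i + p) (q - p)" "beta_pow i p"] by (simp add: beta_pow_add)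

lemma beta_inf_Lstar:
  assumes "1 \<le> i" shows "beta_inf i \<in> Lstar k"
  unfolding Lstar_iff
proof (intro conjI ballI allI impI)
  show "beta_inf i \<subseteq> Lam k" using beta_pow_in_Lam[OF assms] by (auto simp: beta_inf_def)
  show "beta_inf i \<noteq> {}" by (simp add: beta_inf_def)
  fix \<mu> assume "\<mu> \<in> beta_inf i"
  then obtain p where p: "\<mu> = beta_pow i p" unfolding beta_inf_def by blast
  {
    fix \<nu> assume "\<nu> \<in> beta_inf i"
    then obtain q where q: "\<nu> = beta_pow i q" unfolding beta_inf_def by blast
    show "\<exists>\<rho>\<in>beta_inf i. mle \<mu> \<rho> \<and> mle \<nu> \<rho>"
      using beta_pow_mono[of p "max p q" i] beta_pow_mono[of q "max p q" i]
      unfolding p q beta_inf_def by auto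
  next
    fix \<nu> assume \<nu>: "mle \<nu> \<mu>"
    have "letters (snd \<nu>) \<subseteq> {Beta}" using mle_letters[OF \<nu>] letters_beta_pow p by blast
    then have "\<nu> = beta_pow (rng \<nu>) (len \<nu>)" by (rule beta_powI)
    moreover have "rng \<nu> = i" using mle_rng[OF \<nu>] p by simp
    ultimately show "\<nu> \<in> beta_inf i" unfolding beta_inf_def by (metis rangeI)
  }
qed

text \<open>Zorn's lemma within the cylinder of \<mu>: the union of a chain of directed hereditary
  sets is again one. An element maximal there is maximal altogether, since every larger set still
  contains \<mu>.\<close>

lemma Lmax_extends:
  assumes "\<mu> \<in> Lam k" obtains x where "x \<in> Lmax k" "\<mu> \<in> x"
proof -
  have "segments k \<mu> \<in> Zstar k \<mu>"
    using segments_Lstar[OF assms] by (simp add: Zstar_def segments_iff[OF assms])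
  moreover have "\<Union>\<C> \<in> Zstar k \<mu>" if C: "\<C> \<noteq> {}" "subset.chain (Zstar k \<mu>) \<C>" for \<C>
  proof -
    have L: "x \<in> Lstar k" "\<mu> \<in> x" if "x \<in> \<C>" for x
      using C(2) that by (auto simp: subset.chain_def Zstar_def)
    have ch: "x \<subseteq> y \<or> y \<subseteq> x" if "x \<in> \<C>" "y \<in> \<C>" for x y
      using C(2) that by (auto simp: subset_chain_def)
    have "\<exists>\<rho>\<in>\<Union>\<C>. mle \<nu> \<rho> \<and> mle \<nu>' \<rho>" if u: "\<nu> \<in> \<Union>\<C>" "\<nu>' \<in> \<Union>\<C>" for \<nu> \<nu>'
    proof -
      obtain y z where yz: "y \<in> \<C>" "\<nu> \<in> y" "z \<in> \<C>" "\<nu>' \<in> z" using u by blast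
      obtain x where x: "x \<in> \<C>" "\<nu> \<in> x" "\<nu>' \<in> x"
        using ch[OF yz(1,3)] yz by (elim disjE) (blast dest: subsetD)+
      obtain \<rho> where "\<rho> \<in> x" "mle \<nu> \<rho>" "mle \<nu>' \<rho>" using Lstar_directed[OF L(1)[OF x(1)] x(2,3)] .
      then show ?thesis using x(1) by blast
    qed
    moreover have "\<Union>\<C> \<subseteq> Lam k" using L(1) Lstar_Lam by blast
    moreover have "\<nu> \<in> \<Union>\<C>" if "\<rho> \<in> \<Union>\<C>" "mle \<nu> \<rho>" for \<rho> \<nu> using that L(1) Lstar_down by blast
    moreover have "\<mu> \<in> \<Union>\<C>" using C(1) L(2) by blast
    ultimately show ?thesis unfolding Zstar_def Lstar_iff by blast
  qed
  ultimately obtain x where x: "x \<in> Zstar k \<mu>" "\<And>y. y \<in> Zstar k \<mu> \<Longrightarrow> x \<subseteq> y \<Longrightarrow> y = x"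
    using subset_Zorn_nonempty[of "Zstar k \<mu>"] by blast
  then have "x \<in> Lmax k" by (auto simp: Lmax_def Zstar_def)
  with x(1) that show thesis by (auto simp: Zstar_def)
qed

text \<open>The first block of \<open>d\<close> is \<beta>^n closed by \<gamma>. A prefix of
  \<open>d\<close> either stays inside that block, so that it is a power of \<beta>, or contains the
  whole block and is longer than \<open>n\<close>.\<close>

lemma nle_beta_gamma:
  assumes "nle c d" "nle (Blk 0 n j (Fin 0 0)) d" "c = nform_of w" "length w \<le> n"
  shows "set w \<subseteq> {Beta}"
proof (cases c)
  case (Fin a b)
  then have "a = 0" using assms(1,2) by (cases d) auto
  then have "nform_of w = nform_of (replicate b Beta)"
    using Fin assms(3) by (simp add: nform_of_replicate_Beta)
  then have "abs_word w = abs_word (replicate b Beta)"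
    using nform_eq_iff nform_abs by metis
  then have "letters (abs_word w) = letters (abs_word (replicate b Beta))" by simp
  then show ?thesis by auto
next
  case (Blk a b j' e)
  then obtain e' where "d = Blk 0 n j e'" "a = 0" "b = n" using assms(1,2) by (cases d) auto
  then have "nform_of w = nform_of (flat (Blk 0 n j' e))" using Blk assms(3) by (simp only: nform_of_flat)
  then have "abs_word w = abs_word (flat (Blk 0 n j' e))" using nform_eq_iff nform_abs by metis
  then have "word_length (abs_word w) = word_length (abs_word (flat (Blk 0 n j' e)))" by simp
  then show ?thesis using assms(4) by simp
qed

text \<open>
  \<open>\<beta>\<^sup>\<infinity>\<close> is not maximal, being contained in \<open>{\<alpha>\<^sup>p\<beta>\<^sup>q}\<close>; it is a limit of maximal elements
  containing \<open>\<beta>\<^sup>n\<gamma>\<close>, since no such element contains a path of length at most \<open>n\<close> other than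
  powers of \<open>\<beta>\<close>.
\<close>

lemma beta_inf_bd:
  assumes k: "infinite {i. 1 \<le> i \<and> 0 < k i}" and i: "1 \<le> i"
  shows "beta_inf i \<in> bd k"
  unfolding in_bd_iff
proof (intro conjI allI impI)
  show "beta_inf i \<in> Lstar k" using i by (rule beta_inf_Lstar)
  have "\<exists>x\<in>Lmax k. beta_pow i n \<in> x \<and> (\<forall>\<mu>\<in>x. len \<mu> \<le> n \<longrightarrow> \<mu> \<in> beta_inf i)" for n
  proof -
    \<comment> \<open>The hypothesis on \<open>k\<close> enters here: some level from i + n on
      carries an edge \<gamma>, and m - i edges \<beta> lead from v_i to it.\<close>
    obtain m where m: "i + n \<le> m" "0 < k m"
      using k by (metis (no_types, lifting) infinite_nat_iff_unbounded_le mem_Collect_eq)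
    define N where "N = m - i"
    define \<rho> where "\<rho> = path i (replicate N Beta @ [Gamma 1])"
    have N: "n \<le> N" "i + N = m" using m by (auto simp: N_def)
    have adm: "admissible k i (replicate q Beta)" for q i by (induction q arbitrary: i) auto
    have "\<rho> \<in> Lam k"
      using i m(2) adm N(2) by (auto simp: \<rho>_def Lam_iff path_def wadm_abs admissible_append)
    then obtain x where x: "x \<in> Lmax k" "\<rho> \<in> x" by (rule Lmax_extends)
    have xL: "x \<in> Lstar k" using x(1) by (simp add: Lmax_def)
    have nr: "nform (snd \<rho>) = Blk 0 N 1 (Fin 0 0)"
      by (simp add: \<rho>_def path_def nform_of_append nform_of_replicate_Beta nform_of_Gamma)
        (simp add: nform_of_def)
    have "\<mu> \<in> beta_inf i" if \<mu>: "\<mu> \<in> x" "len \<mu> \<le> n" for \<mu>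
    proof -
      obtain \<kappa> where \<kappa>: "mle \<mu> \<kappa>" "mle \<rho> \<kappa>" using Lstar_directed[OF xL \<mu>(1) x(2)] by blast
      obtain w where w: "snd \<mu> = abs_word w" by (rule abs_word_cases)
      have "set w \<subseteq> {Beta}"
      proof (rule nle_beta_gamma)
        show "nle (nform_of w) (nform (snd \<kappa>))" "nle (Blk 0 N 1 (Fin 0 0)) (nform (snd \<kappa>))"
          using \<kappa> nr w by (simp_all add: mle_wle wle_nform)
        show "length w \<le> N" using \<mu>(2) w N(1) by (simp add: len_def)
      qed simp
      then have "\<mu> = beta_pow (rng \<mu>) (len \<mu>)" using w by (intro beta_powI) simp
      moreover have "rng \<mu> = i" using Lstar_rng[OF xL \<mu>(1) x(2)] by (simp add: \<rho>_def)
      ultimately show ?thesis unfolding beta_inf_def by (metis rangeI)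
    qed
    moreover have "mle (beta_pow i n) \<rho>"
    proof -
      have "\<rho> = mcomp (beta_pow i N) (path (i + N) [Gamma 1])"
        by (simp add: \<rho>_def beta_pow_def mcomp_path)
      then have "mle (beta_pow i N) \<rho>" using mleI[of "path (i + N) [Gamma 1]" "beta_pow i N"] by simp
      then show ?thesis using beta_pow_mono[OF N(1)] mle_trans by blast
    qed
    ultimately show ?thesis using x Lstar_down[OF xL] by blast
  qed
  then obtain x where x: "\<And>n. x n \<in> Lmax k" "\<And>n. beta_pow i n \<in> x n"
    "\<And>n \<mu>. \<mu> \<in> x n \<Longrightarrow> len \<mu> \<le> n \<Longrightarrow> \<mu> \<in> beta_inf i" by metis
  have xL: "x n \<in> Lstar k" for n using x(1) by (simp add: Lmax_def)
  fix U assume U: "openin (Lstar_top k) U \<and> beta_inf i \<in> U"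
  then have "generate_topology_on
      {Zstar k \<rho> - (\<Union>\<mu>\<in>M. Zstar k \<mu>) | \<rho> M. \<rho> \<in> Lam k \<and> finite M \<and> M \<subseteq> Lam k} U"
    unfolding Lstar_top_def by (blast intro: openin_topology_generated_by)
  \<comment> \<open>Convergence is proved along the generation of the topology. Membership for all
    large \<open>n\<close>, not just for one, is what survives finite intersections.\<close>
  then have "beta_inf i \<in> U \<longrightarrow> (\<exists>N. \<forall>n\<ge>N. x n \<in> U)"
  proof induction
    case (Int a b)
    show ?case
    proof
      assume "beta_inf i \<in> a \<inter> b"
      then obtain N N' where "\<forall>n\<ge>N. x n \<in> a" "\<forall>n\<ge>N'. x n \<in> b" using Int.IH by blast
      then show "\<exists>N. \<forall>n\<ge>N. x n \<in> a \<inter> b" by (intro exI[of _ "max N N'"]) auto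
    qed
  next
    case (Basis s)
    then obtain \<rho> M where s: "s = Zstar k \<rho> - (\<Union>\<mu>\<in>M. Zstar k \<mu>)" "finite M" by blast
    show ?case
    proof
      assume b: "beta_inf i \<in> s"
      then obtain p where p: "\<rho> = beta_pow i p" by (auto simp: s(1) Zstar_def beta_inf_def)
      have M: "\<mu> \<notin> beta_inf i" if "\<mu> \<in> M" for \<mu>
        using b that beta_inf_Lstar[OF i] by (auto simp: s(1) Zstar_def)
      \<comment> \<open>From \<open>p\<close> on, \<open>x n\<close> contains \<open>\<rho>\<close>.
        The lengths of the members of \<open>M\<close> are included so that all of these, not being
        powers of \<beta>, are excluded from \<open>x n\<close>.\<close>
      define N where "N = Max (insert p (len ` M))"
      have "x n \<in> s" if n: "n \<ge> N" for n
      proof -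
        have "p \<le> n" "\<And>\<mu>. \<mu> \<in> M \<Longrightarrow> len \<mu> \<le> n"
          using n s(2) by (auto simp: N_def)
        then have "\<mu> \<notin> x n" if "\<mu> \<in> M" for \<mu> using M x(3) that by blast
        moreover have "\<rho> \<in> x n"
          using Lstar_down[OF xL x(2)] beta_pow_mono[OF \<open>p \<le> n\<close>] p by blast
        ultimately show ?thesis using xL by (auto simp: s(1) Zstar_def)
      qed
      then show "\<exists>N. \<forall>n\<ge>N. x n \<in> s" by blast
    qed
  qed blast+
  then show "\<exists>y\<in>Lmax k. y \<in> U" using U x(1) by blast
qed

lemma act_beta_inf:
  assumes "1 \<le> i" shows "act k (beta_pow i q) (beta_inf (i + q)) = beta_inf i"
proof -
  have y: "beta_inf i \<in> Zstar k (beta_pow i q)"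
    using beta_inf_Lstar[OF assms] by (auto simp: Zstar_def beta_inf_def)
  have "shift (beta_pow i q) (beta_inf i) = beta_inf (i + q)"
  proof (intro set_eqI iffI)
    fix \<nu> assume "\<nu> \<in> shift (beta_pow i q) (beta_inf i)"
    then have r: "rng \<nu> = i + q" and m: "mcomp (beta_pow i q) \<nu> \<in> beta_inf i" by (auto simp: shift_def)
    have "letters (snd (mcomp (beta_pow i q) \<nu>)) \<subseteq> {Beta}"
      using m by (rule letters_beta_inf)
    then have "letters (snd \<nu>) \<subseteq> {Beta}" by (simp add: mcomp_def letters_append)
    then show "\<nu> \<in> beta_inf (i + q)" using beta_powI r unfolding beta_inf_def by (metis rangeI)
  next
    fix \<nu> assume "\<nu> \<in> beta_inf (i + q)"
    then show "\<nu> \<in> shift (beta_pow i q) (beta_inf i)"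
      by (auto simp: shift_def beta_inf_def beta_pow_add)
  qed
  then show ?thesis using act_shift[OF y] by simp
qed

lemma path_Alpha_in_vLam: "path 1 [Alpha] \<in> vLam k 1" and path_Beta_in_vLam: "path 1 [Beta] \<in> vLam k 1"
  by (simp_all add: vLam_def Lam_iff path_def wadm_abs rng_def)

lemma path_Beta: "path i [Beta] = beta_pow i 1"
  by (simp add: beta_pow_def)

definition alpha_beta_inf :: "(nat \<Rightarrow> nat) \<Rightarrow> mor set" where
  "alpha_beta_inf k = act k (path 1 [Alpha]) (beta_inf 2)"

lemma beta_inf_Zstar: "1 \<le> i \<Longrightarrow> beta_inf i \<in> Zstar k (vertex i)"
  using beta_inf_Lstar by (auto simp: Zstar_vertex beta_inf_def)

text \<open>Serves to rule out every path of \<open>Fpaths\<close> whose part in \<open>Phi\<close>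
  ends in an edge \<gamma>.\<close>

lemma alpha_beta_inf_no_Gamma:
  assumes "\<mu> \<in> alpha_beta_inf k" shows "letters (snd \<mu>) \<subseteq> {Alpha, Beta}"
proof -
  have "path 1 [Alpha] \<in> Lam k" "beta_inf 2 \<in> Zstar k (vertex (src (path 1 [Alpha])))"
    using path_Alpha_in_vLam beta_inf_Zstar[of 2] by (auto simp: vLam_def numeral_2_eq_2)
  then obtain \<nu> where \<nu>: "\<nu> \<in> beta_inf 2" "mle \<mu> (mcomp (path 1 [Alpha]) \<nu>)"
    using assms by (auto simp: alpha_beta_inf_def act_iff)
  have "letters (snd \<nu>) \<subseteq> {Beta}" using \<nu>(1) by (rule letters_beta_inf)
  then show ?thesis using mle_letters[OF \<nu>(2)] by (auto simp: mcomp_def letters_append path_def)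
qed

lemma alpha_in_alpha_beta_inf: "path 1 [Alpha] \<in> alpha_beta_inf k"
  using path_Alpha_in_vLam beta_inf_Zstar[of 2]
  by (auto simp: alpha_beta_inf_def vLam_def numeral_2_eq_2 intro!: in_act)

lemma alpha_notin_beta_inf: "path 1 [Alpha] \<notin> beta_inf i"
proof
  assume "path 1 [Alpha] \<in> beta_inf i"
  then have "letters (snd (path 1 [Alpha])) \<subseteq> {Beta}" by (rule letters_beta_inf)
  then show False by (simp add: path_def)
qed

lemma C_gens_vanish:
  assumes \<phi>: "\<phi> \<in> C_gens k i" and g: "grng k g = alpha_beta_inf k" "gsrc k g = beta_inf 1"
  shows "\<phi> g = 0"
proof (rule ccontr)
  assume nz: "\<phi> g \<noteq> 0"
  \<comment> \<open>Since \<mu> belongs to \<mu>x, it is a power of \<beta>. The infinite path of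
    edges \<beta> from s(\<mu>) then has the same image as \<open>x\<close> under
    \<open>act k \<mu>\<close>, and injectivity identifies the two. This fixes the coordinate of
    \<open>g\<close> for both kinds of generators.\<close>
  have beta_prefix: "\<mu> = beta_pow 1 (len \<mu>)" "x = beta_inf (src \<mu>)"
    if \<mu>: "\<mu> \<in> vLam k 1" "x \<in> vbd k (src \<mu>)" "act k \<mu> x = beta_inf 1" for \<mu> x
  proof -
    have L: "\<mu> \<in> Lam k" "rng \<mu> = 1" using \<mu>(1) by (auto simp: vLam_def)
    have "\<mu> \<in> beta_inf 1" using in_act[OF L(1) vbd_Zstar[OF \<mu>(2)]] \<mu>(3) by simp
    then show e: "\<mu> = beta_pow 1 (len \<mu>)" by (auto simp: beta_inf_def)
    have s: "src \<mu> = 1 + len \<mu>" using L(2) by (simp add: src_def)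
    have "act k \<mu> (beta_inf (src \<mu>)) = beta_inf 1" using act_beta_inf[of 1 k "len \<mu>"] e s by simp
    moreover have "beta_inf (src \<mu>) \<in> Zstar k (vertex (src \<mu>))" using s by (intro beta_inf_Zstar) simp
    ultimately show "x = beta_inf (src \<mu>)"
      using shift_act[OF L(1)] vbd_Zstar[OF \<mu>(2)] \<mu>(3) by metis
  qed
  consider (E) \<nu> \<mu> where "\<nu> \<in> Epaths k i" "\<mu> \<in> Epaths k i"
      "\<phi> = indicator (gset k \<nu> \<mu> (Z k (vertex (i + 1)) - Z k (beta_pow (i + 1) 1)))"
    | (F) \<eta> \<xi> where "\<eta> \<in> Fpaths k i" "\<xi> \<in> Fpaths k i" "\<phi> = indicator (gset k \<eta> \<xi> (Z k (vertex (i + 2))))"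
    using \<phi> unfolding C_gens_def by blast
  then show False
  proof cases
    case E
    note p = Epaths_props[OF E(1)] Epaths_props[OF E(2)]
    obtain x where x: "x \<in> Z k (vertex (i + 1))" "x \<notin> Z k (beta_pow (i + 1) 1)" "g = gclass k (\<nu>, \<mu>, x)"
      using nz by (auto simp: E(3) gset_def indicator_def split: if_splits)
    have v: "x \<in> vbd k (src \<mu>)" using x(1) p by (simp add: vbd_eq)
    have t: "(\<nu>, \<mu>, x) \<in> triples k" using p v by (auto simp: triples_def)
    have "x = beta_inf (i + 1)" using beta_prefix(2)[OF p(4) v] g(2) x(3) gsrc_gclass[OF t] p(5) by simp
    then show False using x(1,2) by (auto simp: Z_def beta_inf_def)
  next
    case F
    note p = Fpaths_props[OF F(1)] Fpaths_props[OF F(2)]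
    obtain x where x: "x \<in> Z k (vertex (i + 2))" "g = gclass k (\<eta>, \<xi>, x)"
      using nz by (auto simp: F(3) gset_def indicator_def split: if_splits)
    have v: "x \<in> vbd k (src \<xi>)" using x(1) p by (simp add: vbd_eq)
    have t: "(\<eta>, \<xi>, x) \<in> triples k" using p v by (auto simp: triples_def)
    have xb: "x = beta_inf (i + 2)" using beta_prefix(2)[OF p(4) v] g(2) x(2) gsrc_gclass[OF t] p(5) by simp
    have z: "act k \<eta> x = alpha_beta_inf k" using g(1) x(2) grng_gclass[OF t] by simp
    have "\<eta> \<in> Lam k" "x \<in> Zstar k (vertex (src \<eta>))" using p v vbd_Zstar by (auto simp: vLam_def)
    then have "\<eta> \<in> alpha_beta_inf k" using in_act z by metis
    then have lt: "letters (snd \<eta>) \<subseteq> {Alpha, Beta}" by (rule alpha_beta_inf_no_Gamma)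
    obtain \<eta>' q where \<eta>: "\<eta> = mcomp \<eta>' (beta_pow (src \<eta>') q)" "\<eta>' \<in> Phi k i" "len \<eta>' + q = i + 1"
      using F(1) unfolding Fpaths_def by blast
    have "\<eta>' = vertex 1"
    proof (rule ccontr)
      assume "\<eta>' \<noteq> vertex 1"
      then obtain \<mu> \<epsilon> where \<epsilon>: "\<epsilon> \<in> Lam2 k" "len \<epsilon> = 1" "\<eta>' = mcomp \<mu> \<epsilon>"
        using \<eta>(2) unfolding Phi_def by blast
      then obtain l w where w: "\<epsilon> = path l w" "set w \<subseteq> range Gamma" unfolding Lam2_def by blast
      have "letters (snd \<epsilon>) \<subseteq> {Alpha, Beta}"
        using lt by (simp add: \<eta>(1) \<epsilon>(3) mcomp_def letters_append)
      then have "set w \<subseteq> {Alpha, Beta}" by (simp add: w(1) path_def)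
      then show False using \<epsilon>(2) w by (cases w) auto
    qed
    \<comment> \<open>With v_1 as the only possible part in \<open>Phi\<close>, all i + 1 edges of
      \<open>\<eta>\<close> are \<beta>. The range of \<open>g\<close> would then be
      \<open>beta_inf 1\<close>, which does not contain the edge \<alpha>.\<close>
    then have "\<eta> = beta_pow 1 (i + 1)"
      using \<eta> vertex_mcomp[of "beta_pow 1 q" 1] by (simp add: vertex_def)
    then have "act k \<eta> x = beta_inf 1" using act_beta_inf[of 1 k "i + 1"] xb by simp
    then show False using z alpha_in_alpha_beta_inf alpha_notin_beta_inf by metis
  qed
qed

lemma C_fin_vanish:
  assumes "c \<in> C_fin k i" "grng k g = alpha_beta_inf k" "gsrc k g = beta_inf 1"
  shows "c g = 0"
proof -
  obtain A d where "c = (\<lambda>g. \<Sum>\<phi>\<in>A. d \<phi> * \<phi> g)" "A \<subseteq> C_gens k i"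
    using assms(1) unfolding C_fin_def by blast
  then show ?thesis using C_gens_vanish[OF _ assms(2,3)] by (auto intro!: sum.neutral)
qed

definition alpha_beta_swap :: "(nat \<Rightarrow> nat) \<Rightarrow> gfun" where
  "alpha_beta_swap k = indicator (gset k (path 1 [Alpha]) (path 1 [Beta]) (Z k (vertex 2)))"

lemma alpha_beta_swap_in_Cc: "alpha_beta_swap k \<in> Cc k"
  unfolding alpha_beta_swap_def
  by (intro indicator_in_Cc path_Alpha_in_vLam path_Beta_in_vLam openin_Z closedin_Z)
    (auto simp: vbd_eq numeral_2_eq_2)

text \<open>The coordinate at \<open>?z\<close> of the image of the unit vector at \<open>?y\<close>
  is a sum over all groupoid elements with that source and range, whatever the isotropy.
  \<open>c\<close> vanishes at each of them, and the bisection contains exactly one, so the value is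
  1.\<close>

lemma full_dist_alpha_beta_swap:
  assumes k: "infinite {i. 1 \<le> i \<and> 0 < k i}" and c: "c \<in> C_fin k i"
  shows "1 \<le> full_dist k (alpha_beta_swap k) c"
proof -
  let ?f = "\<lambda>g. alpha_beta_swap k g - c g"
  let ?y = "point (beta_inf 1)" and ?z = "point (alpha_beta_inf k)"
  let ?\<delta> = "\<lambda>j. if j = ?y then 1 else 0 :: complex"
  let ?t = "(path 1 [Alpha], path 1 [Beta], beta_inf 2)"
  let ?h = "gclass k ?t"
  have cC: "c \<in> Cc k" using c C_fin_subset_Cc by blast
  then have fC: "?f \<in> Cc k" using alpha_beta_swap_in_Cc Cc_diff by blast
  \<comment> \<open>Membership in the boundary makes \<open>?t\<close> a triple, so that the value 1
    is taken at an actual element of the groupoid.\<close>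
  have b2: "beta_inf 2 \<in> Z k (vertex 2)"
    using beta_inf_bd[OF k, of 2] by (auto simp: Z_eq intro: beta_inf_Zstar)
  then have t: "?t \<in> triples k"
    using path_Alpha_in_vLam path_Beta_in_vLam by (auto simp: triples_def vbd_eq numeral_2_eq_2)
  have hr: "grng k ?h = alpha_beta_inf k" and hs: "gsrc k ?h = beta_inf 1"
    using grng_gclass[OF t] gsrc_gclass[OF t] act_beta_inf[of 1 k 1]
    by (simp_all add: alpha_beta_inf_def path_Beta numeral_2_eq_2)
  have hin: "?h \<in> gset k (path 1 [Alpha]) (path 1 [Beta]) (Z k (vertex 2))"
    using b2 by (auto simp: gset_def)
  have fh: "?f ?h = 1"
    using hin C_fin_vanish[OF c hr hs] by (simp add: alpha_beta_swap_def)
  have hG: "?h \<in> G k" using t by (auto simp: G_def)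
  have zero: "?f g * ?\<delta> (point (gsrc k g)) = 0"
    if g: "g \<in> G k" "point (grng k g) = ?z" "g \<noteq> ?h" for g
  proof (cases "gsrc k g = beta_inf 1")
    case True
    have "g \<notin> gset k (path 1 [Alpha]) (path 1 [Beta]) (Z k (vertex 2))"
      using gset_unique[OF path_Alpha_in_vLam path_Beta_in_vLam _ _ _ hin] g(3) True hs
      by (auto simp: vbd_eq numeral_2_eq_2)
    then show ?thesis
      using C_fin_vanish[OF c _ True] g(2) by (simp add: alpha_beta_swap_def inj_point)
  qed (simp add: inj_point)
  have "gpd.op k ?f ?\<delta> ?z = (\<Sum>\<^sub>\<infinity>g\<in>{?h}. ?f g * ?\<delta> (point (gsrc k g)))"
    unfolding gpd.op_def using zero hG hr by (intro infsum_cong_neutral) auto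
  also have "\<dots> = 1" using fh hs by simp
  finally have one: "gpd.op k ?f ?\<delta> ?z = 1" .
  have "gpd.op k ?f ?\<delta> \<in> ell2" using star_repD(1)[OF star_rep_op fC ell2_point(1)] .
  from ell2_coordinate_le[OF this, of ?z] have "1 \<le> ell2_norm (gpd.op k ?f ?\<delta>)"
    unfolding one by simp
  from ennreal_leI[OF this] have "1 \<le> ennreal (ell2_norm (gpd.op k ?f ?\<delta>))"
    unfolding ennreal_1 .
  also have "\<dots> \<le> full_norm k ?f" by (rule full_norm_ge[OF star_rep_op ell2_point])
  finally show ?thesis by (simp add: full_dist_def)
qed

theorem theorem8p6:
  fixes k :: "nat \<Rightarrow> nat"
  assumes "infinite {i. 1 \<le> i \<and> 0 < k i}"
  shows "C_AF k \<subset> Cstar k"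
proof
  show "C_AF k \<subseteq> Cstar k" by (auto simp: C_AF_def Cstar_closure_def)
  let ?f = "alpha_beta_swap k"
  have "incl k ?f \<notin> C_AF k"
  proof
    assume "incl k ?f \<in> C_AF k"
    then have "\<exists>c\<in>\<Union>i. incl k ` C_fin k i. Cstar_dist k (incl k ?f) c < 1"
      by (simp add: C_AF_def Cstar_closure_def)
    then obtain i c where c: "c \<in> C_fin k i" "Cstar_dist k (incl k ?f) (incl k c) < 1" by blast
    then have "full_dist k ?f c < 1"
      using Cstar_dist_incl[OF alpha_beta_swap_in_Cc] C_fin_subset_Cc by (metis subsetD)
    then show False using full_dist_alpha_beta_swap[OF assms c(1)] by simp
  qed
  then show "C_AF k \<noteq> Cstar k" using incl_in_Cstar[OF alpha_beta_swap_in_Cc] by blast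
qed

end
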